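(* Let $\Omega,\Omega_1,\Omega_2$ be minimal aperiodic tiling spaces in $\mathbb{R}^d$ (not assumed to have finite local complexity), and let $h_i:\Omega\to\Omega_i$, $i\in\{1,2\}$, be two orbit equivalences. (1) If $[h_1]=[h_2]$ as elements of the weak cohomology $H^1_w(\Omega;\mathbb{R}^d)$, then there exists a continuous $s:\Omega\to\mathbb{R}^d$ such that $\tau_s:T\mapsto T-s(T)$ is a homeomorphism of $\Omega$, and there exists a topological conjugacy $\phi:\Omega_1\to\Omega_2$ such that $h_2\circ\tau_s=\phi\circ h_1$. (2) If the tiling spaces have finite local complexity (FLC) and $[h_1]=[h_2]$ in the strong cohomology $H^1_s(\Omega;\mathbb{R}^d)$, then the same conclusion holds with $\phi$ an MLD map.
   Context: **Tiling spaces.** A tile is a convex polytope in $\mathbb{R}^d$ with non-empty interior, possibly carrying a label in a compact metric space; the set of prototiles (tiles up to translation) is compact. A tiling is a collection of tiles covering $\mathbb{R}^d$, any two of which meet only along their boundaries. A Delone set is a uniformly discrete and relatively dense subset of $\mathbb{R}^d$, possibly labelled. Tilings and labelled Delone sets are used interchangeably. $\mathbb{R}^d$ acts by translation, $T\mapsto T-x$. The patch $T\cap B(x,R)$ is the set of labelled tiles meeting $B(x,R)$ (for Delone sets: labelled points in $B(x,R)$). Two tilings (Delone sets) are $\varepsilon$-close if on a ball of radius about $1/\varepsilon$ around the origin there is a one-to-one correspondence between their tiles (points), corresponding tiles being $\varepsilon$-close in Hausdorff distance (points being $\varepsilon$-close) with $\varepsilon$-close labels. A tiling space is a compact translation-invariant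 set of tilings (or labelled Delone sets). It is minimal if every $\mathbb{R}^d$-orbit is dense, aperiodic if $T-x=T$ implies $x=0$ for each of its elements, FLC if for each $R$ there are finitely many patches of radius $R$ up to translation. **Maps.** An orbit equivalence is a homeomorphism sending $\mathbb{R}^d$-orbits to $\mathbb{R}^d$-orbits (every homeomorphism of aperiodic minimal FLC tiling spaces is one). A factor map is a continuous onto map $\phi$ with $\phi(T-x)=\phi(T)-x$; a topological conjugacy is a factor map that is a homeomorphism. A local derivation between FLC tiling spaces is a factor map such that for all $r>0$ there is $R>0$ with: $T\cap B(0,R)=T'\cap B(0,R)$ implies $\phi(T)\cap B(0,r)=\phi(T')\cap B(0,r)$. An MLD map is a local derivation that is a homeomorphism whose inverse is a local derivation. **Weak cohomology and weak class.** A weak 1-cocycle is a continuous $\alpha:\Omega\times\mathbb{R}^d\to\mathbb{R}^d$ with $\alpha(T,x)+\alpha(T-x,y)=\alpha(T,x+y)$; it is a weak coboundary if $\alpha(T,v)=s(T-v)-s(T)$ with $s:\Omega\to\mathbb{R}^d$ continuous. $H^1_w(\Omega;\mathbb{R}^d)$ is the quotient. For an orbit equivalence $h:\Omega\to\Omega'$, define $h_T(x)$ by $h(T-x)=h(T)-h_T(x)$ (well-defined by aperiodicity); the weak class $[h]\in H^1_w(\Omega;\mathbb{R}^d)$ is the class of $(T,v)\mapsto h_T(v)$. **Strong cohomology and strong class (FLC case).** The canonical transversal of a space of Delone sets is the set of its elements containing the origin; an FLC transversal of $\Omega$ is $\mathcal{D}^{-1}(\Xi')$, where $\mathcal{D}:\Omega\to\Omega_0$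 is a local derivation to a space of Delone sets with canonical transversal $\Xi'$. A function on $\Omega$ is transversally locally constant if its restriction to every FLC transversal is locally constant. A strong 1-cocycle is a weak 1-cocycle $\alpha$ with $\alpha(\cdot,v)$ transversally locally constant for each $v$; a strong coboundary is $\alpha(T,v)=s(T-v)-s(T)$ with $s$ continuous and transversally locally constant. The quotient $H^1_s(\Omega;\mathbb{R}^d)$ is canonically isomorphic to $\check H^1(\Omega;\mathbb{R}^d)$: on an open flow box $U=\{S-x: S\in\Xi, |x|<\varepsilon\}$ ($\Xi$ an FLC transversal) put $c_U(S-x)=\alpha(S,x)$; the differences $c_U-c_V$ on overlaps are locally constant and form the Čech cocycle. The fundamental shape class $[\mathcal{F}(\Omega)]$ is the class of $\mathcal{F}(T,v)=v$. The strong class of a homeomorphism $h:\Omega\to\Omega'$ is $[h]:=h^*[\mathcal{F}(\Omega')]$, with $h^*$ the pullback in Čech cohomology. *)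

theory Defs
  imports "HOL-Analysis.Analysis"
begin

section \<open>Tilings and labelled Delone sets\<close>

text \<open>
  A labelled tile is a pair of a subset of the Euclidean space and a label.  A labelled point
  \<open>x\<close> of a Delone set is the labelled tile whose underlying set is \<open>{x}\<close>.  This covers tilings and
  Delone sets uniformly: the Hausdorff distance of singletons is the distance of the points,
  and \<open>{x}\<close> meets a ball iff \<open>x\<close> lies in it.  Unlabelled objects have a constant label.
\<close>

type_synonym ('a, 'l) tile = "'a set \<times> 'l"
type_synonym ('a, 'l) tiling = "('a, 'l) tile set"

definition translate :: "('a::euclidean_space, 'l) tiling \<Rightarrow> 'a \<Rightarrow> ('a, 'l) tiling"
    (infixl \<open>\<ominus>\<close> 65) where
  "T \<ominus> x = (\<lambda>(t, l). ((\<lambda>y. y - x) ` t, l)) ` T"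

definition is_tiling :: "('a::euclidean_space, 'l) tiling \<Rightarrow> bool" where
  "is_tiling T \<longleftrightarrow>
     (\<forall>(t, l)\<in>T. polytope t \<and> interior t \<noteq> {}) \<and>
     (\<Union>(t, l)\<in>T. t) = UNIV \<and>
     (\<forall>p\<in>T. \<forall>q\<in>T. p \<noteq> q \<longrightarrow> fst p \<inter> fst q \<subseteq> frontier (fst p) \<inter> frontier (fst q))"

definition relatively_dense :: "'a::metric_space set \<Rightarrow> bool" where
  "relatively_dense X \<longleftrightarrow> (\<exists>R. \<forall>y. \<exists>x\<in>X. dist x y \<le> R)"

definition is_delone :: "('a::euclidean_space, 'l) tiling \<Rightarrow> bool" where
  "is_delone T \<longleftrightarrow>
     (\<exists>X label. uniform_discrete X \<and> relatively_dense X \<and> T = (\<lambda>x. ({x}, label x)) ` X)"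

definition patch :: "('a::euclidean_space, 'l) tiling \<Rightarrow> 'a \<Rightarrow> real \<Rightarrow> ('a, 'l) tiling" where
  "patch T x R = {(t, l) \<in> T. t \<inter> ball x R \<noteq> {}}"

definition hausdorff_dist :: "'a::metric_space set \<Rightarrow> 'a set \<Rightarrow> real" where
  "hausdorff_dist S T = max (SUP x\<in>S. infdist x T) (SUP y\<in>T. infdist y S)"

definition tile_dist ::
    "('a::euclidean_space, 'l::metric_space) tile \<Rightarrow> ('a, 'l) tile \<Rightarrow> real" where
  "tile_dist p q = max (hausdorff_dist (fst p) (fst q)) (dist (snd p) (snd q))"

text \<open>
  The correspondence is allowed to involve tiles slightly outside the ball of radius \<open>1 / \<epsilon>\<close>,
  since a tile meeting the ball near its boundary may correspond to one that just misses it.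
\<close>

definition tilings_close ::
    "real \<Rightarrow> ('a::euclidean_space, 'l::metric_space) tiling \<Rightarrow> ('a, 'l) tiling \<Rightarrow> bool" where
  "tilings_close \<epsilon> T T' \<longleftrightarrow>
     (\<exists>A A' f. patch T 0 (1 / \<epsilon>) \<subseteq> A \<and> A \<subseteq> T \<and> patch T' 0 (1 / \<epsilon>) \<subseteq> A' \<and> A' \<subseteq> T' \<and>
        bij_betw f A A' \<and> (\<forall>p\<in>A. tile_dist p (f p) < \<epsilon>))"

definition tiling_topology ::
    "('a::euclidean_space, 'l::metric_space) tiling set \<Rightarrow> ('a, 'l) tiling topology" where
  "tiling_topology \<Omega> = topology (\<lambda>U. U \<subseteq> \<Omega> \<and>
     (\<forall>T\<in>U. \<exists>\<epsilon>>0. \<forall>T'\<in>\<Omega>. tilings_close \<epsilon> T T' \<longrightarrow> T' \<in> U))"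

lemma tilings_close_mono:
  assumes "tilings_close \<epsilon> T T'" "0 < \<epsilon>" "\<epsilon> \<le> \<delta>"
  shows "tilings_close \<delta> T T'"
proof -
  have "1 / \<delta> \<le> 1 / \<epsilon>"
    using assms by (simp add: frac_le)
  then have sub: "patch S 0 (1 / \<delta>) \<subseteq> patch S 0 (1 / \<epsilon>)" for S :: "('a, 'b) tiling"
    using subset_ball[of "1 / \<delta>" "1 / \<epsilon>" "0 :: 'a"] unfolding patch_def by blast
  obtain A A' f where "patch T 0 (1 / \<epsilon>) \<subseteq> A" "A \<subseteq> T" "patch T' 0 (1 / \<epsilon>) \<subseteq> A'" "A' \<subseteq> T'"
      "bij_betw f A A'" "\<forall>p\<in>A. tile_dist p (f p) < \<epsilon>"
    using assms(1) unfolding tilings_close_def by blast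
  moreover from this have "\<forall>p\<in>A. tile_dist p (f p) < \<delta>"
    using assms(3) by (meson less_le_trans)
  ultimately show ?thesis
    unfolding tilings_close_def using sub[of T] sub[of T'] by (meson subset_trans)
qed

lemma openin_tiling_topology:
  "openin (tiling_topology \<Omega>) U \<longleftrightarrow> U \<subseteq> \<Omega> \<and>
     (\<forall>T\<in>U. \<exists>\<epsilon>>0. \<forall>T'\<in>\<Omega>. tilings_close \<epsilon> T T' \<longrightarrow> T' \<in> U)"
proof -
  define L where "L = (\<lambda>U. U \<subseteq> \<Omega> \<and>
     (\<forall>T\<in>U. \<exists>\<epsilon>>0. \<forall>T'\<in>\<Omega>. tilings_close \<epsilon> T T' \<longrightarrow> T' \<in> U))"
  have "L (S \<inter> S')" if S: "L S" and S': "L S'" for S S'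
    unfolding L_def
  proof (intro conjI ballI)
    show "S \<inter> S' \<subseteq> \<Omega>" using S unfolding L_def by auto
    fix T assume T: "T \<in> S \<inter> S'"
    obtain \<epsilon> where \<epsilon>: "\<epsilon> > 0" "\<And>T'. T' \<in> \<Omega> \<Longrightarrow> tilings_close \<epsilon> T T' \<Longrightarrow> T' \<in> S"
      using S T unfolding L_def by (meson IntD1)
    obtain \<delta> where \<delta>: "\<delta> > 0" "\<And>T'. T' \<in> \<Omega> \<Longrightarrow> tilings_close \<delta> T T' \<Longrightarrow> T' \<in> S'"
      using S' T unfolding L_def by (meson IntD2)
    have pos: "min \<epsilon> \<delta> > 0" using \<epsilon>(1) \<delta>(1) by simp
    have "T' \<in> S \<inter> S'" if "T' \<in> \<Omega>" "tilings_close (min \<epsilon> \<delta>) T T'" for T'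
      using \<epsilon>(2)[OF that(1) tilings_close_mono[OF that(2) pos]]
        \<delta>(2)[OF that(1) tilings_close_mono[OF that(2) pos]] by simp
    with pos show "\<exists>\<gamma>>0. \<forall>T'\<in>\<Omega>. tilings_close \<gamma> T T' \<longrightarrow> T' \<in> S \<inter> S'"
      by meson
  qed
  moreover have "L (\<Union>\<K>)" if K: "\<forall>K\<in>\<K>. L K" for \<K>
    unfolding L_def
  proof (intro conjI ballI)
    show "\<Union>\<K> \<subseteq> \<Omega>" using K unfolding L_def by auto
    fix T assume "T \<in> \<Union>\<K>"
    then obtain K' where K': "K' \<in> \<K>" "T \<in> K'" by auto
    then obtain \<epsilon> where "\<epsilon> > 0" "\<forall>T'\<in>\<Omega>. tilings_close \<epsilon> T T' \<longrightarrow> T' \<in> K'"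
      using K unfolding L_def by meson
    then show "\<exists>\<epsilon>>0. \<forall>T'\<in>\<Omega>. tilings_close \<epsilon> T T' \<longrightarrow> T' \<in> \<Union>\<K>"
      using K'(1) by (meson UnionI)
  qed
  ultimately have "istopology L"
    unfolding istopology_def by simp
  then have "openin (topology L) U \<longleftrightarrow> L U"
    by (simp only: topology_inverse')
  then show ?thesis
    unfolding tiling_topology_def L_def .
qed

lemma topspace_tiling_topology [simp]: "topspace (tiling_topology \<Omega>) = \<Omega>"
proof
  have "openin (tiling_topology \<Omega>) \<Omega>"
    unfolding openin_tiling_topology by (meson subset_refl zero_less_one)
  then show "\<Omega> \<subseteq> topspace (tiling_topology \<Omega>)"
    by (rule openin_subset)
  show "topspace (tiling_topology \<Omega>) \<subseteq> \<Omega>"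
    using openin_topspace[of "tiling_topology \<Omega>"] unfolding openin_tiling_topology by simp
qed

text \<open>
  Compactness of the set of tiles up to translation, expressed by a compact set of
  representatives (sequential compactness with respect to \<open>tile_dist\<close>, which is a metric on
  the tiles of a tiling or a Delone set).  For Delone sets this says that the labels that occur
  form a compact set.
\<close>

definition compact_up_to_translation ::
    "('a::euclidean_space, 'l::metric_space) tile set \<Rightarrow> bool" where
  "compact_up_to_translation K \<longleftrightarrow>
     (\<exists>P\<subseteq>K. (\<forall>p\<in>K. \<exists>q\<in>P. \<exists>x. {p} = {q} \<ominus> x) \<and>
        (\<forall>\<sigma>::nat \<Rightarrow> ('a, 'l) tile. range \<sigma> \<subseteq> P \<longrightarrow>
           (\<exists>q\<in>P. \<exists>r. strict_mono r \<and> (\<lambda>n. tile_dist (\<sigma> (r n)) q) \<longlonglongrightarrow> 0)))"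

definition tiling_space :: "('a::euclidean_space, 'l::metric_space) tiling set \<Rightarrow> bool" where
  "tiling_space \<Omega> \<longleftrightarrow>
     ((\<forall>T\<in>\<Omega>. is_tiling T) \<or> (\<forall>T\<in>\<Omega>. is_delone T)) \<and>
     compact_up_to_translation (\<Union>\<Omega>) \<and>
     compact_space (tiling_topology \<Omega>) \<and>
     (\<forall>T\<in>\<Omega>. \<forall>x. T \<ominus> x \<in> \<Omega>)"

definition tiling_orbit :: "('a::euclidean_space, 'l) tiling \<Rightarrow> ('a, 'l) tiling set" where
  "tiling_orbit T = range (\<lambda>x. T \<ominus> x)"

definition minimal_space :: "('a::euclidean_space, 'l::metric_space) tiling set \<Rightarrow> bool" where
  "minimal_space \<Omega> \<longleftrightarrow> (\<forall>T\<in>\<Omega>. tiling_topology \<Omega> closure_of tiling_orbit T = \<Omega>)"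

definition aperiodic_space :: "('a::euclidean_space, 'l) tiling set \<Rightarrow> bool" where
  "aperiodic_space \<Omega> \<longleftrightarrow> (\<forall>T\<in>\<Omega>. \<forall>x. T \<ominus> x = T \<longrightarrow> x = 0)"

text \<open>Translation classes of patches are orbits of patches.\<close>

definition FLC :: "('a::euclidean_space, 'l) tiling set \<Rightarrow> bool" where
  "FLC \<Omega> \<longleftrightarrow> (\<forall>R. finite {tiling_orbit (patch T x R) |T x. T \<in> \<Omega>})"


section \<open>Maps between tiling spaces\<close>

definition orbit_equivalence ::
    "('a::euclidean_space, 'l::metric_space) tiling set \<Rightarrow> ('a, 'm::metric_space) tiling set \<Rightarrow>
     (('a, 'l) tiling \<Rightarrow> ('a, 'm) tiling) \<Rightarrow> bool" where
  "orbit_equivalence \<Omega> \<Omega>' h \<longleftrightarrow>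
     homeomorphic_map (tiling_topology \<Omega>) (tiling_topology \<Omega>') h \<and>
     (\<forall>T\<in>\<Omega>. h ` tiling_orbit T = tiling_orbit (h T))"

definition factor_map ::
    "('a::euclidean_space, 'l::metric_space) tiling set \<Rightarrow> ('a, 'm::metric_space) tiling set \<Rightarrow>
     (('a, 'l) tiling \<Rightarrow> ('a, 'm) tiling) \<Rightarrow> bool" where
  "factor_map \<Omega> \<Omega>' \<phi> \<longleftrightarrow>
     continuous_map (tiling_topology \<Omega>) (tiling_topology \<Omega>') \<phi> \<and> \<phi> ` \<Omega> = \<Omega>' \<and>
     (\<forall>T\<in>\<Omega>. \<forall>x. \<phi> (T \<ominus> x) = \<phi> T \<ominus> x)"

definition topological_conjugacy ::
    "('a::euclidean_space, 'l::metric_space) tiling set \<Rightarrow> ('a, 'm::metric_space) tiling set \<Rightarrow>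
     (('a, 'l) tiling \<Rightarrow> ('a, 'm) tiling) \<Rightarrow> bool" where
  "topological_conjugacy \<Omega> \<Omega>' \<phi> \<longleftrightarrow>
     factor_map \<Omega> \<Omega>' \<phi> \<and> homeomorphic_map (tiling_topology \<Omega>) (tiling_topology \<Omega>') \<phi>"

definition local_derivation ::
    "('a::euclidean_space, 'l::metric_space) tiling set \<Rightarrow> ('a, 'm::metric_space) tiling set \<Rightarrow>
     (('a, 'l) tiling \<Rightarrow> ('a, 'm) tiling) \<Rightarrow> bool" where
  "local_derivation \<Omega> \<Omega>' \<phi> \<longleftrightarrow> factor_map \<Omega> \<Omega>' \<phi> \<and>
     (\<forall>r>0. \<exists>R>0. \<forall>T\<in>\<Omega>. \<forall>T'\<in>\<Omega>.
        patch T 0 R = patch T' 0 R \<longrightarrow> patch (\<phi> T) 0 r = patch (\<phi> T') 0 r)"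

definition MLD_map ::
    "('a::euclidean_space, 'l::metric_space) tiling set \<Rightarrow> ('a, 'm::metric_space) tiling set \<Rightarrow>
     (('a, 'l) tiling \<Rightarrow> ('a, 'm) tiling) \<Rightarrow> bool" where
  "MLD_map \<Omega> \<Omega>' \<phi> \<longleftrightarrow>
     homeomorphic_map (tiling_topology \<Omega>) (tiling_topology \<Omega>') \<phi> \<and>
     local_derivation \<Omega> \<Omega>' \<phi> \<and> local_derivation \<Omega>' \<Omega> (inv_into \<Omega> \<phi>)"


section \<open>Weak cohomology\<close>

definition weak_cocycle ::
    "('a::euclidean_space, 'l::metric_space) tiling set \<Rightarrow> (('a, 'l) tiling \<Rightarrow> 'a \<Rightarrow> 'a) \<Rightarrow> bool"
  where
  "weak_cocycle \<Omega> \<alpha> \<longleftrightarrow>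
     continuous_map (prod_topology (tiling_topology \<Omega>) euclidean) euclidean (\<lambda>(T, x). \<alpha> T x) \<and>
     (\<forall>T\<in>\<Omega>. \<forall>x y. \<alpha> T x + \<alpha> (T \<ominus> x) y = \<alpha> T (x + y))"

definition weak_coboundary ::
    "('a::euclidean_space, 'l::metric_space) tiling set \<Rightarrow> (('a, 'l) tiling \<Rightarrow> 'a \<Rightarrow> 'a) \<Rightarrow> bool"
  where
  "weak_coboundary \<Omega> \<alpha> \<longleftrightarrow>
     (\<exists>s. continuous_map (tiling_topology \<Omega>) euclidean s \<and>
        (\<forall>T\<in>\<Omega>. \<forall>v. \<alpha> T v = s (T \<ominus> v) - s T))"

text \<open>Elements of the quotient groups are represented as cosets, that is, as sets of cocycles.\<close>

definition weak_cohomology_class ::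
    "('a::euclidean_space, 'l::metric_space) tiling set \<Rightarrow> (('a, 'l) tiling \<Rightarrow> 'a \<Rightarrow> 'a) \<Rightarrow>
     (('a, 'l) tiling \<Rightarrow> 'a \<Rightarrow> 'a) set" where
  "weak_cohomology_class \<Omega> \<alpha> =
     {\<beta>. weak_cocycle \<Omega> \<beta> \<and> weak_coboundary \<Omega> (\<lambda>T v. \<beta> T v - \<alpha> T v)}"

text \<open>\<open>displacement h T x\<close> is $h_T(x)$; it is unique when the target space is aperiodic.\<close>

definition displacement ::
    "(('a::euclidean_space, 'l) tiling \<Rightarrow> ('a, 'm) tiling) \<Rightarrow> ('a, 'l) tiling \<Rightarrow> 'a \<Rightarrow> 'a" where
  "displacement h T x = (THE y. h (T \<ominus> x) = h T \<ominus> y)"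

definition weak_class ::
    "('a::euclidean_space, 'l::metric_space) tiling set \<Rightarrow>
     (('a, 'l) tiling \<Rightarrow> ('a, 'm) tiling) \<Rightarrow> (('a, 'l) tiling \<Rightarrow> 'a \<Rightarrow> 'a) set" where
  "weak_class \<Omega> h = weak_cohomology_class \<Omega> (displacement h)"


section \<open>Strong cohomology\<close>

definition locally_constant_on :: "'x topology \<Rightarrow> 'x set \<Rightarrow> ('x \<Rightarrow> 'b) \<Rightarrow> bool" where
  "locally_constant_on X A f \<longleftrightarrow>
     (\<forall>x\<in>A. \<exists>W. openin X W \<and> x \<in> W \<and> (\<forall>y\<in>A \<inter> W. f y = f x))"

definition canonical_transversal :: "('a::euclidean_space, 'l) tiling set \<Rightarrow> ('a, 'l) tiling set"
  where
  "canonical_transversal \<Omega> = {T \<in> \<Omega>. \<exists>l. ({0}, l) \<in> T}"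

text \<open>
  An FLC space of labelled Delone sets uses only finitely many labels, so it is no restriction to
  take the labels of \<open>\<Omega>\<^sub>0\<close> in \<open>real\<close>.
\<close>

definition FLC_transversal ::
    "('a::euclidean_space, 'l::metric_space) tiling set \<Rightarrow> ('a, 'l) tiling set \<Rightarrow> bool" where
  "FLC_transversal \<Omega> \<Xi> \<longleftrightarrow>
     (\<exists>(\<Omega>\<^sub>0 :: ('a, real) tiling set) D.
        tiling_space \<Omega>\<^sub>0 \<and> (\<forall>T\<in>\<Omega>\<^sub>0. is_delone T) \<and> FLC \<Omega>\<^sub>0 \<and> local_derivation \<Omega> \<Omega>\<^sub>0 D \<and>
        \<Xi> = {T \<in> \<Omega>. D T \<in> canonical_transversal \<Omega>\<^sub>0})"

definition transversally_locally_constant ::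
    "('a::euclidean_space, 'l::metric_space) tiling set \<Rightarrow> (('a, 'l) tiling \<Rightarrow> 'b) \<Rightarrow> bool" where
  "transversally_locally_constant \<Omega> f \<longleftrightarrow>
     (\<forall>\<Xi>. FLC_transversal \<Omega> \<Xi> \<longrightarrow> locally_constant_on (tiling_topology \<Omega>) \<Xi> f)"

definition strong_cocycle ::
    "('a::euclidean_space, 'l::metric_space) tiling set \<Rightarrow> (('a, 'l) tiling \<Rightarrow> 'a \<Rightarrow> 'a) \<Rightarrow> bool"
  where
  "strong_cocycle \<Omega> \<alpha> \<longleftrightarrow>
     weak_cocycle \<Omega> \<alpha> \<and> (\<forall>v. transversally_locally_constant \<Omega> (\<lambda>T. \<alpha> T v))"

definition strong_coboundary ::
    "('a::euclidean_space, 'l::metric_space) tiling set \<Rightarrow> (('a, 'l) tiling \<Rightarrow> 'a \<Rightarrow> 'a) \<Rightarrow> bool"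
  where
  "strong_coboundary \<Omega> \<alpha> \<longleftrightarrow>
     (\<exists>s. continuous_map (tiling_topology \<Omega>) euclidean s \<and> transversally_locally_constant \<Omega> s \<and>
        (\<forall>T\<in>\<Omega>. \<forall>v. \<alpha> T v = s (T \<ominus> v) - s T))"

definition strong_cohomology_class ::
    "('a::euclidean_space, 'l::metric_space) tiling set \<Rightarrow> (('a, 'l) tiling \<Rightarrow> 'a \<Rightarrow> 'a) \<Rightarrow>
     (('a, 'l) tiling \<Rightarrow> 'a \<Rightarrow> 'a) set" where
  "strong_cohomology_class \<Omega> \<alpha> =
     {\<beta>. strong_cocycle \<Omega> \<beta> \<and> strong_coboundary \<Omega> (\<lambda>T v. \<beta> T v - \<alpha> T v)}"

definition fundamental_shape_class ::
    "('a::euclidean_space, 'l::metric_space) tiling set \<Rightarrow> (('a, 'l) tiling \<Rightarrow> 'a \<Rightarrow> 'a) set" where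
  "fundamental_shape_class \<Omega> = strong_cohomology_class \<Omega> (\<lambda>T v. v)"


section \<open>First Cech cohomology\<close>

text \<open>
  A triple \<open>(I, U, c)\<close> is a 1-cochain \<open>c\<close> on the cover \<open>U\<close> with index set \<open>I\<close>, with coefficients
  in the sheaf of locally constant functions; only the values of \<open>c i j\<close> on \<open>U i \<inter> U j\<close> matter.
\<close>

type_synonym ('i, 'x, 'b) cech = "'i set \<times> ('i \<Rightarrow> 'x set) \<times> ('i \<Rightarrow> 'i \<Rightarrow> 'x \<Rightarrow> 'b)"

fun cech_cocycle :: "'x topology \<Rightarrow> ('i, 'x, 'b::ab_group_add) cech \<Rightarrow> bool" where
  "cech_cocycle X (I, U, c) \<longleftrightarrow>
     (\<forall>i\<in>I. openin X (U i)) \<and> (\<Union>i\<in>I. U i) = topspace X \<and>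
     (\<forall>i\<in>I. \<forall>j\<in>I. locally_constant_on X (U i \<inter> U j) (c i j)) \<and>
     (\<forall>i\<in>I. \<forall>j\<in>I. \<forall>k\<in>I. \<forall>x\<in>U i \<inter> U j \<inter> U k. c i j x + c j k x = c i k x)"

text \<open>
  Equality in the direct limit over all open covers: on some common refinement \<open>\<W>\<close>, with
  refinement maps \<open>\<rho>\<close> and \<open>\<sigma>\<close>, the two cocycles differ by the coboundary of a locally constant
  0-cochain \<open>g\<close>.
\<close>

fun cech_cohomologous ::
    "'x topology \<Rightarrow> ('i, 'x, 'b::ab_group_add) cech \<Rightarrow> ('j, 'x, 'b) cech \<Rightarrow> bool" where
  "cech_cohomologous X (I, U, c) (J, V, d) \<longleftrightarrow>
     (\<exists>(\<W> :: 'x set set) \<rho> \<sigma> g.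
        (\<forall>W\<in>\<W>. openin X W) \<and> \<Union>\<W> = topspace X \<and>
        (\<forall>W\<in>\<W>. \<rho> W \<in> I \<and> W \<subseteq> U (\<rho> W)) \<and>
        (\<forall>W\<in>\<W>. \<sigma> W \<in> J \<and> W \<subseteq> V (\<sigma> W)) \<and>
        (\<forall>W\<in>\<W>. locally_constant_on X W (g W)) \<and>
        (\<forall>W\<in>\<W>. \<forall>W'\<in>\<W>. \<forall>x\<in>W \<inter> W'.
           c (\<rho> W) (\<rho> W') x - d (\<sigma> W) (\<sigma> W') x = g W' x - g W x))"

text \<open>
  A class is represented by the set of its representatives on covers indexed by sets of
  points.  Every class has such a representative, since each open cover is refined by the set of
  its members, indexed by itself.
\<close>

definition cech_class ::
    "'x topology \<Rightarrow> ('i, 'x, 'b::ab_group_add) cech \<Rightarrow> ('x set, 'x, 'b) cech set" where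
  "cech_class X C = {D. cech_cocycle X D \<and> cech_cohomologous X C D}"

fun cech_pullback_cochain ::
    "'x topology \<Rightarrow> ('x \<Rightarrow> 'y) \<Rightarrow> ('i, 'y, 'b) cech \<Rightarrow> ('i, 'x, 'b) cech" where
  "cech_pullback_cochain X f (I, U, c) =
     (I, \<lambda>i. {x \<in> topspace X. f x \<in> U i}, \<lambda>i j x. c i j (f x))"

text \<open>The union ranges over the representatives of a class, all of which give the same class.\<close>

definition cech_pullback ::
    "'x topology \<Rightarrow> ('x \<Rightarrow> 'y) \<Rightarrow> ('y set, 'y, 'b::ab_group_add) cech set \<Rightarrow>
     ('x set, 'x, 'b) cech set" where
  "cech_pullback X f A = (\<Union>C\<in>A. cech_class X (cech_pullback_cochain X f C))"


section \<open>From strong to Cech cohomology, and the strong class\<close>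

definition flow_box ::
    "('a::euclidean_space, 'l) tiling set \<times> real \<Rightarrow> ('a, 'l) tiling set" where
  "flow_box = (\<lambda>(\<Xi>, \<epsilon>). {S \<ominus> x |S x. S \<in> \<Xi> \<and> norm x < \<epsilon>})"

text \<open>The open flow boxes \<open>\<Xi> \<times> B(0, \<epsilon>) \<cong> U\<close>, indexed by \<open>(\<Xi>, \<epsilon>)\<close>.\<close>

definition flow_boxes ::
    "('a::euclidean_space, 'l::metric_space) tiling set \<Rightarrow> (('a, 'l) tiling set \<times> real) set" where
  "flow_boxes \<Omega> = {(\<Xi>, \<epsilon>). FLC_transversal \<Omega> \<Xi> \<and> \<epsilon> > 0 \<and>
     openin (tiling_topology \<Omega>) (flow_box (\<Xi>, \<epsilon>)) \<and>
     homeomorphic_map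
       (prod_topology (subtopology (tiling_topology \<Omega>) \<Xi>) (top_of_set (ball 0 \<epsilon>)))
       (subtopology (tiling_topology \<Omega>) (flow_box (\<Xi>, \<epsilon>))) (\<lambda>(S, x). S \<ominus> x)}"

text \<open>The function $c_U$ with $c_U(S - x) = \alpha(S, x)$ on the flow box $U$.\<close>

definition flow_box_function ::
    "(('a::euclidean_space, 'l) tiling \<Rightarrow> 'a \<Rightarrow> 'a) \<Rightarrow> ('a, 'l) tiling set \<times> real \<Rightarrow>
     ('a, 'l) tiling \<Rightarrow> 'a" where
  "flow_box_function \<alpha> = (\<lambda>(\<Xi>, \<epsilon>) T.
     (THE c. \<exists>S x. S \<in> \<Xi> \<and> norm x < \<epsilon> \<and> T = S \<ominus> x \<and> c = \<alpha> S x))"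

definition flow_box_cocycle ::
    "('a::euclidean_space, 'l::metric_space) tiling set \<Rightarrow> (('a, 'l) tiling \<Rightarrow> 'a \<Rightarrow> 'a) \<Rightarrow>
     (('a, 'l) tiling set \<times> real, ('a, 'l) tiling, 'a) cech" where
  "flow_box_cocycle \<Omega> \<alpha> = (flow_boxes \<Omega>, flow_box,
     \<lambda>i j T. flow_box_function \<alpha> i T - flow_box_function \<alpha> j T)"

text \<open>The canonical isomorphism from strong to Cech cohomology, as a map on cosets.\<close>

definition strong_to_cech ::
    "('a::euclidean_space, 'l::metric_space) tiling set \<Rightarrow> (('a, 'l) tiling \<Rightarrow> 'a \<Rightarrow> 'a) set \<Rightarrow>
     (('a, 'l) tiling set, ('a, 'l) tiling, 'a) cech set" where
  "strong_to_cech \<Omega> A = (\<Union>\<alpha>\<in>A. cech_class (tiling_topology \<Omega>) (flow_box_cocycle \<Omega> \<alpha>))"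

text \<open>
  The strong class $h^*[\mathcal{F}(\Omega')]$ of \<open>h\<close>, as an element of the Cech
  cohomology of \<open>\<Omega>\<close>, with which the strong cohomology of \<open>\<Omega>\<close> is identified.
\<close>

definition strong_class ::
    "('a::euclidean_space, 'l::metric_space) tiling set \<Rightarrow> ('a, 'm::metric_space) tiling set \<Rightarrow>
     (('a, 'l) tiling \<Rightarrow> ('a, 'm) tiling) \<Rightarrow>
     (('a, 'l) tiling set, ('a, 'l) tiling, 'a) cech set" where
  "strong_class \<Omega> \<Omega>' h =
     cech_pullback (tiling_topology \<Omega>) h (strong_to_cech \<Omega>' (fundamental_shape_class \<Omega>'))"

end

theory Submission
  imports Defs
begin

text \<open>
  For an orbit equivalence \<open>h\<close>, the displacement of \<open>T\<close> by \<open>v\<close> is the vector by which \<open>h T\<close> has to be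
  translated to reach \<open>h (T \<ominus> v)\<close>.

  The weak case.  Suppose that the displacements of \<open>h\<^sub>1\<close> and \<open>h\<^sub>2\<close> differ by the coboundary of \<open>s\<close>.
  When \<open>T\<close> moves to \<open>T \<ominus> v\<close>, the tiling \<open>h\<^sub>2 T \<ominus> s T\<close> then moves by exactly the displacement of \<open>h\<^sub>1\<close>,
  so \<open>h\<^sub>1 T \<mapsto> h\<^sub>2 T \<ominus> s T\<close> commutes with translations.  This map \<open>\<phi>\<close> meets every orbit of \<open>\<Omega>\<^sub>2\<close>, hence is
  onto.  It is injective: two tilings with the same image lie on one orbit, and there \<open>\<phi>\<close> is
  injective because the action on \<open>\<Omega>\<^sub>2\<close> is free.  By compactness it is a conjugacy.  The shift is
  obtained by pulling \<open>s T\<close> back along the orbit through the displacement of the inverse of \<open>h\<^sub>2\<close>.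
  All this takes place for free continuous actions of a Euclidean space on compact Hausdorff
  spaces, and rests on one analytic fact, the joint continuity of the displacement
  (\<open>disp_continuous\<close>).  It makes the displacement a weak cocycle, and the shift continuous.
  The point is that small vectors have small displacements (\<open>disp_small\<close>), which follows from the
  theorem of Sierpinski that an interval is not a countable disjoint union of at least two nonempty
  closed sets.

  The strong case.  Over a flow box, a transversal times a ball, the Cech cocycle of the fundamental
  shape class is a difference of functions which, up to a continuous global function and locally
  constant functions, are the coordinates in the direction of the ball.  Such primitives can be
  carried along cohomologies of Cech cocycles (\<open>primitive_transport\<close>).  If the strong classes agree, the
  difference of the two primitives of a common representative is a function \<open>\<sigma>\<close> on \<open>\<Omega>\<close> that is, near every tiling
  and up to a constant, the coordinate of \<open>h\<^sub>1 T\<close> in a flow box of \<open>\<Omega>\<^sub>1\<close> minus that of \<open>h\<^sub>2 T\<close> in a flow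
  box of \<open>\<Omega>\<^sub>2\<close> (\<open>equal_strong_classes_potential\<close>).  Along short pieces of orbits coordinates move like
  displacements, so the coboundary of \<open>\<sigma>\<close> is the difference of the displacements, and the weak argument applies
  with \<open>s = \<sigma>\<close>.

  That \<open>\<phi>\<close> is local (\<open>local_derivation_conj\<close>) comes from the description of closeness under finite local
  complexity: tilings are close iff they agree on a large ball up to a small translation
  (\<open>close_imp_patch_eq\<close>), and a flow coordinate measures this translation.  If \<open>h\<^sub>1 T\<close> and \<open>h\<^sub>1 T'\<close> agree on a
  large ball, their coordinates are equal, so \<open>\<sigma> T' - \<sigma> T\<close> exactly undoes the small translation
  between \<open>h\<^sub>2 T\<close> and \<open>h\<^sub>2 T'\<close>.  The situation is symmetric in \<open>h\<^sub>1\<close> and \<open>h\<^sub>2\<close>, so the inverse is local as well.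
  Finally, equality of the classes only carries information because the classes are nonempty sets of
  cocycles; this amounts to covering the space by flow boxes (\<open>flow_boxes_cover\<close>), which are built from
  the Delone sets of reference points of the tiles.
\<close>

section \<open>Free actions of a Euclidean space on a compact space\<close>

lemma continuous_map_into_metricI:
  fixes f :: "'x \<Rightarrow> 'a::metric_space"
  assumes "\<And>x e. x \<in> topspace X \<Longrightarrow> e > 0 \<Longrightarrow> \<exists>N. openin X N \<and> x \<in> N \<and> (\<forall>y\<in>N. dist (f y) (f x) < e)"
  shows "continuous_map X euclidean f"
  unfolding continuous_map_def
proof (intro conjI allI impI)
  fix U :: "'a set" assume U: "openin euclidean U"
  define P where "P = {x \<in> topspace X. f x \<in> U}"
  have "\<exists>N. openin X N \<and> x \<in> N \<and> N \<subseteq> P" if x: "x \<in> P" for x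
  proof -
    have "open U" using U by simp
    moreover have "f x \<in> U" using x unfolding P_def by simp
    ultimately obtain e where e: "e > 0" "ball (f x) e \<subseteq> U" using openE by blast
    have "x \<in> topspace X" using x unfolding P_def by simp
    then obtain N where N: "openin X N" "x \<in> N" "\<forall>y\<in>N. dist (f y) (f x) < e" using assms e(1) by blast
    have "y \<in> P" if "y \<in> N" for y
    proof -
      have "f y \<in> ball (f x) e" using N(3) that by (simp add: dist_commute[of "f x"])
      then show ?thesis using e(2) openin_subset[OF N(1)] that unfolding P_def by blast
    qed
    then show ?thesis using N(1,2) by blast
  qed
  then have "openin X P" by (subst openin_subopen) blast
  then show "openin X {x \<in> topspace X. f x \<in> U}" unfolding P_def .
qed simp

text \<open>
  The setting of the weak case.  The tilings only enter through the fact that a space of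
  aperiodic tilings with the translations is of this form.
\<close>

locale compact_free_action =
  fixes X :: "'x topology" and act :: "'x \<Rightarrow> 'a::euclidean_space \<Rightarrow> 'x"
  assumes compact: "compact_space X" and hausdorff: "Hausdorff_space X"
    and act_closed: "x \<in> topspace X \<Longrightarrow> act x v \<in> topspace X"
    and act_zero: "x \<in> topspace X \<Longrightarrow> act x 0 = x"
    and act_add: "x \<in> topspace X \<Longrightarrow> act (act x v) w = act x (v + w)"
    and act_continuous: "continuous_map (prod_topology X euclidean) X (\<lambda>(x, v). act x v)"
    and free: "x \<in> topspace X \<Longrightarrow> act x v = x \<Longrightarrow> v = 0"
begin

lemma act_inject:
  assumes "x \<in> topspace X" "act x v = act x w"
  shows "v = w"
proof -
  have "act (act x v) (w - v) = act x w"
    using assms(1) by (simp add: act_add)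
  then have "act (act x v) (w - v) = act x v"
    using assms(2) by simp
  then have "w - v = 0"
    using free[OF act_closed[OF assms(1)]] by blast
  then show ?thesis by simp
qed

lemma continuous_map_act:
  assumes "continuous_map Z X f" "continuous_map Z euclidean g"
  shows "continuous_map Z X (\<lambda>z. act (f z) (g z))"
proof -
  have "continuous_map Z X ((\<lambda>(x, v). act x v) \<circ> (\<lambda>z. (f z, g z)))"
    by (intro continuous_map_compose[OF _ act_continuous] continuous_map_pairedI assms)
  then show ?thesis by (simp add: o_def)
qed

end

text \<open>
  Freeness of the action on \<open>Y\<close> makes the displacement well defined.
\<close>

locale orbit_map = A: compact_free_action X a + B: compact_free_action Y b
  for X :: "'x topology" and a :: "'x \<Rightarrow> 'a::euclidean_space \<Rightarrow> 'x"
    and Y :: "'y topology" and b :: "'y \<Rightarrow> 'a \<Rightarrow> 'y" +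
  fixes h :: "'x \<Rightarrow> 'y"
  assumes h_continuous: "continuous_map X Y h"
    and h_orbit: "x \<in> topspace X \<Longrightarrow> \<exists>w. h (a x v) = b (h x) w"
begin

definition disp :: "'x \<Rightarrow> 'a \<Rightarrow> 'a" where
  "disp x v = (THE w. h (a x v) = b (h x) w)"

lemma h_closed: "x \<in> topspace X \<Longrightarrow> h x \<in> topspace Y"
  using h_continuous by (simp add: continuous_map_def Pi_iff)

lemma disp_unique:
  assumes "x \<in> topspace X" "h (a x v) = b (h x) w"
  shows "disp x v = w"
  unfolding disp_def using assms B.act_inject[OF h_closed[OF assms(1)]] by (intro the_equality) auto

lemma disp_eq: "x \<in> topspace X \<Longrightarrow> h (a x v) = b (h x) (disp x v)"
  using h_orbit disp_unique by metis

lemma disp_zero: "x \<in> topspace X \<Longrightarrow> disp x 0 = 0"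
  by (intro disp_unique) (simp_all add: A.act_zero B.act_zero h_closed)

lemma disp_add:
  assumes "x \<in> topspace X"
  shows "disp x v + disp (a x v) w = disp x (v + w)"
proof -
  have "h (a x (v + w)) = h (a (a x v) w)"
    using assms by (simp add: A.act_add)
  also have "\<dots> = b (b (h x) (disp x v)) (disp (a x v) w)"
    using assms by (simp add: disp_eq A.act_closed)
  also have "\<dots> = b (h x) (disp x v + disp (a x v) w)"
    using assms by (simp add: B.act_add h_closed)
  finally show ?thesis
    using disp_unique[OF assms] by metis
qed

text \<open>
  The condition says that \<open>(h x, h (a x v))\<close> lies in the set of pairs \<open>(y, b y w)\<close> with \<open>w \<in> K\<close>, which is
  compact as an image of \<open>Y \<times> K\<close>.  This is how compactness of \<open>Y\<close> controls the displacement without any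
  local product structure.
\<close>

lemma closedin_disp_in_compact:
  assumes "compact K"
  shows "closedin (prod_topology X euclidean) {(x, v). x \<in> topspace X \<and> disp x v \<in> K}"
proof -
  define G where "G = (\<lambda>(y, w). (y, b y w)) ` (topspace Y \<times> K)"
  have "compactin (prod_topology Y euclidean) (topspace Y \<times> K)"
    using assms B.compact by (simp add: compactin_Times compact_space_def compactin_euclidean_iff)
  moreover have "continuous_map (prod_topology Y euclidean) (prod_topology Y Y) (\<lambda>(y, w). (y, b y w))"
    using B.act_continuous by (simp add: case_prod_unfold continuous_map_paired continuous_map_fst)
  ultimately have "compactin (prod_topology Y Y) G"
    unfolding G_def by (rule image_compactin)
  then have G: "closedin (prod_topology Y Y) G"
    by (intro compactin_imp_closedin) (auto simp: Hausdorff_space_prod_topology B.hausdorff)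
  have cont: "continuous_map (prod_topology X euclidean) (prod_topology Y Y)
      (\<lambda>z. (h (fst z), h (a (fst z) (snd z))))"
    using continuous_map_compose[OF A.act_continuous h_continuous]
      continuous_map_compose[OF continuous_map_fst h_continuous]
    by (simp add: continuous_map_paired o_def case_prod_unfold)
  have "(h x, h (a x v)) \<in> G \<longleftrightarrow> disp x v \<in> K" if "x \<in> topspace X" for x v
    using that disp_eq[OF that] disp_unique[OF that] h_closed[OF that]
    unfolding G_def by (auto simp: image_iff)
  then have "{(x, v). x \<in> topspace X \<and> disp x v \<in> K} =
      {z \<in> topspace (prod_topology X euclidean). (h (fst z), h (a (fst z) (snd z))) \<in> G}"
    by auto
  then show ?thesis
    using closedin_continuous_map_preimage[OF cont G] by simp
qed

text \<open>
  The vector \<open>0\<close> has displacement \<open>0\<close>, so the tube lemma yields a uniform neighbourhood of \<open>0\<close>.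
\<close>

lemma disp_avoids_near_zero:
  assumes "compact K" "0 \<notin> K"
  obtains \<delta> where "\<delta> > 0" "\<And>x v. x \<in> topspace X \<Longrightarrow> norm v < \<delta> \<Longrightarrow> disp x v \<notin> K"
proof -
  define W where "W = topspace (prod_topology X (euclidean :: 'a topology)) -
    {(x, v). x \<in> topspace X \<and> disp x v \<in> K}"
  have "openin (prod_topology X euclidean) W"
    unfolding W_def using closedin_disp_in_compact[OF assms(1)] by blast
  moreover have "topspace X \<times> {0} \<subseteq> W"
    unfolding W_def using assms(2) by (auto simp: disp_zero)
  ultimately obtain U V where UV: "topspace X \<subseteq> U" "openin euclidean V" "0 \<in> V" "U \<times> V \<subseteq> W"
    using tube_lemma_left[of X euclidean W "topspace X" 0] A.compact
    by (auto simp: compact_space_def)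
  then obtain \<delta> where \<delta>: "\<delta> > 0" "ball 0 \<delta> \<subseteq> V"
    by (metis open_openin openE)
  have "disp x v \<notin> K" if "x \<in> topspace X" "norm v < \<delta>" for x v
  proof -
    have "(x, v) \<in> W"
        using that UV(1,4) \<delta>(2) by (force simp: subset_iff)
    then show ?thesis
      using that unfolding W_def by auto
  qed
  with \<delta>(1) that show ?thesis by blast
qed

text \<open>
  By the previous lemma the displacement of a small vector is either below \<open>e\<close> or above \<open>2 * e\<close>.  On the
  segment from \<open>0\<close> to \<open>v\<close>, being within \<open>e\<close> is therefore an equivalence relation with closed classes.
  The classes are countably many, since their values are separated in a separable space, so by
  Sierpinski's theorem there is only one, and it contains \<open>0\<close>.
\<close>

lemma disp_small:
  assumes "e > 0"
  obtains \<delta> where "\<delta> > 0" "\<And>x v. x \<in> topspace X \<Longrightarrow> norm v < \<delta> \<Longrightarrow> norm (disp x v) < e"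
proof -
  define K where "K = cball 0 (2 * e) - ball (0::'a) e"
  have "compact K" "0 \<notin> K"
    unfolding K_def using assms by (auto intro: compact_diff)
  then obtain \<delta> where \<delta>: "\<delta> > 0" "\<And>x v. x \<in> topspace X \<Longrightarrow> norm v < \<delta> \<Longrightarrow> disp x v \<notin> K"
    by (rule disp_avoids_near_zero) blast
  have gap: "norm (disp x v) < e \<or> norm (disp x v) > 2 * e" if "x \<in> topspace X" "norm v < \<delta>" for x v
    using \<delta>(2)[OF that] unfolding K_def by auto
  have "norm (disp x v) < e" if x: "x \<in> topspace X" and v: "norm v < \<delta>" for x v
  proof -
    define f where "f t = disp x (t *\<^sub>R v)" for t :: real
    define C where "C t = {u \<in> {0..1}. dist (f u) (f t) \<le> e}" for t
    \<comment> \<open>Differences of values of \<open>f\<close> are displacements of small vectors, so the gap applies to them.\<close>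
    have jump: "dist (f u) (f t) < e \<or> dist (f u) (f t) > 2 * e" if "u \<in> {0..1}" "t \<in> {0..1}" for u t
    proof -
      have "f t + disp (a x (t *\<^sub>R v)) (u *\<^sub>R v - t *\<^sub>R v) = f u"
        unfolding f_def using disp_add[OF x, of "t *\<^sub>R v" "u *\<^sub>R v - t *\<^sub>R v"] by simp
      then have "dist (f u) (f t) = norm (disp (a x (t *\<^sub>R v)) ((u - t) *\<^sub>R v))"
        by (metis add_diff_cancel_left' dist_norm scaleR_left_diff_distrib)
      moreover have "\<bar>u - t\<bar> * norm v \<le> 1 * norm v"
        using that by (intro mult_right_mono) auto
      then have "norm ((u - t) *\<^sub>R v) < \<delta>"
        using v by simp
      ultimately show ?thesis
        using gap[OF A.act_closed[OF x]] by metis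
    qed
    have class_eq: "C t = C u" if "t \<in> {0..1}" "u \<in> {0..1}" "dist (f u) (f t) \<le> 2 * e" for t u
    proof -
      have near: "dist (f u) (f t) < e" using jump[OF that(2,1)] that(3) by linarith
      have "dist (f w) (f t) \<le> e \<longleftrightarrow> dist (f w) (f u) \<le> e" if w: "w \<in> {0..1}" for w
        using jump[OF w \<open>t \<in> _\<close>] jump[OF w \<open>u \<in> _\<close>] near
          dist_triangle[of "f w" "f t" "f u"] dist_triangle[of "f w" "f u" "f t"]
        by (smt (verit) dist_commute)
      then show ?thesis unfolding C_def by auto
    qed
    have closed_C: "closed (C t)" for t
    proof -
      have "continuous_map euclidean (prod_topology X euclidean) (\<lambda>u::real. (x, u *\<^sub>R v))"
        using x by (auto intro!: continuous_map_pairedI continuous_intros)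
      moreover have "closedin (prod_topology X euclidean)
          {(x, w). x \<in> topspace X \<and> disp x w \<in> cball (f t) e}"
        by (intro closedin_disp_in_compact) auto
      ultimately have "closed {u. disp x (u *\<^sub>R v) \<in> cball (f t) e}"
        using closedin_continuous_map_preimage x by fastforce
      then have "closed ({u. disp x (u *\<^sub>R v) \<in> cball (f t) e} \<inter> {0..1})"
        by (intro closed_Int) auto
      moreover have "C t = {u. disp x (u *\<^sub>R v) \<in> cball (f t) e} \<inter> {0..1}"
        unfolding C_def f_def by (auto simp: dist_commute)
      ultimately show ?thesis by simp
    qed
    \<comment> \<open>A class is determined by any point of a countable dense set within \<open>e\<close> of one of its values.\<close>
    have "countable (C ` {0..1})"
    proof -
      obtain Q :: "'a set" where Q: "countable Q" "\<And>S. open S \<Longrightarrow> S \<noteq> {} \<Longrightarrow> \<exists>q\<in>Q. q \<in> S"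
        using countable_dense_exists[where 'a = 'a] by metis
      have "\<forall>t. \<exists>q\<in>Q. q \<in> ball (f t) e"
        using Q(2) assms by (metis centre_in_ball empty_iff open_ball)
      then obtain q where q: "\<And>t. q t \<in> Q" "\<And>t. dist (f t) (q t) < e"
        by (metis mem_ball)
      have eq_C: "C t = C u" if "t \<in> {0..1}" "u \<in> {0..1}" "q t = q u" for t u
        using class_eq[OF that(1,2)] q(2)[of t] q(2)[of u] that(3)
        by (smt (verit) dist_commute dist_triangle2)
      have "C t = C (inv_into {0..1} q (q t))" if "t \<in> {0..1}" for t
        using that by (intro eq_C) (auto intro: inv_into_into simp: f_inv_into_f simp del: atLeastAtMost_iff)
      then have "C ` {0..1} = (C \<circ> inv_into {0..1} q) ` q ` {0..1}"
        by (auto simp: image_image intro!: image_cong)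
      moreover have "countable (q ` {0..1})"
        using countable_subset[OF _ Q(1)] q(1) by blast
      ultimately show ?thesis by simp
    qed
    moreover have "pairwise disjnt (C ` {0..1})"
    proof (clarsimp simp: pairwise_image pairwise_def)
      fix t u :: real assume tu: "0 \<le> t" "t \<le> 1" "0 \<le> u" "u \<le> 1" "C t \<noteq> C u"
      have "False" if w: "w \<in> C t" "w \<in> C u" for w
      proof -
        have "C t = C w" "C u = C w"
          by (intro class_eq; use w tu(1-4) assms in \<open>simp add: C_def\<close>)+
        then show False using tu(5) by simp
      qed
      then show "disjnt (C t) (C u)"
        by (auto simp: disjnt_def)
    qed
    moreover have in_C: "t \<in> C t" if "t \<in> {0..1}" for t
      using that assms unfolding C_def by auto
    moreover have "\<Union> (C ` {0..1}) = {0..1}"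
      using in_C unfolding C_def by blast
    ultimately have "C ` {0..1} = {{0..1}}"
      using closed_C by (intro real_Sierpinski_lemma) (auto, (metis atLeastAtMost_iff empty_iff))
    moreover have "C 0 \<in> C ` {0..1}" by simp
    ultimately have "C 0 = {0..1}" by (metis singletonD)
    then have "1 \<in> C 0" by simp
    then have "dist (f 1) (f 0) \<le> e" unfolding C_def by blast
    moreover have "dist (f 1) (f 0) < e \<or> dist (f 1) (f 0) > 2 * e" by (rule jump) auto
    ultimately have "dist (f 1) (f 0) < e" using assms by linarith
    then show ?thesis
      unfolding f_def by (simp add: disp_zero x)
  qed
  with \<delta>(1) that show ?thesis by blast
qed

text \<open>
  A vector of norm at most \<open>R\<close> is a sum of boundedly many small vectors, each of displacement at
  most \<open>1\<close>.
\<close>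

lemma disp_bounded:
  obtains M where "\<And>x v. x \<in> topspace X \<Longrightarrow> norm v \<le> R \<Longrightarrow> norm (disp x v) \<le> M"
proof -
  obtain \<delta> where \<delta>: "\<delta> > 0" "\<And>x v. x \<in> topspace X \<Longrightarrow> norm v < \<delta> \<Longrightarrow> norm (disp x v) < 1"
    using disp_small[of 1] by auto
  have steps: "norm (disp x (real n *\<^sub>R v)) \<le> real n" if "x \<in> topspace X" "norm v < \<delta>" for x v n
  proof (induction n)
    case 0
    show ?case using that by (simp add: disp_zero)
  next
    case (Suc n)
    have "disp x (real (Suc n) *\<^sub>R v) = disp x (real n *\<^sub>R v) + disp (a x (real n *\<^sub>R v)) v"
      using disp_add[OF that(1)] by (simp add: algebra_simps)
    also have "norm \<dots> \<le> real n + 1"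
      by (rule norm_triangle_mono[OF Suc less_imp_le[OF \<delta>(2)[OF A.act_closed[OF that(1)] that(2)]]])
    finally show ?case by simp
  qed
  obtain n :: nat where n: "n > 0" "\<bar>R\<bar> / \<delta> < real n"
    by (meson reals_Archimedean2 gr0I le_less_trans less_le_trans divide_nonneg_pos \<delta>(1) abs_ge_zero
        of_nat_0_less_iff)
  have "norm (disp x v) \<le> real n" if "x \<in> topspace X" "norm v \<le> R" for x v
  proof -
    have "\<bar>R\<bar> < \<delta> * real n" using n \<delta>(1) by (simp add: field_simps)
    then have "norm v < \<delta> * real n" using that by linarith
    then have "norm ((1 / real n) *\<^sub>R v) < \<delta>"
      using n by (simp add: field_simps)
    from steps[OF that(1) this, of n] n show ?thesis by simp
  qed
  with that show ?thesis by blast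
qed

text \<open>
  Near \<open>(x0, v0)\<close> the displacement is bounded, so if it is not near its value at \<open>(x0, v0)\<close>, it lies in a
  compact set that does not contain this value, and this is a closed condition.
\<close>

lemma disp_continuous: "continuous_map (prod_topology X euclidean) euclidean (\<lambda>(x, v). disp x v)"
proof (rule continuous_map_into_metricI)
  fix z :: "'x \<times> 'a" and e :: real
  assume z: "z \<in> topspace (prod_topology X euclidean)" and e: "e > 0"
  obtain x0 v0 where z_eq: "z = (x0, v0)" by (cases z)
  obtain M where M: "\<And>x v. x \<in> topspace X \<Longrightarrow> norm v \<le> norm v0 + 1 \<Longrightarrow> norm (disp x v) \<le> M"
    by (rule disp_bounded) blast
  define K where "K = cball 0 M - ball (disp x0 v0) e"
  have "compact K" unfolding K_def by (intro compact_diff) auto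
  define S where "S = topspace X \<times> ball v0 1 - {(x, v). x \<in> topspace X \<and> disp x v \<in> K}"
  have "openin (prod_topology X euclidean) S"
    unfolding S_def
    by (intro openin_diff closedin_disp_in_compact \<open>compact K\<close>) (simp add: openin_prod_Times_iff)
  moreover have "z \<in> S" using z e unfolding S_def K_def z_eq by auto
  moreover have "dist (disp x v) (disp x0 v0) < e" if "(x, v) \<in> S" for x v
  proof -
    have "norm v \<le> norm v0 + 1"
      using that norm_triangle_sub[of v v0] unfolding S_def by (auto simp: dist_norm norm_minus_commute)
    with M that show ?thesis unfolding S_def K_def by (auto simp: dist_commute)
  qed
  ultimately show "\<exists>N. openin (prod_topology X euclidean) N \<and> z \<in> N \<and>
      (\<forall>y\<in>N. dist (case y of (x, v) \<Rightarrow> disp x v) (case z of (x, v) \<Rightarrow> disp x v) < e)"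
    unfolding z_eq by (intro exI[of _ S]) auto
qed

end

section \<open>Orbit homeomorphisms with cohomologous displacements\<close>

locale orbit_homeomorphism = orbit_map X a Y b h
  for X :: "'x topology" and a :: "'x \<Rightarrow> 'a::euclidean_space \<Rightarrow> 'x"
    and Y :: "'y topology" and b :: "'y \<Rightarrow> 'a \<Rightarrow> 'y" and h :: "'x \<Rightarrow> 'y" +
  assumes h_homeomorphic: "homeomorphic_map X Y h"
    and h_orbit_onto: "x \<in> topspace X \<Longrightarrow> \<exists>v. h (a x v) = b (h x) w"
begin

definition h_inv :: "'y \<Rightarrow> 'x" where
  "h_inv = inv_into (topspace X) h"

lemma h_bij: "bij_betw h (topspace X) (topspace Y)"
  using h_homeomorphic by (simp add: homeomorphic_eq_everything_map bij_betw_def)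

lemma h_inv_closed: "y \<in> topspace Y \<Longrightarrow> h_inv y \<in> topspace X"
  using h_bij unfolding h_inv_def by (metis bij_betw_def inv_into_into)

lemma h_h_inv: "y \<in> topspace Y \<Longrightarrow> h (h_inv y) = y"
  using h_bij unfolding h_inv_def by (metis bij_betw_inv_into_right)

lemma h_inv_h: "x \<in> topspace X \<Longrightarrow> h_inv (h x) = x"
  using h_bij unfolding h_inv_def by (metis bij_betw_inv_into_left)

lemma h_inv_homeomorphic: "homeomorphic_map Y X h_inv"
proof -
  obtain g where g: "homeomorphic_maps X Y h g"
    using h_homeomorphic homeomorphic_map_maps by metis
  have "g y = h_inv y" if "y \<in> topspace Y" for y
    using g that h_inv_h[of "g y"] by (auto simp: homeomorphic_maps_def continuous_map_def Pi_iff)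
  moreover have "homeomorphic_map Y X g"
    using g homeomorphic_maps_map by metis
  ultimately show ?thesis
    by (metis homeomorphic_map_eq)
qed

lemma h_inv_continuous: "continuous_map Y X h_inv"
  using h_inv_homeomorphic homeomorphic_imp_continuous_map by blast

lemma h_inv_orbit_map: "orbit_map Y b X a h_inv"
proof
  show "continuous_map Y X h_inv" by (rule h_inv_continuous)
  fix y w assume y: "y \<in> topspace Y"
  obtain v where "h (a (h_inv y) v) = b (h (h_inv y)) w"
    using h_orbit_onto[OF h_inv_closed[OF y]] by blast
  then have "h_inv (b y w) = a (h_inv y) v"
    using y by (metis A.act_closed h_h_inv h_inv_closed h_inv_h)
  then show "\<exists>v. h_inv (b y w) = a (h_inv y) v" by blast
qed

end

locale cohomologous_orbit_homeomorphisms =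
  H1: orbit_homeomorphism X a Y b h\<^sub>1 + H2: orbit_homeomorphism X a Z c h\<^sub>2
  for X :: "'x topology" and a :: "'x \<Rightarrow> 'a::euclidean_space \<Rightarrow> 'x"
    and Y :: "'y topology" and b :: "'y \<Rightarrow> 'a \<Rightarrow> 'y" and h\<^sub>1 :: "'x \<Rightarrow> 'y"
    and Z :: "'z topology" and c :: "'z \<Rightarrow> 'a \<Rightarrow> 'z" and h\<^sub>2 :: "'x \<Rightarrow> 'z" +
  fixes s :: "'x \<Rightarrow> 'a"
  assumes s_continuous: "continuous_map X euclidean s"
    and s_coboundary: "x \<in> topspace X \<Longrightarrow> H1.disp x v - H2.disp x v = s (a x v) - s x"
begin

definition conj :: "'y \<Rightarrow> 'z" where
  "conj y = c (h\<^sub>2 (H1.h_inv y)) (s (H1.h_inv y))"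

definition conj_inv :: "'z \<Rightarrow> 'y" where
  "conj_inv z = b (h\<^sub>1 (H2.h_inv z)) (- s (H2.h_inv z))"

text \<open>
  The vector that \<open>h\<^sub>2\<close> turns into the displacement \<open>s x\<close>, starting at \<open>x\<close>.
\<close>

definition shift :: "'x \<Rightarrow> 'a" where
  "shift x = orbit_map.disp c a H2.h_inv (h\<^sub>2 x) (s x)"

lemma conj_h1: "x \<in> topspace X \<Longrightarrow> conj (h\<^sub>1 x) = c (h\<^sub>2 x) (s x)"
  by (simp add: conj_def H1.h_inv_h)

lemma conj_inv_h2: "x \<in> topspace X \<Longrightarrow> conj_inv (h\<^sub>2 x) = b (h\<^sub>1 x) (- s x)"
  by (simp add: conj_inv_def H2.h_inv_h)

lemma conj_closed: "y \<in> topspace Y \<Longrightarrow> conj y \<in> topspace Z"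
  by (simp add: conj_def H1.h_inv_closed H2.h_closed H2.B.act_closed)

lemma conj_inv_closed: "z \<in> topspace Z \<Longrightarrow> conj_inv z \<in> topspace Y"
  by (simp add: conj_inv_def H2.h_inv_closed H1.h_closed H1.B.act_closed)

text \<open>
  Moving \<open>x\<close> by \<open>v\<close> moves \<open>h\<^sub>2 x\<close> by its own displacement and changes \<open>s x\<close> by the difference of the two
  displacements; together this is the displacement of \<open>h\<^sub>1\<close>.
\<close>

lemma conj_act:
  assumes y: "y \<in> topspace Y"
  shows "conj (b y w) = c (conj y) w"
proof -
  define x where "x = H1.h_inv y"
  have x: "x \<in> topspace X" "h\<^sub>1 x = y"
    using y by (simp_all add: x_def H1.h_inv_closed H1.h_h_inv)
  obtain v where v: "h\<^sub>1 (a x v) = b y w"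
    using H1.h_orbit_onto[OF x(1)] x(2) by metis
  have disp: "H1.disp x v = w"
    using v x by (intro H1.disp_unique) auto
  have "conj (b y w) = c (h\<^sub>2 (a x v)) (s (a x v))"
    using conj_h1[OF H1.A.act_closed[OF x(1)]] v by metis
  also have "\<dots> = c (c (h\<^sub>2 x) (H2.disp x v)) (s (a x v))"
    by (simp add: H2.disp_eq x)
  also have "\<dots> = c (h\<^sub>2 x) (H2.disp x v + s (a x v))"
    by (simp add: H2.B.act_add H2.h_closed x)
  also have "H2.disp x v + s (a x v) = s x + w"
    using s_coboundary[OF x(1), of v] disp by (simp add: algebra_simps)
  also have "c (h\<^sub>2 x) (s x + w) = c (c (h\<^sub>2 x) (s x)) w"
    by (simp add: H2.B.act_add H2.h_closed x)
  also have "\<dots> = c (conj y) w"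
    using conj_h1[OF x(1)] x(2) by simp
  finally show ?thesis .
qed

lemma conj_conj_inv:
  assumes z: "z \<in> topspace Z"
  shows "conj (conj_inv z) = z"
proof -
  define x where "x = H2.h_inv z"
  have x: "x \<in> topspace X" "h\<^sub>2 x = z"
    using z by (simp_all add: x_def H2.h_inv_closed H2.h_h_inv)
  have "conj (conj_inv z) = c (conj (h\<^sub>1 x)) (- s x)"
    using x conj_inv_h2[OF x(1)] by (simp add: conj_act H1.h_closed)
  also have "\<dots> = z"
    using x by (simp add: conj_h1 H2.B.act_add H2.h_closed z H2.B.act_zero)
  finally show ?thesis .
qed

text \<open>
  Points with equal images lie on one orbit, because \<open>h\<^sub>2\<close> separates orbits.  On an orbit the map is
  injective by equivariance and freeness.
\<close>

lemma conj_inj: "inj_on conj (topspace Y)"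
proof
  fix y y' assume y: "y \<in> topspace Y" "y' \<in> topspace Y" and eq: "conj y = conj y'"
  define x where "x = H1.h_inv y"
  define x' where "x' = H1.h_inv y'"
  have x: "x \<in> topspace X" "h\<^sub>1 x = y" "x' \<in> topspace X" "h\<^sub>1 x' = y'"
    using y by (simp_all add: x_def x'_def H1.h_inv_closed H1.h_h_inv)
  have eq': "c (h\<^sub>2 x) (s x) = c (h\<^sub>2 x') (s x')"
    using eq x conj_h1 by metis
  have "h\<^sub>2 x' = c (c (h\<^sub>2 x') (s x')) (- s x')"
    by (simp add: H2.B.act_add H2.h_closed x H2.B.act_zero)
  also have "\<dots> = c (h\<^sub>2 x) (s x - s x')"
    by (simp add: H2.B.act_add H2.h_closed x flip: eq')
  finally obtain v where "h\<^sub>2 x' = h\<^sub>2 (a x v)"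
    using H2.h_orbit_onto[OF x(1)] by metis
  then have x': "x' = a x v"
    using x H1.A.act_closed H2.h_inv_h by metis
  define w where "w = H1.disp x v"
  have y': "y' = b y w"
    using x x' H1.disp_eq[OF x(1)] by (simp add: w_def)
  then have "c (conj y) w = conj y"
    using eq conj_act[OF y(1)] by simp
  then have "w = 0"
    using H2.B.free conj_closed[OF y(1)] by blast
  then show "y = y'"
    using y' H1.B.act_zero[OF y(1)] by simp
qed

lemma conj_continuous: "continuous_map Y Z conj"
  unfolding conj_def
  by (intro H2.B.continuous_map_act continuous_map_compose[unfolded o_def, OF H1.h_inv_continuous]
      H2.h_continuous s_continuous)

lemma conj_homeomorphic: "homeomorphic_map Y Z conj"
proof (rule continuous_imp_homeomorphic_map)
  show "conj ` topspace Y = topspace Z"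
    using conj_closed conj_conj_inv conj_inv_closed by (force simp: image_iff)
qed (use conj_continuous conj_inj H1.B.compact H2.B.hausdorff in auto)

lemma inv_into_conj: "z \<in> topspace Z \<Longrightarrow> inv_into (topspace Y) conj z = conj_inv z"
  by (metis conj_conj_inv conj_inj conj_inv_closed inv_into_f_f)

lemma shift_continuous: "continuous_map X euclidean shift"
proof -
  interpret I: orbit_map Z c X a H2.h_inv by (rule H2.h_inv_orbit_map)
  have "continuous_map X euclidean ((\<lambda>(z, w). I.disp z w) \<circ> (\<lambda>x. (h\<^sub>2 x, s x)))"
    by (intro continuous_map_compose[OF _ I.disp_continuous] continuous_map_pairedI
        H2.h_continuous s_continuous)
  then show ?thesis
    unfolding shift_def[abs_def] by (simp add: o_def)
qed

lemma act_shift: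
  assumes x: "x \<in> topspace X"
  shows "a x (shift x) = H2.h_inv (conj (h\<^sub>1 x))"
proof -
  interpret I: orbit_map Z c X a H2.h_inv by (rule H2.h_inv_orbit_map)
  show ?thesis
    using I.disp_eq[OF H2.h_closed[OF x], of "s x"] x
    by (simp add: shift_def conj_h1 H2.h_inv_h)
qed

lemma h2_act_shift: "x \<in> topspace X \<Longrightarrow> h\<^sub>2 (a x (shift x)) = conj (h\<^sub>1 x)"
  by (simp add: act_shift H2.h_h_inv conj_closed H1.h_closed)

lemma act_shift_homeomorphic: "homeomorphic_map X X (\<lambda>x. a x (shift x))"
proof -
  have "homeomorphic_map X X (H2.h_inv \<circ> (conj \<circ> h\<^sub>1))"
    by (intro homeomorphic_map_compose[where Y = Z] homeomorphic_map_compose[where Y = Y]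
        H1.h_homeomorphic conj_homeomorphic H2.h_inv_homeomorphic)
  then show ?thesis
    by (rule homeomorphic_map_eq) (simp add: act_shift)
qed

end

section \<open>The Hausdorff distance and the distance of tiles\<close>

lemma hausdorff_dist_commute: "hausdorff_dist S T = hausdorff_dist T S"
  unfolding hausdorff_dist_def by (simp add: max.commute)

lemma infdist_le_hausdorff_dist:
  assumes "compact S" "x \<in> S"
  shows "infdist x T \<le> hausdorff_dist S T"
proof -
  have "continuous_on S (\<lambda>x. infdist x T)"
    by (intro continuous_intros)
  then have "bdd_above ((\<lambda>x. infdist x T) ` S)"
    using assms(1) by (intro bounded_imp_bdd_above compact_imp_bounded compact_continuous_image)
  then have "infdist x T \<le> (SUP x\<in>S. infdist x T)"
    using assms(2) by (rule cSUP_upper2) auto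
  then show ?thesis unfolding hausdorff_dist_def by simp
qed

lemma hausdorff_dist_less_obtains:
  assumes "compact S" "T \<noteq> {}" "hausdorff_dist S T < e" "x \<in> S"
  obtains y where "y \<in> T" "dist x y < e"
proof -
  have "(INF y\<in>T. dist x y) < e"
    using infdist_le_hausdorff_dist[OF assms(1,4), of T] assms(2,3) by (simp add: infdist_def)
  then show ?thesis
    using assms(2) that by (subst (asm) cINF_less_iff) auto
qed

lemma hausdorff_dist_leI:
  assumes "S \<noteq> {}" "T \<noteq> {}"
    and "\<And>x. x \<in> S \<Longrightarrow> \<exists>y\<in>T. dist x y \<le> e" "\<And>y. y \<in> T \<Longrightarrow> \<exists>x\<in>S. dist x y \<le> e"
  shows "hausdorff_dist S T \<le> e"
  unfolding hausdorff_dist_def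
proof (rule max.boundedI)
  show "(SUP x\<in>S. infdist x T) \<le> e"
    using assms(1,3) by (intro cSUP_least) (auto intro: infdist_le2)
  show "(SUP y\<in>T. infdist y S) \<le> e"
    using assms(2,4) by (intro cSUP_least) (auto intro: infdist_le2 simp: dist_commute)
qed

lemma hausdorff_dist_triangle:
  assumes "compact S" "S \<noteq> {}" "compact T" "T \<noteq> {}" "compact U" "U \<noteq> {}"
  shows "hausdorff_dist S U \<le> hausdorff_dist S T + hausdorff_dist T U"
proof (rule field_le_epsilon)
  fix e :: real assume "e > 0"
  have *: "\<exists>z\<in>U. dist x z \<le> hausdorff_dist S T + hausdorff_dist T U + e"
    if A: "x \<in> S" "compact S" "compact T" "T \<noteq> {}" "U \<noteq> {}" for x and S T U :: "'a set"
  proof -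
    obtain y where y: "y \<in> T" "dist x y < hausdorff_dist S T + e / 2"
      by (rule hausdorff_dist_less_obtains[of S T "hausdorff_dist S T + e / 2" x])
        (use A \<open>e > 0\<close> in auto)
    obtain z where z: "z \<in> U" "dist y z < hausdorff_dist T U + e / 2"
      by (rule hausdorff_dist_less_obtains[of T U "hausdorff_dist T U + e / 2" y])
        (use A y \<open>e > 0\<close> in auto)
    show ?thesis
      using y z dist_triangle[of x z y] by (intro bexI[of _ z]) auto
  qed
  show "hausdorff_dist S U \<le> hausdorff_dist S T + hausdorff_dist T U + e"
    using assms *[of _ S T U] *[of _ U T S]
    by (intro hausdorff_dist_leI)
      (auto simp: hausdorff_dist_commute dist_commute add.commute)
qed

lemma hausdorff_dist_self: "S \<noteq> {} \<Longrightarrow> hausdorff_dist S S = 0"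
  unfolding hausdorff_dist_def by simp

lemma hausdorff_dist_le_0_eq:
  assumes "compact S" "S \<noteq> {}" "compact T" "T \<noteq> {}" "hausdorff_dist S T \<le> 0"
  shows "S = T"
proof -
  have *: "S \<subseteq> T" if "compact S" "compact T" "T \<noteq> {}" "hausdorff_dist S T \<le> 0" for S T :: "'a set"
  proof
    fix x assume "x \<in> S"
    then have "infdist x T = 0"
      using infdist_le_hausdorff_dist[of S x T] that infdist_nonneg[of x T] by force
    then show "x \<in> T"
      using that(2,3) compact_imp_closed in_closed_iff_infdist_zero by blast
  qed
  show ?thesis
    using *[of S T] *[of T S] assms by (auto simp: hausdorff_dist_commute)
qed

lemma hausdorff_dist_translate_le:
  fixes S T :: "'a::real_normed_vector set"
  assumes "compact S" "S \<noteq> {}" "compact T" "T \<noteq> {}"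
  shows "hausdorff_dist ((\<lambda>y. y - v) ` S) ((\<lambda>y. y - w) ` T) \<le> hausdorff_dist S T + dist v w"
proof (rule field_le_epsilon)
  fix e :: real assume "e > 0"
  have *: "\<exists>z\<in>(\<lambda>y. y - w) ` T. dist (x - v) z \<le> hausdorff_dist S T + dist v w + e"
    if A: "x \<in> S" "compact S" "T \<noteq> {}" for x v w and S T :: "'a set"
  proof -
    obtain y where y: "y \<in> T" "dist x y < hausdorff_dist S T + e"
      by (rule hausdorff_dist_less_obtains[of S T "hausdorff_dist S T + e" x])
        (use A \<open>e > 0\<close> in auto)
    have "(x - v) - (y - w) = (x - y) - (v - w)" by simp
    then have "dist (x - v) (y - w) \<le> dist x y + dist v w"
      unfolding dist_norm by (metis norm_triangle_ineq4)
    with y show ?thesis by force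
  qed
  show "hausdorff_dist ((\<lambda>y. y - v) ` S) ((\<lambda>y. y - w) ` T) \<le> hausdorff_dist S T + dist v w + e"
    using assms *[where S = S and T = T and v = v and w = w] *[where S = T and T = S and v = w and w = v]
    by (intro hausdorff_dist_leI) (auto simp: hausdorff_dist_commute dist_commute)
qed

text \<open>
  On tiles of this kind \<open>tile_dist\<close> is a metric.
\<close>

definition solid :: "('a::metric_space, 'l) tile \<Rightarrow> bool" where
  "solid p \<longleftrightarrow> compact (fst p) \<and> fst p \<noteq> {}"

definition shift_tile :: "('a::euclidean_space, 'l) tile \<Rightarrow> 'a \<Rightarrow> ('a, 'l) tile" where
  "shift_tile p v = ((\<lambda>y. y - v) ` fst p, snd p)"

lemma translate_eq_shift_tile: "T \<ominus> v = (\<lambda>p. shift_tile p v) ` T"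
  unfolding translate_def shift_tile_def by (auto simp: case_prod_unfold)

lemma shift_tile_shift_tile [simp]: "shift_tile (shift_tile p v) w = shift_tile p (v + w)"
  unfolding shift_tile_def by (auto simp: image_image algebra_simps)

lemma shift_tile_0 [simp]: "shift_tile p 0 = p"
  unfolding shift_tile_def by simp

lemma fst_shift_tile: "fst (shift_tile p v) = (\<lambda>y. y - v) ` fst p"
  unfolding shift_tile_def by simp

lemma solid_shift_tile [simp]: "solid (shift_tile p v) \<longleftrightarrow> solid p"
proof -
  have *: "solid (shift_tile p v)" if "solid p" for p :: "('a, 'b) tile" and v
    using that compact_translation[of "fst p" "- v"]
    by (simp add: solid_def fst_shift_tile add.commute[of "- v"])
  show ?thesis
    using *[of p v] *[of "shift_tile p v" "- v"] by (metis add.right_inverse shift_tile_0 shift_tile_shift_tile)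
qed

lemma inj_shift_tile: "inj (\<lambda>p. shift_tile p v)"
  by (rule inj_on_inverseI[where g = "\<lambda>p. shift_tile p (- v)"]) simp

lemma translate_0 [simp]: "T \<ominus> 0 = T"
  by (simp add: translate_eq_shift_tile)

lemma translate_translate [simp]: "T \<ominus> v \<ominus> w = T \<ominus> (v + w)"
  by (simp add: translate_eq_shift_tile image_image)

lemma shift_tile_in_translate [simp]: "shift_tile p v \<in> T \<ominus> v \<longleftrightarrow> p \<in> T"
  by (simp add: translate_eq_shift_tile inj_image_mem_iff[OF inj_shift_tile])

lemma in_translate_iff: "p \<in> T \<ominus> v \<longleftrightarrow> shift_tile p (- v) \<in> T"
  using shift_tile_in_translate[of "shift_tile p (- v)" v T] by simp

lemma translate_mono: "T \<subseteq> T' \<Longrightarrow> T \<ominus> v \<subseteq> T' \<ominus> v"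
  by (auto simp: translate_eq_shift_tile)

lemma shift_tile_meets_ball:
  "fst (shift_tile p v) \<inter> ball x R \<noteq> {} \<longleftrightarrow> fst p \<inter> ball (x + v) R \<noteq> {}"
proof -
  have "dist x (y - v) = dist (x + v) y" for y
    by (simp add: dist_norm algebra_simps)
  then show ?thesis
    by (auto simp: fst_shift_tile)
qed

lemma in_patch: "p \<in> patch T x R \<longleftrightarrow> p \<in> T \<and> fst p \<inter> ball x R \<noteq> {}"
  unfolding patch_def by auto

lemma patch_subset: "patch T x R \<subseteq> T"
  unfolding patch_def by auto

lemma patch_ball_mono: "ball x R \<subseteq> ball x' R' \<Longrightarrow> patch T x R \<subseteq> patch T x' R'"
  unfolding patch_def by blast

lemma patch_mono: "R \<le> R' \<Longrightarrow> patch T x R \<subseteq> patch T x R'"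
  by (intro patch_ball_mono subset_ball)

lemma patch_translate: "patch (T \<ominus> v) x R = patch T (x + v) R \<ominus> v"
proof -
  have "p \<in> patch (T \<ominus> v) x R \<longleftrightarrow> p \<in> patch T (x + v) R \<ominus> v" for p
    using shift_tile_meets_ball[of "shift_tile p (- v)" v x R]
    by (simp add: in_patch in_translate_iff)
  then show ?thesis by blast
qed

text \<open>
  Agreement on a ball is inherited by the smaller balls inside it, whatever their centre; a
  translation moves such a ball to the origin.
\<close>

lemma patch_eq_mono:
  assumes eq: "patch T 0 R = patch T' 0 R" and le: "r + norm v \<le> R"
  shows "patch (T \<ominus> v) 0 r = patch (T' \<ominus> v) 0 r"
proof -
  have "ball v r \<subseteq> ball 0 R"
    using le by (simp add: ball_subset_ball_iff)
  then have "fst p \<inter> ball v r \<noteq> {} \<Longrightarrow> fst p \<inter> ball 0 R \<noteq> {}" for p :: "('a, 'b) tile"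
    by blast
  then have "patch S v r = {p \<in> patch S 0 R. fst p \<inter> ball v r \<noteq> {}}" for S :: "('a, 'b) tiling"
    by (simp add: set_eq_iff in_patch del: split_paired_All) blast
  then show ?thesis
    using eq by (simp add: patch_translate)
qed

lemma tile_dist_commute: "tile_dist p q = tile_dist q p"
  unfolding tile_dist_def by (simp add: hausdorff_dist_commute dist_commute)

lemma tile_dist_self: "solid p \<Longrightarrow> tile_dist p p = 0"
  unfolding tile_dist_def solid_def by (simp add: hausdorff_dist_self)

lemma tile_dist_triangle:
  assumes "solid p" "solid q" "solid r"
  shows "tile_dist p r \<le> tile_dist p q + tile_dist q r"
  using hausdorff_dist_triangle[of "fst p" "fst q" "fst r"] dist_triangle[of "snd p" "snd r" "snd q"] assms
  unfolding tile_dist_def solid_def by linarith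

lemma tile_dist_le_0_eq:
  assumes "solid p" "solid q" "tile_dist p q \<le> 0"
  shows "p = q"
  using assms hausdorff_dist_le_0_eq[of "fst p" "fst q"] unfolding solid_def tile_dist_def
  by (intro prod_eqI) auto

lemma tile_dist_shift_tile_le:
  assumes "solid p" "solid q"
  shows "tile_dist (shift_tile p v) (shift_tile q w) \<le> tile_dist p q + dist v w"
proof -
  have "hausdorff_dist ((\<lambda>y. y - v) ` fst p) ((\<lambda>y. y - w) ` fst q) \<le> hausdorff_dist (fst p) (fst q) + dist v w"
    using assms unfolding solid_def by (intro hausdorff_dist_translate_le) auto
  then show ?thesis
    using zero_le_dist[of v w] unfolding tile_dist_def shift_tile_def fst_conv snd_conv by linarith
qed

lemma tile_dist_less_obtains:
  assumes "solid p" "solid q" "tile_dist p q < e" "x \<in> fst p"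
  obtains y where "y \<in> fst q" "dist x y < e"
  using assms hausdorff_dist_less_obtains[of "fst p" "fst q" e x]
  unfolding solid_def tile_dist_def by auto

lemma tile_dist_meets_ball:
  assumes "solid p" "solid q" "tile_dist p q < e" "fst p \<inter> ball x R \<noteq> {}"
  shows "fst q \<inter> ball x (R + e) \<noteq> {}"
proof -
  obtain y where y: "y \<in> fst p" "dist x y < R" using assms(4) by auto
  obtain z where z: "z \<in> fst q" "dist y z < e"
    using tile_dist_less_obtains[OF assms(1-3) y(1)] .
  have "dist x z < R + e" using y z dist_triangle[of x z y] by linarith
  with z show ?thesis by auto
qed

section \<open>The topology of a space of tilings\<close>

definition tilewise_solid :: "('a::euclidean_space, 'l) tiling \<Rightarrow> bool" where
  "tilewise_solid T \<longleftrightarrow> (\<forall>p\<in>T. solid p)"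

lemma tilings_close_refl:
  assumes "tilewise_solid T" "\<epsilon> > 0"
  shows "tilings_close \<epsilon> T T"
  unfolding tilings_close_def
  by (rule exI[of _ T], rule exI[of _ T], rule exI[of _ id])
    (use assms patch_subset[of T] in \<open>simp add: tile_dist_self tilewise_solid_def\<close>)

lemma tilings_close_sym:
  assumes "tilings_close \<epsilon> T T'"
  shows "tilings_close \<epsilon> T' T"
proof -
  obtain A A' f where *: "patch T 0 (1 / \<epsilon>) \<subseteq> A" "A \<subseteq> T" "patch T' 0 (1 / \<epsilon>) \<subseteq> A'" "A' \<subseteq> T'"
      "bij_betw f A A'" "\<forall>p\<in>A. tile_dist p (f p) < \<epsilon>"
    using assms unfolding tilings_close_def by blast
  have "tile_dist q (inv_into A f q) < \<epsilon>" if "q \<in> A'" for q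
  proof -
    have "inv_into A f q \<in> A" "f (inv_into A f q) = q"
      using that *(5) by (auto simp: bij_betw_def inv_into_into f_inv_into_f)
    then show ?thesis using *(6) by (metis tile_dist_commute)
  qed
  then show ?thesis
    unfolding tilings_close_def
    by (intro exI[of _ A'] exI[of _ A] exI[of _ "inv_into A f"] conjI ballI * bij_betw_inv_into) simp_all
qed

text \<open>
  Composing the two correspondences.  A tile that meets the ball of radius \<open>1 / \<epsilon>\<close> corresponds to one
  that meets the ball of radius \<open>1 / \<epsilon> + \<delta>\<close>, where the second correspondence is defined.
\<close>

lemma tilings_close_trans:
  assumes "tilewise_solid T" "tilewise_solid T'" "tilewise_solid T''"
    and "tilings_close \<delta> T T'" "tilings_close \<delta> T' T''"
    and "\<delta> > 0" "2 * \<delta> \<le> \<epsilon>" "1 / \<epsilon> + \<delta> \<le> 1 / \<delta>"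
  shows "tilings_close \<epsilon> T T''"
proof -
  obtain A A' f where f: "patch T 0 (1 / \<delta>) \<subseteq> A" "A \<subseteq> T" "patch T' 0 (1 / \<delta>) \<subseteq> A'" "A' \<subseteq> T'"
      "bij_betw f A A'" "\<And>p. p \<in> A \<Longrightarrow> tile_dist p (f p) < \<delta>"
    using assms(4) unfolding tilings_close_def by blast
  obtain B B' g where g: "patch T' 0 (1 / \<delta>) \<subseteq> B" "B \<subseteq> T'" "patch T'' 0 (1 / \<delta>) \<subseteq> B'" "B' \<subseteq> T''"
      "bij_betw g B B'" "\<And>p. p \<in> B \<Longrightarrow> tile_dist p (g p) < \<delta>"
    using assms(5) unfolding tilings_close_def by blast
  have le: "1 / \<epsilon> \<le> 1 / \<delta>" using assms by linarith
  have ok: "solid p" if "p \<in> T \<or> p \<in> T' \<or> p \<in> T''" for p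
    using that assms(1-3) unfolding tilewise_solid_def by auto
  have f_in: "f p \<in> T'" if "p \<in> A" for p
    using f(4,5) that bij_betwE by blast
  have g_in: "g p \<in> T''" if "p \<in> B" for p
    using g(4,5) that bij_betwE by blast
  define C where "C = {p \<in> A. f p \<in> B}"
  have "patch T 0 (1 / \<epsilon>) \<subseteq> C"
  proof
    fix p assume p: "p \<in> patch T 0 (1 / \<epsilon>)"
    then have pA: "p \<in> A" using f(1) patch_mono[OF le] by blast
    have "fst (f p) \<inter> ball 0 (1 / \<epsilon> + \<delta>) \<noteq> {}"
      using p pA f f_in ok by (intro tile_dist_meets_ball[of p]) (auto simp: in_patch)
    then have "f p \<in> patch T' 0 (1 / \<delta>)"
      using subset_ball[OF assms(8), of 0] f_in[OF pA] by (auto simp: in_patch)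
    then show "p \<in> C" using pA g(1) unfolding C_def by auto
  qed
  moreover have "patch T'' 0 (1 / \<epsilon>) \<subseteq> (g \<circ> f) ` C"
  proof
    fix r assume r: "r \<in> patch T'' 0 (1 / \<epsilon>)"
    then have "r \<in> B'" using g(3) patch_mono[OF le] by blast
    then obtain q where q: "q \<in> B" "r = g q" using g(5) unfolding bij_betw_def by blast
    have "solid q" "solid r" "tile_dist r q < \<delta>"
      using q subsetD[OF g(2) q(1)] g(6)[OF q(1)] ok[of q] ok[of r] g_in[OF q(1)]
      by (simp_all add: tile_dist_commute)
    then have "fst q \<inter> ball 0 (1 / \<epsilon> + \<delta>) \<noteq> {}"
      using r by (intro tile_dist_meets_ball[of r]) (simp_all add: in_patch)
    then have "q \<in> patch T' 0 (1 / \<delta>)"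
      using subset_ball[OF assms(8), of 0] q g(2) by (auto simp: in_patch)
    then obtain p where "p \<in> A" "q = f p" using f(3,5) unfolding bij_betw_def by blast
    with q show "r \<in> (g \<circ> f) ` C" unfolding C_def by auto
  qed
  moreover have "(g \<circ> f) ` C \<subseteq> T''" "C \<subseteq> T"
    using g_in f(2) unfolding C_def o_def by blast+
  moreover have "bij_betw (g \<circ> f) C ((g \<circ> f) ` C)"
  proof (rule inj_on_imp_bij_betw, rule comp_inj_on)
    show "inj_on f C" using f(5) unfolding C_def bij_betw_def by (auto intro: inj_on_subset)
    show "inj_on g (f ` C)" using g(5) unfolding C_def bij_betw_def by (auto intro: inj_on_subset)
  qed
  moreover have "tile_dist p ((g \<circ> f) p) < \<epsilon>" if "p \<in> C" for p
  proof -
    have "tile_dist p (g (f p)) \<le> tile_dist p (f p) + tile_dist (f p) (g (f p))"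
      using that f(2) f_in g_in unfolding C_def by (intro tile_dist_triangle ok) auto
    also have "\<dots> < \<delta> + \<delta>"
      using that f(6) g(6) unfolding C_def by (intro add_strict_mono) auto
    finally show ?thesis using assms(7) by simp
  qed
  ultimately show ?thesis
    unfolding tilings_close_def
    by (intro exI[of _ C] exI[of _ "(g \<circ> f) ` C"] exI[of _ "g \<circ> f"] conjI ballI)
qed

text \<open>
  A scale at which closeness can be composed to closeness at the original scale.  The bound \<open>1 / 2\<close>
  ensures the condition on the radii in \<open>tilings_close_trans\<close>.
\<close>

definition finer :: "real \<Rightarrow> real" where
  "finer \<epsilon> = min (\<epsilon> / 2) (1 / 2)"

lemma finer_pos: "\<epsilon> > 0 \<Longrightarrow> finer \<epsilon> > 0"
  unfolding finer_def by simp

lemma tilings_close_finer: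
  assumes "\<epsilon> > 0" "tilewise_solid T" "tilewise_solid T'" "tilewise_solid T''"
    and "tilings_close (finer \<epsilon>) T T'" "tilings_close (finer \<epsilon>) T' T''"
  shows "tilings_close \<epsilon> T T''"
proof -
  define \<delta> where "\<delta> = finer \<epsilon>"
  have \<delta>: "\<delta> > 0" "2 * \<delta> \<le> \<epsilon>" "2 * \<delta> \<le> 1"
    using assms(1) unfolding \<delta>_def finer_def by auto
  have "1 / \<epsilon> \<le> 1 / (2 * \<delta>)"
    using assms(1) \<delta> by (intro divide_left_mono) auto
  moreover have "\<delta> \<le> 1 / (2 * \<delta>)"
  proof -
    have "2 * \<delta> * \<delta> \<le> 1 * 1"
      using \<delta> by (intro mult_mono) auto
    then show ?thesis using \<delta>(1) by (simp add: field_simps)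
  qed
  moreover have "1 / (2 * \<delta>) + 1 / (2 * \<delta>) = 1 / \<delta>" by simp
  ultimately have "1 / \<epsilon> + \<delta> \<le> 1 / \<delta>" by linarith
  then show ?thesis
    using tilings_close_trans[OF assms(2-4), of \<delta> \<epsilon>] assms(5,6) \<delta> unfolding \<delta>_def by blast
qed

lemma tilings_close_translate:
  assumes "tilewise_solid T" "tilewise_solid T'" "tilings_close \<delta> T T'" "\<delta> > 0" "\<delta> \<le> \<epsilon>"
    and "1 / \<epsilon> + norm v \<le> 1 / \<delta>"
  shows "tilings_close \<epsilon> (T \<ominus> v) (T' \<ominus> v)"
proof -
  obtain A A' f where f: "patch T 0 (1 / \<delta>) \<subseteq> A" "A \<subseteq> T" "patch T' 0 (1 / \<delta>) \<subseteq> A'" "A' \<subseteq> T'"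
      "bij_betw f A A'" "\<And>p. p \<in> A \<Longrightarrow> tile_dist p (f p) < \<delta>"
    using assms(3) unfolding tilings_close_def by blast
  have "patch S v (1 / \<epsilon>) \<subseteq> patch S 0 (1 / \<delta>)" for S :: "('a, 'b) tiling"
  proof -
    have "ball v (1 / \<epsilon>) \<subseteq> ball 0 (1 / \<delta>)"
      using assms(6) by (simp add: ball_subset_ball_iff)
    then show ?thesis by (rule patch_ball_mono)
  qed
  then have "patch (T \<ominus> v) 0 (1 / \<epsilon>) \<subseteq> A \<ominus> v" "patch (T' \<ominus> v) 0 (1 / \<epsilon>) \<subseteq> A' \<ominus> v"
    using f(1,3) by (auto simp: patch_translate intro!: translate_mono)
  moreover have "A \<ominus> v \<subseteq> T \<ominus> v" "A' \<ominus> v \<subseteq> T' \<ominus> v"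
    using f(2,4) by (simp_all add: translate_mono)
  moreover define g where "g = (\<lambda>q. shift_tile q v) \<circ> f \<circ> (\<lambda>p. shift_tile p (- v))"
  have "bij_betw g (A \<ominus> v) (A' \<ominus> v)"
    unfolding g_def
  proof (intro bij_betw_trans)
    have "bij_betw (\<lambda>p. shift_tile p (- v)) (A \<ominus> v) (A \<ominus> v \<ominus> (- v))"
      unfolding translate_eq_shift_tile[of "A \<ominus> v" "- v"]
      using inj_shift_tile[of "- v"] by (intro inj_on_imp_bij_betw) (auto intro: inj_on_subset)
    then show "bij_betw (\<lambda>p. shift_tile p (- v)) (A \<ominus> v) A" by simp
    show "bij_betw f A A'" by (rule f)
    show "bij_betw (\<lambda>p. shift_tile p v) A' (A' \<ominus> v)"
      unfolding translate_eq_shift_tile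
      using inj_shift_tile[of v] by (intro inj_on_imp_bij_betw) (auto intro: inj_on_subset)
  qed
  moreover have "tile_dist p (g p) < \<epsilon>" if p: "p \<in> A \<ominus> v" for p
  proof -
    obtain q where q: "q \<in> A" "p = shift_tile q v"
      using p unfolding translate_eq_shift_tile by blast
    then have "f q \<in> A'" using f(5) bij_betwE by blast
    then have "solid q" "solid (f q)"
      using f(2,4) assms(1,2) q unfolding tilewise_solid_def by blast+
    then have "tile_dist p (g p) \<le> tile_dist q (f q)"
      using tile_dist_shift_tile_le[of q "f q" v v] q by (simp add: g_def)
    then show ?thesis using f(6)[OF q(1)] assms(5) by linarith
  qed
  ultimately show ?thesis
    unfolding tilings_close_def
    by (intro exI[of _ "A \<ominus> v"] exI[of _ "A' \<ominus> v"] exI[of _ g] conjI ballI)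
qed

text \<open>
  Translating all tiles is a correspondence between the two tilings as a whole, so no restriction
  on the radius appears.
\<close>

lemma tilings_close_translate_self:
  assumes "tilewise_solid T" "dist v w < \<epsilon>"
  shows "tilings_close \<epsilon> (T \<ominus> v) (T \<ominus> w)"
  unfolding tilings_close_def
proof (intro exI conjI ballI)
  show "bij_betw (\<lambda>p. shift_tile p (w - v)) (T \<ominus> v) (T \<ominus> w)"
    using inj_shift_tile[of "w - v"] translate_translate[of T v "w - v"]
    by (auto simp: bij_betw_def translate_eq_shift_tile intro: inj_on_subset)
  fix p assume "p \<in> T \<ominus> v"
  then have "solid p"
    using assms(1) by (auto simp: tilewise_solid_def translate_eq_shift_tile)
  then have "tile_dist (shift_tile p 0) (shift_tile p (w - v)) \<le> tile_dist p p + dist 0 (w - v)"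
    by (rule tile_dist_shift_tile_le) fact
  with \<open>solid p\<close> show "tile_dist p (shift_tile p (w - v)) < \<epsilon>"
    using assms(2) by (simp add: tile_dist_self dist_norm norm_minus_commute)
qed (use patch_subset in auto)

lemma tilings_close_of_patch_eq:
  assumes "tilewise_solid T" "\<epsilon> > 0" "patch T 0 R = patch T' 0 R" "1 / \<epsilon> \<le> R"
  shows "tilings_close \<epsilon> T T'"
  unfolding tilings_close_def
proof (intro exI conjI ballI)
  show "bij_betw id (patch T 0 R) (patch T' 0 R)" using assms(3) by simp
  fix p assume "p \<in> patch T 0 R"
  then have "solid p" using assms(1) by (auto simp: tilewise_solid_def in_patch)
  then show "tile_dist p (id p) < \<epsilon>" using assms(2) by (simp add: tile_dist_self)
qed (rule patch_subset patch_mono[OF assms(4)])+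

text \<open>
  A point \<open>y\<close> outside of \<open>T\<close> is separated from \<open>T\<close> by a hyperplane.  Moving \<open>y\<close> by \<open>e\<close> away from
  the hyperplane leads to a point that still belongs to \<open>S\<close>, but is further than \<open>e\<close> from \<open>T\<close>.
\<close>

lemma ball_subset_of_hausdorff_close:
  fixes S T :: "'a::euclidean_space set"
  assumes "compact S" "convex T" "compact T" "T \<noteq> {}" "ball c r \<subseteq> S" "hausdorff_dist S T < e" "e > 0"
  shows "ball c (r - e) \<subseteq> T"
proof
  fix y assume y: "y \<in> ball c (r - e)"
  show "y \<in> T"
  proof (rule ccontr)
    assume "y \<notin> T"
    then obtain a k where ak: "a \<bullet> y < k" "\<And>z. z \<in> T \<Longrightarrow> k < a \<bullet> z"
      using separating_hyperplane_closed_point[of T y] assms(2,3) compact_imp_closed by blast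
    have a: "a \<noteq> 0" using ak assms(4) by fastforce
    define w where "w = y - (e / norm a) *\<^sub>R a"
    have "dist y w = e" using a assms(7) by (simp add: w_def dist_norm)
    then have "w \<in> S" using y assms(5) dist_triangle[of c w y] by (auto simp: subset_iff)
    then obtain z where z: "z \<in> T" "dist w z < e"
      using hausdorff_dist_less_obtains[OF assms(1,4,6)] by blast
    have "a \<bullet> (y - w) = e * norm a"
      by (simp add: w_def dot_square_norm power2_eq_square)
    moreover have "a \<bullet> (y - w) < a \<bullet> (z - w)"
      using ak(1) ak(2)[OF z(1)] by (simp add: inner_diff_right)
    moreover have "a \<bullet> (z - w) \<le> norm a * dist w z"
      by (metis dist_commute dist_norm norm_cauchy_schwarz)
    moreover have "norm a * dist w z < norm a * e" using z(2) a by simp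
    ultimately show False by (simp add: mult.commute)
  qed
qed

lemma tiling_tileD:
  assumes "is_tiling T" "p \<in> T"
  shows "convex (fst p)" "interior (fst p) \<noteq> {}" "solid p"
proof -
  have p: "polytope (fst p)" "interior (fst p) \<noteq> {}"
    using assms unfolding is_tiling_def by auto
  then show "convex (fst p)" "interior (fst p) \<noteq> {}"
    by (auto intro: polytope_imp_convex)
  show "solid p"
    using p interior_subset[of "fst p"] unfolding solid_def by (auto intro: polytope_imp_compact)
qed

lemma tiling_tile_unique:
  assumes "is_tiling T" "p \<in> T" "q \<in> T" "x \<in> interior (fst p)" "x \<in> fst q"
  shows "q = p"
proof (rule ccontr)
  assume "q \<noteq> p"
  then have "fst p \<inter> fst q \<subseteq> frontier (fst p)"
    using assms(1-3) unfolding is_tiling_def by blast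
  then show False
    using assms(4,5) interior_subset[of "fst p"] by (auto simp: frontier_def)
qed

lemma delone_tileE:
  assumes "is_delone T" "p \<in> T"
  obtains x where "fst p = {x}"
  using assms unfolding is_delone_def by auto

lemma delone_separated:
  assumes "is_delone T"
  obtains e where "e > 0"
    "\<And>p q x y. p \<in> T \<Longrightarrow> q \<in> T \<Longrightarrow> x \<in> fst p \<Longrightarrow> y \<in> fst q \<Longrightarrow> dist x y < e \<Longrightarrow> p = q"
proof -
  obtain X label where X: "uniform_discrete X" "T = (\<lambda>x. ({x}, label x)) ` X"
    using assms unfolding is_delone_def by blast
  then obtain e where e: "e > 0" "\<And>x y. x \<in> X \<Longrightarrow> y \<in> X \<Longrightarrow> dist x y < e \<Longrightarrow> x = y"
    unfolding uniform_discrete_def by blast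
  show ?thesis
  proof (rule that[OF e(1)])
    fix p q x y assume "p \<in> T" "q \<in> T" "x \<in> fst p" "y \<in> fst q" "dist x y < e"
    moreover from this have "x = y" using X(2) e(2) by auto
    ultimately show "p = q" using X(2) by auto
  qed
qed

lemma tilewise_solid_of_tiling_or_delone: "is_tiling T \<or> is_delone T \<Longrightarrow> tilewise_solid T"
  unfolding tilewise_solid_def
proof (intro ballI)
  fix p assume kind: "is_tiling T \<or> is_delone T" and p: "p \<in> T"
  from kind show "solid p"
  proof
    assume "is_delone T"
    then obtain x where "fst p = {x}" using p by (rule delone_tileE)
    then show ?thesis by (simp add: solid_def)
  next
    assume "is_tiling T"
    then show ?thesis using p by (rule tiling_tileD)
  qed
qed

text \<open>
  Tiles near a tile \<open>p\<close> contain a common inner point of \<open>p\<close> in their interior, and at most one tile of a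
  tiling can do that.  Two points of a Delone set near a given point are near each other, hence equal.
\<close>

lemma nearby_tile_unique:
  assumes "is_tiling T \<and> is_tiling T' \<or> is_delone T \<and> is_delone T'" "p \<in> T"
  obtains e q\<^sub>0 where "e > 0" "\<And>q. q \<in> T' \<Longrightarrow> tile_dist p q < e \<Longrightarrow> q = q\<^sub>0"
proof -
  have solid: "solid p" "\<And>q. q \<in> T' \<Longrightarrow> solid q"
    using assms tilewise_solid_of_tiling_or_delone[of T] tilewise_solid_of_tiling_or_delone[of T']
    unfolding tilewise_solid_def by blast+
  have "\<exists>e>0. \<forall>q\<in>T'. \<forall>q'\<in>T'. tile_dist p q < e \<longrightarrow> tile_dist p q' < e \<longrightarrow> q = q'"
    using assms(1)
  proof
    assume T: "is_tiling T \<and> is_tiling T'"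
    then obtain c where "c \<in> interior (fst p)" using tiling_tileD(2) assms(2) by blast
    then obtain r where r: "r > 0" "ball c r \<subseteq> fst p"
      unfolding mem_interior by blast
    have inner: "c \<in> interior (fst q)" if q: "q \<in> T'" "tile_dist p q < r / 2" for q
    proof -
      have "ball c (r - r / 2) \<subseteq> fst q"
        using q solid(1) solid(2)[OF q(1)] tiling_tileD(1)[of T' q] T r
        by (intro ball_subset_of_hausdorff_close[of "fst p"]) (auto simp: solid_def tile_dist_def)
      then show ?thesis
        using r(1) unfolding mem_interior by (intro exI[of _ "r / 2"]) (simp add: field_simps)
    qed
    have "q = q'" if "q \<in> T'" "q' \<in> T'" "tile_dist p q < r / 2" "tile_dist p q' < r / 2" for q q'
      using tiling_tile_unique[of T' q' q c] T that inner interior_subset by blast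
    then show ?thesis using r(1) by (intro exI[of _ "r / 2"]) auto
  next
    assume T: "is_delone T \<and> is_delone T'"
    then obtain x where x: "fst p = {x}" using delone_tileE assms(2) by blast
    obtain e where e: "e > 0" "\<And>p q x y. p \<in> T' \<Longrightarrow> q \<in> T' \<Longrightarrow> x \<in> fst p \<Longrightarrow> y \<in> fst q \<Longrightarrow> dist x y < e \<Longrightarrow> p = q"
      using delone_separated T by blast
    have "q = q'" if q: "q \<in> T'" "q' \<in> T'" "tile_dist p q < e / 2" "tile_dist p q' < e / 2" for q q'
    proof -
      obtain y where y: "y \<in> fst q" "dist x y < e / 2"
        by (rule tile_dist_less_obtains[OF solid(1) solid(2)[OF q(1)] q(3), of x]) (simp add: x)
      obtain y' where y': "y' \<in> fst q'" "dist x y' < e / 2"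
        by (rule tile_dist_less_obtains[OF solid(1) solid(2)[OF q(2)] q(4), of x]) (simp add: x)
      have "dist y y' < e" using y y' dist_triangle3[of y y' x] by linarith
      then show ?thesis using e(2) q y y' by blast
    qed
    then show ?thesis using e(1) by (intro exI[of _ "e / 2"]) auto
  qed
  then show ?thesis using that by metis
qed

text \<open>
  The tiles of \<open>T'\<close> that correspond to a given tile at the various scales all coincide, so their
  common value has distance \<open>0\<close> from the given tile.
\<close>

lemma tilings_subset_of_close:
  assumes "is_tiling T \<and> is_tiling T' \<or> is_delone T \<and> is_delone T'"
    and "\<And>\<epsilon>. \<epsilon> > 0 \<Longrightarrow> tilings_close \<epsilon> T T'"
  shows "T \<subseteq> T'"
proof
  fix p assume p: "p \<in> T"
  have solid: "solid p" "\<And>q. q \<in> T' \<Longrightarrow> solid q"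
    using assms p tilewise_solid_of_tiling_or_delone[of T] tilewise_solid_of_tiling_or_delone[of T']
    unfolding tilewise_solid_def by blast+
  then obtain x where x: "x \<in> fst p" unfolding solid_def by blast
  have near: "\<exists>q\<in>T'. tile_dist p q < \<epsilon>" if \<epsilon>: "\<epsilon> > 0" "\<epsilon> \<le> 1 / (norm x + 1)" for \<epsilon>
  proof -
    have "norm x + 1 \<le> 1 / \<epsilon>"
      using \<epsilon> norm_ge_zero[of x] by (simp add: field_simps)
    then have "p \<in> patch T 0 (1 / \<epsilon>)"
      using p x by (auto simp: in_patch)
    then show ?thesis
      using assms(2)[OF \<epsilon>(1)] unfolding tilings_close_def by (metis bij_betwE subsetD)
  qed
  obtain e q where e: "e > 0" "\<And>q'. q' \<in> T' \<Longrightarrow> tile_dist p q' < e \<Longrightarrow> q' = q"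
    using nearby_tile_unique[OF assms(1) p] by metis
  define m where "m = min e (1 / (norm x + 1))"
  have m: "m > 0" "m \<le> 1 / (norm x + 1)" "m \<le> e" unfolding m_def using e(1)
    by (auto intro!: divide_pos_pos add_nonneg_pos)
  obtain q' where q': "q' \<in> T'" "tile_dist p q' < m" using near m by blast
  then have q: "q \<in> T'" using e(2)[of q'] m(3) by auto
  have "tile_dist p q \<le> 0"
  proof (rule field_le_epsilon)
    fix d :: real assume "d > 0"
    then have "min d m > 0" "min d m \<le> 1 / (norm x + 1)" using m by auto
    then obtain q'' where "q'' \<in> T'" "tile_dist p q'' < min d m"
      using near by blast
    moreover from this have "q'' = q" using e(2)[of q''] m(3) by auto
    ultimately show "tile_dist p q \<le> 0 + d" by auto
  qed
  then have "p = q" using tile_dist_le_0_eq solid q by blast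
  with q show "p \<in> T'" by simp
qed

text \<open>
  Enough to treat closeness at the various scales as a base of a uniformity.
\<close>

locale solid_tilings =
  fixes \<Omega> :: "('a::euclidean_space, 'l::metric_space) tiling set"
  assumes tilewise_solid: "T \<in> \<Omega> \<Longrightarrow> tilewise_solid T"
begin

text \<open>
  The tilings close to \<open>T\<close> need not form an open set, but they contain the set of those around which
  they form a neighbourhood, and that set is open by \<open>tilings_close_finer\<close>.
\<close>

lemma tilings_close_neighbourhood:
  assumes "T \<in> \<Omega>" "\<epsilon> > 0"
  obtains V where "openin (tiling_topology \<Omega>) V" "T \<in> V" "\<And>T'. T' \<in> V \<Longrightarrow> tilings_close \<epsilon> T T'"
proof
  define V where "V = {S \<in> \<Omega>. \<exists>\<delta>>0. \<forall>S'\<in>\<Omega>. tilings_close \<delta> S S' \<longrightarrow> tilings_close \<epsilon> T S'}"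
  show "T \<in> V" using assms unfolding V_def by blast
  show "tilings_close \<epsilon> T T'" if "T' \<in> V" for T'
    using that tilings_close_refl tilewise_solid unfolding V_def by blast
  have "\<exists>\<gamma>>0. \<forall>S'\<in>\<Omega>. tilings_close \<gamma> S S' \<longrightarrow> S' \<in> V" if SV: "S \<in> V" for S
  proof -
    obtain \<delta> where S: "S \<in> \<Omega>" "\<delta> > 0" "\<And>S'. S' \<in> \<Omega> \<Longrightarrow> tilings_close \<delta> S S' \<Longrightarrow> tilings_close \<epsilon> T S'"
      using SV unfolding V_def by blast
    have "S' \<in> V" if S': "S' \<in> \<Omega>" "tilings_close (finer \<delta>) S S'" for S'
    proof -
      have "tilings_close \<epsilon> T S''" if "S'' \<in> \<Omega>" "tilings_close (finer \<delta>) S' S''" for S''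
        using S(3)[OF that(1)] tilings_close_finer[OF S(2) _ _ _ S'(2) that(2)] tilewise_solid S(1) S'(1) that(1)
        by blast
      then show ?thesis using S'(1) finer_pos[OF S(2)] unfolding V_def by blast
    qed
    then show ?thesis using finer_pos[OF S(2)] by blast
  qed
  then show "openin (tiling_topology \<Omega>) V"
    unfolding openin_tiling_topology V_def by blast
qed

lemma continuous_map_into_tilingsI:
  assumes "\<And>x. x \<in> topspace X \<Longrightarrow> f x \<in> \<Omega>"
    and "\<And>x \<epsilon>. x \<in> topspace X \<Longrightarrow> \<epsilon> > 0 \<Longrightarrow>
      \<exists>W. openin X W \<and> x \<in> W \<and> (\<forall>y\<in>W. tilings_close \<epsilon> (f x) (f y))"
  shows "continuous_map X (tiling_topology \<Omega>) f"
  unfolding continuous_map_def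
proof (intro conjI allI impI)
  show "f \<in> topspace X \<rightarrow> topspace (tiling_topology \<Omega>)" using assms(1) by auto
  fix U assume U: "openin (tiling_topology \<Omega>) U"
  define P where "P = {x \<in> topspace X. f x \<in> U}"
  have "\<exists>W. openin X W \<and> x \<in> W \<and> W \<subseteq> P" if "x \<in> P" for x
  proof -
    have x: "x \<in> topspace X" "f x \<in> U" using that unfolding P_def by auto
    then obtain \<epsilon> where \<epsilon>: "\<epsilon> > 0" "\<And>T'. T' \<in> \<Omega> \<Longrightarrow> tilings_close \<epsilon> (f x) T' \<Longrightarrow> T' \<in> U"
      using U unfolding openin_tiling_topology by blast
    obtain W where W: "openin X W" "x \<in> W" "\<And>y. y \<in> W \<Longrightarrow> tilings_close \<epsilon> (f x) (f y)"
      using assms(2)[OF x(1) \<epsilon>(1)] by blast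
    have "y \<in> P" if "y \<in> W" for y
      using that W \<epsilon>(2)[of "f y"] assms(1) openin_subset[OF W(1)] unfolding P_def by blast
    with W show ?thesis by blast
  qed
  then show "openin X {x \<in> topspace X. f x \<in> U}"
    unfolding P_def[symmetric] by (subst openin_subopen) blast
qed

end

lemma solid_tilings_of_tiling_space: "tiling_space \<Omega> \<Longrightarrow> solid_tilings \<Omega>"
  unfolding tiling_space_def by (intro solid_tilings.intro tilewise_solid_of_tiling_or_delone) blast

lemma Hausdorff_tiling_topology:
  assumes "tiling_space \<Omega>"
  shows "Hausdorff_space (tiling_topology \<Omega>)"
  unfolding Hausdorff_space_def
proof (intro allI impI)
  interpret solid_tilings \<Omega> using assms by (rule solid_tilings_of_tiling_space)
  fix T T' assume T: "T \<in> topspace (tiling_topology \<Omega>) \<and> T' \<in> topspace (tiling_topology \<Omega>) \<and> T \<noteq> T'"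
  have kind: "is_tiling T \<and> is_tiling T' \<or> is_delone T \<and> is_delone T'"
    using assms T unfolding tiling_space_def by auto
  have "\<exists>\<epsilon>>0. \<not> tilings_close \<epsilon> T T'"
  proof (rule ccontr)
    assume "\<not> ?thesis"
    then have close: "\<And>\<epsilon>. \<epsilon> > 0 \<Longrightarrow> tilings_close \<epsilon> T T'" by blast
    have "T \<subseteq> T'" "T' \<subseteq> T"
      using tilings_subset_of_close[of T T'] tilings_subset_of_close[of T' T] kind close tilings_close_sym
      by blast+
    then show False using T by blast
  qed
  then obtain \<epsilon> where \<epsilon>: "\<epsilon> > 0" "\<not> tilings_close \<epsilon> T T'" by blast
  define \<delta> where "\<delta> = finer \<epsilon>"
  have \<delta>: "\<delta> > 0" using \<epsilon>(1) finer_pos unfolding \<delta>_def by blast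
  obtain V where V: "openin (tiling_topology \<Omega>) V" "T \<in> V" "\<And>S. S \<in> V \<Longrightarrow> tilings_close \<delta> T S"
    by (rule tilings_close_neighbourhood[of T \<delta>]) (use T \<delta> in simp_all)
  obtain V' where V': "openin (tiling_topology \<Omega>) V'" "T' \<in> V'" "\<And>S. S \<in> V' \<Longrightarrow> tilings_close \<delta> T' S"
    by (rule tilings_close_neighbourhood[of T' \<delta>]) (use T \<delta> in simp_all)
  have "S \<notin> V'" if "S \<in> V" for S
  proof
    assume "S \<in> V'"
    then have "tilings_close \<epsilon> T T'"
      using tilings_close_finer[of \<epsilon> T S T'] V(3)[OF that] tilings_close_sym[OF V'(3)] T tilewise_solid
        openin_subset[OF V(1)] that \<epsilon>(1) unfolding \<delta>_def by auto
    with \<epsilon>(2) show False by simp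
  qed
  then show "\<exists>U V. openin (tiling_topology \<Omega>) U \<and> openin (tiling_topology \<Omega>) V \<and> T \<in> U \<and> T' \<in> V \<and> disjnt U V"
    using V V' unfolding disjnt_def by blast
qed

text \<open>
  Translating \<open>T\<close> by \<open>v\<close> and the nearby \<open>S\<close> by \<open>w\<close> is compared through \<open>S \<ominus> v\<close>.
\<close>

lemma continuous_map_translate:
  assumes "tiling_space \<Omega>"
  shows "continuous_map (prod_topology (tiling_topology \<Omega>) euclidean) (tiling_topology \<Omega>) (\<lambda>(T, v). T \<ominus> v)"
proof -
  interpret solid_tilings \<Omega> using assms by (rule solid_tilings_of_tiling_space)
  have closed: "T \<ominus> v \<in> \<Omega>" if "T \<in> \<Omega>" for T v
    using assms that unfolding tiling_space_def by blast
  show ?thesis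
  proof (rule continuous_map_into_tilingsI, goal_cases)
    case (1 z)
    then show ?case using closed by (auto simp: case_prod_unfold)
  next
    case (2 z \<epsilon>)
    obtain T v where z: "z = (T, v)" "T \<in> \<Omega>" using 2(1) by (cases z) auto
    define \<delta> where "\<delta> = finer \<epsilon>"
    have \<delta>: "\<delta> > 0" using 2(2) finer_pos unfolding \<delta>_def by blast
    define \<gamma> where "\<gamma> = min \<delta> (1 / (1 / \<delta> + norm v))"
    have pos: "1 / \<delta> + norm v > 0" using \<delta>(1) by (simp add: add_pos_nonneg)
    have \<gamma>: "\<gamma> > 0" "\<gamma> \<le> \<delta>" unfolding \<gamma>_def using \<delta> pos by auto
    have "\<gamma> \<le> 1 / (1 / \<delta> + norm v)" unfolding \<gamma>_def by simp
    then have \<gamma>': "1 / \<delta> + norm v \<le> 1 / \<gamma>"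
      using \<gamma>(1) pos by (metis divide_le_eq le_divide_eq mult.commute)
    obtain V where V: "openin (tiling_topology \<Omega>) V" "T \<in> V" "\<And>S. S \<in> V \<Longrightarrow> tilings_close \<gamma> T S"
      by (rule tilings_close_neighbourhood[of T \<gamma>]) (use z(2) \<gamma>(1) in simp_all)
    have "tilings_close \<epsilon> (T \<ominus> v) (S \<ominus> w)" if S: "S \<in> V" "w \<in> ball v \<delta>" for S w
    proof (rule tilings_close_finer[OF 2(2), folded \<delta>_def, where T' = "S \<ominus> v"])
      have "S \<in> \<Omega>" using S(1) openin_subset[OF V(1)] by auto
      then show "tilings_close \<delta> (T \<ominus> v) (S \<ominus> v)"
        using tilings_close_translate[OF _ _ V(3)[OF S(1)] \<gamma> \<gamma>'] tilewise_solid z(2) by blast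
      show "tilings_close \<delta> (S \<ominus> v) (S \<ominus> w)"
        using S(2) tilings_close_translate_self[of S v w \<delta>] tilewise_solid[of S] \<open>S \<in> \<Omega>\<close> by simp
      show "tilewise_solid (T \<ominus> v)" "tilewise_solid (S \<ominus> v)" "tilewise_solid (S \<ominus> w)"
        using closed tilewise_solid z(2) \<open>S \<in> \<Omega>\<close> by blast+
    qed
    moreover have "openin (prod_topology (tiling_topology \<Omega>) euclidean) (V \<times> ball v \<delta>)"
      using V(1) by (simp add: openin_prod_Times_iff)
    ultimately show ?case
      using V(2) \<delta>(1) z(1) by (intro exI[of _ "V \<times> ball v \<delta>"]) auto
  qed
qed

lemma compact_free_action_translate:
  assumes "tiling_space \<Omega>" "aperiodic_space \<Omega>"
  shows "compact_free_action (tiling_topology \<Omega>) (\<ominus>)"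
proof
  show "continuous_map (prod_topology (tiling_topology \<Omega>) euclidean) (tiling_topology \<Omega>) (\<lambda>(T, v). T \<ominus> v)"
    using assms(1) by (rule continuous_map_translate)
  show "Hausdorff_space (tiling_topology \<Omega>)"
    using assms(1) by (rule Hausdorff_tiling_topology)
qed (use assms in \<open>auto simp: tiling_space_def aperiodic_space_def\<close>)

lemma orbit_homeomorphism_of_orbit_equivalence:
  assumes "tiling_space \<Omega>" "aperiodic_space \<Omega>" "tiling_space \<Omega>'" "aperiodic_space \<Omega>'"
    and h: "orbit_equivalence \<Omega> \<Omega>' h"
  shows "orbit_homeomorphism (tiling_topology \<Omega>) (\<ominus>) (tiling_topology \<Omega>') (\<ominus>) h"
proof -
  have orb: "\<exists>w. h (T \<ominus> v) = h T \<ominus> w" "\<exists>w. h (T \<ominus> w) = h T \<ominus> v" if "T \<in> \<Omega>" for T v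
  proof -
    have "range (\<lambda>v. h (T \<ominus> v)) = range (\<lambda>v. h T \<ominus> v)"
      using h that unfolding orbit_equivalence_def tiling_orbit_def by (simp add: image_image)
    then show "\<exists>w. h (T \<ominus> v) = h T \<ominus> w" "\<exists>w. h (T \<ominus> w) = h T \<ominus> v"
      by (metis rangeI rangeE)+
  qed
  have "homeomorphic_map (tiling_topology \<Omega>) (tiling_topology \<Omega>') h"
    using h unfolding orbit_equivalence_def by blast
  moreover have "orbit_map (tiling_topology \<Omega>) (\<ominus>) (tiling_topology \<Omega>') (\<ominus>) h"
    using assms orb(1) homeomorphic_imp_continuous_map[OF calculation]
    by (intro orbit_map.intro compact_free_action_translate orbit_map_axioms.intro) auto
  ultimately show ?thesis
    using orb(2) by (intro orbit_homeomorphism.intro orbit_homeomorphism_axioms.intro) auto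
qed

lemma displacement_eq_disp:
  assumes "orbit_map (tiling_topology \<Omega>) (\<ominus>) (tiling_topology \<Omega>') (\<ominus>) h"
  shows "displacement h = orbit_map.disp (\<ominus>) (\<ominus>) h"
  by (intro ext) (simp add: displacement_def orbit_map.disp_def[OF assms])

section \<open>Finite local complexity\<close>

text \<open>
  The lowest corner of the bounding box.  It serves as a reference point that moves along with
  translations and is Lipschitz for the Hausdorff distance.
\<close>

definition corner :: "'a::euclidean_space set \<Rightarrow> 'a" where
  "corner S = (\<Sum>b\<in>Basis. (INF y\<in>S. y \<bullet> b) *\<^sub>R b)"

lemma corner_inner: "b \<in> Basis \<Longrightarrow> corner S \<bullet> b = (INF y\<in>S. y \<bullet> b)"
  unfolding corner_def by (simp add: inner_sum_left_Basis)

lemma bdd_below_inner: "compact S \<Longrightarrow> bdd_below ((\<lambda>y. y \<bullet> b) ` S)"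
  by (intro bounded_imp_bdd_below compact_imp_bounded compact_continuous_image continuous_intros)

lemma corner_translate:
  assumes "compact S" "S \<noteq> {}"
  shows "corner ((\<lambda>y. y - v) ` S) = corner S - v"
proof (rule euclidean_eqI)
  fix b :: 'a assume b: "b \<in> Basis"
  have "(INF y\<in>S. y \<bullet> b - v \<bullet> b) = (INF y\<in>S. y \<bullet> b) - v \<bullet> b"
  proof (rule antisym)
    show "(INF y\<in>S. y \<bullet> b - v \<bullet> b) \<le> (INF y\<in>S. y \<bullet> b) - v \<bullet> b"
    proof -
      have "bdd_below ((\<lambda>y. y \<bullet> b - v \<bullet> b) ` S)"
        using assms(1)
        by (intro bounded_imp_bdd_below compact_imp_bounded compact_continuous_image continuous_intros)
      then have "(INF y\<in>S. y \<bullet> b - v \<bullet> b) \<le> x \<bullet> b - v \<bullet> b" if "x \<in> S" for x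
        using that by (rule cINF_lower)
      then have "(INF y\<in>S. y \<bullet> b - v \<bullet> b) + v \<bullet> b \<le> x \<bullet> b" if "x \<in> S" for x
        using that by (simp add: le_diff_eq)
      then have "(INF y\<in>S. y \<bullet> b - v \<bullet> b) + v \<bullet> b \<le> (INF y\<in>S. y \<bullet> b)"
        using assms(2) by (intro cINF_greatest) auto
      then show ?thesis by simp
    qed
    show "(INF y\<in>S. y \<bullet> b) - v \<bullet> b \<le> (INF y\<in>S. y \<bullet> b - v \<bullet> b)"
      using assms bdd_below_inner by (intro cINF_greatest) (auto intro: cINF_lower)
  qed
  then show "corner ((\<lambda>y. y - v) ` S) \<bullet> b = (corner S - v) \<bullet> b"
    using b by (simp add: corner_inner inner_diff_left image_image)
qed

lemma dist_corner_le:
  fixes S T :: "'a::euclidean_space set"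
  assumes "compact S" "S \<noteq> {}" "compact T" "T \<noteq> {}"
  shows "dist (corner S) (corner T) \<le> real DIM('a) * hausdorff_dist S T"
proof -
  have le: "(INF y\<in>T. y \<bullet> b) \<le> (INF y\<in>S. y \<bullet> b) + hausdorff_dist S T"
    if S: "b \<in> Basis" "compact S" "S \<noteq> {}" "compact T" "T \<noteq> {}" for S T and b :: 'a
  proof (rule field_le_epsilon)
    fix e :: real assume e: "e > 0"
    have "(INF y\<in>T. y \<bullet> b) - hausdorff_dist S T - e \<le> x \<bullet> b" if x: "x \<in> S" for x
    proof -
      obtain y where y: "y \<in> T" "dist x y < hausdorff_dist S T + e"
        by (rule hausdorff_dist_less_obtains[of S T "hausdorff_dist S T + e" x]) (use S x e in auto)
      have "(INF y\<in>T. y \<bullet> b) \<le> y \<bullet> b"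
        using y S by (intro cINF_lower bdd_below_inner) auto
      moreover have "\<bar>(y - x) \<bullet> b\<bar> \<le> dist x y"
        using Basis_le_norm[OF S(1), of "y - x"] by (simp add: dist_norm norm_minus_commute)
      ultimately show ?thesis using y(2) by (simp add: inner_diff_left)
    qed
    then have "(INF y\<in>T. y \<bullet> b) - hausdorff_dist S T - e \<le> (INF y\<in>S. y \<bullet> b)"
      using S by (intro cINF_greatest) auto
    then show "(INF y\<in>T. y \<bullet> b) \<le> (INF y\<in>S. y \<bullet> b) + hausdorff_dist S T + e" by simp
  qed
  have "norm (corner S - corner T) \<le> (\<Sum>b\<in>Basis. \<bar>(corner S - corner T) \<bullet> b\<bar>)"
    by (rule norm_le_l1)
  also have "\<dots> \<le> (\<Sum>b\<in>(Basis::'a set). hausdorff_dist S T)"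
  proof (rule sum_mono)
    fix b :: 'a assume b: "b \<in> Basis"
    show "\<bar>(corner S - corner T) \<bullet> b\<bar> \<le> hausdorff_dist S T"
      using le[OF b assms] le[OF b assms(3,4,1,2)] b
      by (simp add: inner_diff_left corner_inner hausdorff_dist_commute)
  qed
  finally show ?thesis by (simp add: dist_norm)
qed

definition anchor :: "('a::euclidean_space, 'l) tile \<Rightarrow> 'a" where
  "anchor p = corner (fst p)"

definition prototile :: "('a::euclidean_space, 'l) tile \<Rightarrow> ('a, 'l) tile" where
  "prototile p = shift_tile p (anchor p)"

lemma anchor_shift_tile: "solid p \<Longrightarrow> anchor (shift_tile p v) = anchor p - v"
  unfolding anchor_def solid_def by (simp add: fst_shift_tile corner_translate)

lemma prototile_shift_tile: "solid p \<Longrightarrow> prototile (shift_tile p v) = prototile p"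
  unfolding prototile_def by (simp add: anchor_shift_tile)

lemma shift_prototile: "shift_tile (prototile p) (- anchor p) = p"
  unfolding prototile_def by simp

lemma solid_prototile [simp]: "solid (prototile p) \<longleftrightarrow> solid p"
  unfolding prototile_def by simp

lemma dist_anchor_le:
  fixes p q :: "('a::euclidean_space, 'l::metric_space) tile"
  assumes "solid p" "solid q"
  shows "dist (anchor p) (anchor q) \<le> real DIM('a) * tile_dist p q"
proof -
  have "dist (anchor p) (anchor q) \<le> real DIM('a) * hausdorff_dist (fst p) (fst q)"
    using assms unfolding anchor_def solid_def by (intro dist_corner_le) auto
  also have "\<dots> \<le> real DIM('a) * tile_dist p q"
    unfolding tile_dist_def by (intro mult_left_mono) auto
  finally show ?thesis .
qed

lemma tile_dist_prototile_le:
  fixes p q :: "('a::euclidean_space, 'l::metric_space) tile"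
  assumes "solid p" "solid q"
  shows "tile_dist (prototile p) (prototile q) \<le> (real DIM('a) + 1) * tile_dist p q"
  using tile_dist_shift_tile_le[OF assms, of "anchor p" "anchor q"] dist_anchor_le[OF assms]
  unfolding prototile_def by (simp add: algebra_simps)

lemma finite_patch_delone:
  fixes T :: "('a::euclidean_space, 'l) tiling"
  assumes "is_delone T"
  shows "finite (patch T x R)"
proof -
  obtain X label where X: "uniform_discrete X" "T = (\<lambda>x. ({x}, label x)) ` X"
    using assms unfolding is_delone_def by blast
  have "finite (X \<inter> ball x R)"
    using uniform_discrete_subset[OF X(1), of "X \<inter> ball x R"] uniform_discrete_finite_iff
    by (metis Int_lower1 Int_lower2 bounded_ball bounded_subset)
  moreover have "patch T x R \<subseteq> (\<lambda>x. ({x}, label x)) ` (X \<inter> ball x R)"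
    unfolding X(2) patch_def by auto
  ultimately show ?thesis
    using finite_subset by blast
qed

text \<open>
  Infinitely many tiles near \<open>x\<close> would have representatives that accumulate at a prototile \<open>q\<^sub>0\<close>, and bounded
  translation vectors, which accumulate too.  So two of them would be so close together that both
  contain a common small ball.
\<close>

lemma finite_patch_tiling:
  fixes \<Omega> :: "('a::euclidean_space, 'l::metric_space) tiling set"
  assumes "tiling_space \<Omega>" and tilings: "\<And>T. T \<in> \<Omega> \<Longrightarrow> is_tiling T" and T: "T \<in> \<Omega>"
  shows "finite (patch T x R)"
proof (rule ccontr)
  assume "infinite (patch T x R)"
  then obtain p :: "nat \<Rightarrow> ('a, 'l) tile" where p: "inj p" "\<And>n. p n \<in> patch T x R"
    using infinite_countable_subset by (metis range_subsetD)
  have pT: "p n \<in> T" for n using p(2) by (simp add: in_patch)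
  have "compact_up_to_translation (\<Union>\<Omega>)"
    using assms(1) unfolding tiling_space_def by blast
  then obtain P where P: "P \<subseteq> \<Union>\<Omega>" "\<forall>p\<in>\<Union>\<Omega>. \<exists>q\<in>P. \<exists>v. {p} = {q} \<ominus> v"
    "\<forall>\<sigma>::nat \<Rightarrow> ('a, 'l) tile. range \<sigma> \<subseteq> P \<longrightarrow>
           (\<exists>q\<in>P. \<exists>r. strict_mono r \<and> (\<lambda>n. tile_dist (\<sigma> (r n)) q) \<longlonglongrightarrow> 0)"
    unfolding compact_up_to_translation_def by (elim exE conjE) (rule that)
  have "\<exists>q v. q \<in> P \<and> p n = shift_tile q v" for n
  proof -
    have "p n \<in> \<Union>\<Omega>" using pT T by blast
    then obtain q v where qv: "q \<in> P" "{p n} = {q} \<ominus> v" using P(2) by blast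
    from qv(2) have "p n = shift_tile q v" by (simp add: translate_eq_shift_tile)
    with qv(1) show ?thesis by blast
  qed
  then obtain q v where qv: "\<And>n. q n \<in> P" "\<And>n. p n = shift_tile (q n) (v n)" by metis
  obtain q\<^sub>0 r where q\<^sub>0: "q\<^sub>0 \<in> P" "strict_mono r" "(\<lambda>n. tile_dist (q (r n)) q\<^sub>0) \<longlonglongrightarrow> 0"
  proof -
    have "range q \<subseteq> P" using qv(1) by blast
    from P(3)[rule_format, OF this] show ?thesis using that by blast
  qed
  obtain T\<^sub>0 where T\<^sub>0: "T\<^sub>0 \<in> \<Omega>" "q\<^sub>0 \<in> T\<^sub>0" using P(1) q\<^sub>0(1) by blast
  have solid: "solid q\<^sub>0" "\<And>n. solid (q n)"
    using tiling_tileD(3)[OF tilings[OF T\<^sub>0(1)] T\<^sub>0(2)] tiling_tileD(3)[OF tilings[OF T] pT]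
    by (simp_all add: qv(2))
  obtain c \<rho> where c: "\<rho> > 0" "ball c \<rho> \<subseteq> fst q\<^sub>0"
    using tiling_tileD(2)[OF tilings[OF T\<^sub>0(1)] T\<^sub>0(2)] mem_interior by blast
  have "bounded (fst q\<^sub>0)" using solid(1) compact_imp_bounded unfolding solid_def by blast
  then obtain M where M: "\<forall>y\<in>fst q\<^sub>0. norm y \<le> M"
    unfolding bounded_iff by blast
  have "eventually (\<lambda>n. tile_dist (q (r n)) q\<^sub>0 < min (\<rho> / 2) 1) sequentially"
    by (rule order_tendstoD(2)[OF q\<^sub>0(3)]) (use c(1) in simp)
  then obtain N where "\<forall>n\<ge>N. tile_dist (q (r n)) q\<^sub>0 < min (\<rho> / 2) 1"
    unfolding eventually_sequentially by blast
  then have N: "tile_dist q\<^sub>0 (q (r n)) < min (\<rho> / 2) 1" if "n \<ge> N" for n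
    using that by (simp add: tile_dist_commute[of q\<^sub>0])
  have convex: "convex (fst (q n))" for n
  proof -
    have "fst (q n) = (\<lambda>y. y + v n) ` fst (p n)"
      by (simp add: qv(2) fst_shift_tile image_image)
    then show ?thesis
      using tiling_tileD(1)[OF tilings[OF T] pT[of n]] convex_translation[of "fst (p n)" "v n"]
      by (simp add: add.commute)
  qed
  have inner: "ball c (\<rho> / 2) \<subseteq> fst (q (r n))" if "n \<ge> N" for n
  proof -
    have "hausdorff_dist (fst q\<^sub>0) (fst (q (r n))) < \<rho> / 2"
      using N[OF that] unfolding tile_dist_def by linarith
    then have "ball c (\<rho> - \<rho> / 2) \<subseteq> fst (q (r n))"
      using c solid(1) solid(2)[of "r n"] convex[of "r n"] unfolding solid_def
      by (intro ball_subset_of_hausdorff_close[of "fst q\<^sub>0"]) simp_all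
    then show ?thesis by simp
  qed
  define B where "B = M + 1 + norm x + R"
  have bounded_v: "v (r n) \<in> cball 0 B" if n: "n \<ge> N" for n
  proof -
    have "fst (p (r n)) \<inter> ball x R \<noteq> {}" using p(2)[of "r n"] unfolding in_patch by blast
    then obtain y where y: "y \<in> fst (p (r n))" "dist x y < R"
      unfolding ball_def by blast
    then have "y + v (r n) \<in> fst (q (r n))" by (auto simp: qv(2) fst_shift_tile)
    then obtain z where z: "z \<in> fst q\<^sub>0" "dist (y + v (r n)) z < 1"
      by (rule tile_dist_less_obtains[of "q (r n)" q\<^sub>0 1, rotated 3])
        (use solid N[OF n] in \<open>auto simp: tile_dist_commute\<close>)
    have "v (r n) = ((y + v (r n)) - z) + z + (x - y) - x" by simp
    then have "norm (v (r n)) \<le> norm ((y + v (r n)) - z + z + (x - y)) + norm x"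
      using norm_triangle_ineq4[of "(y + v (r n)) - z + z + (x - y)" x] by simp
    also have "\<dots> \<le> norm ((y + v (r n)) - z) + norm z + norm (x - y) + norm x"
      using norm_triangle_ineq[of "(y + v (r n)) - z + z" "x - y"] norm_triangle_ineq[of "(y + v (r n)) - z" z]
      by linarith
    finally show ?thesis
      using z(2) bspec[OF M z(1)] y(2) unfolding B_def mem_cball_0 dist_norm by linarith
  qed
  have "\<forall>n. v (r (n + N)) \<in> cball 0 B" using bounded_v by simp
  then have "bounded (range (\<lambda>n. v (r (n + N))))"
    by (intro bounded_subset[OF bounded_cball[of 0 B]]) blast
  then obtain l t where lt: "strict_mono (t :: nat \<Rightarrow> nat)" "((\<lambda>n. v (r (n + N))) \<circ> t) \<longlonglongrightarrow> l"
    using bounded_imp_convergent_subsequence by blast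
  then have "Cauchy ((\<lambda>n. v (r (n + N))) \<circ> t)" using LIMSEQ_imp_Cauchy by blast
  moreover have "\<rho> / 2 > 0" using c(1) by simp
  ultimately obtain m where m: "\<forall>i\<ge>m. \<forall>j\<ge>m. dist (v (r (t i + N))) (v (r (t j + N))) < \<rho> / 2"
    unfolding Cauchy_def o_def by blast
  define i j where "i = r (t m + N)" and "j = r (t (Suc m) + N)"
  have "i \<noteq> j"
    using strict_monoD[OF lt(1), of m "Suc m"] strict_mono_eq[OF q\<^sub>0(2)] unfolding i_def j_def by simp
  have in_ball: "c - v i \<in> ball (c - v k) (\<rho> / 2)" "ball (c - v k) (\<rho> / 2) \<subseteq> fst (p k)" if "k = i \<or> k = j" for k
  proof -
    have "dist (v i) (v k) < \<rho> / 2"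
      using m[rule_format, of m m] m[rule_format, of m "Suc m"] that unfolding i_def j_def by auto
    then show "c - v i \<in> ball (c - v k) (\<rho> / 2)" by (simp add: dist_norm norm_minus_commute)
    have "\<exists>n\<ge>N. k = r n" using that unfolding i_def j_def by (metis le_add2)
    then have inner_k: "ball c (\<rho> / 2) \<subseteq> fst (q k)" using inner by blast
    show "ball (c - v k) (\<rho> / 2) \<subseteq> fst (p k)"
    proof
      fix z assume "z \<in> ball (c - v k) (\<rho> / 2)"
      then have "z + v k \<in> ball c (\<rho> / 2)" by (simp add: dist_norm algebra_simps)
      then have "z + v k \<in> fst (q k)" using inner_k by blast
      then have "(z + v k) - v k \<in> fst (p k)" unfolding qv(2) fst_shift_tile by (rule imageI)
      then show "z \<in> fst (p k)" by simp
    qed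
  qed
  have "c - v i \<in> interior (fst (p i))"
    using in_ball(1)[of i] interior_maximal[OF in_ball(2)[of i] open_ball] by blast
  moreover have "c - v i \<in> fst (p j)" using in_ball[of j] by blast
  ultimately have "p j = p i"
    using tiling_tile_unique[OF tilings[OF T] pT pT] by blast
  with \<open>i \<noteq> j\<close> p(1) show False by (auto simp: inj_def)
qed

locale FLC_space =
  fixes \<Omega> :: "('a::euclidean_space, 'l::metric_space) tiling set"
  assumes tiling_space: "tiling_space \<Omega>" and FLC: "FLC \<Omega>"
begin

sublocale solid_tilings \<Omega>
  using tiling_space by (rule solid_tilings_of_tiling_space)

lemma solid_tile: "T \<in> \<Omega> \<Longrightarrow> p \<in> T \<Longrightarrow> solid p"
  using tilewise_solid[of T] unfolding tilewise_solid_def by simp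

lemma translate_closed: "T \<in> \<Omega> \<Longrightarrow> T \<ominus> v \<in> \<Omega>"
  using tiling_space unfolding tiling_space_def by blast

lemma finite_patch:
  assumes "T \<in> \<Omega>"
  shows "finite (patch T x R)"
proof -
  have "(\<forall>T\<in>\<Omega>. is_tiling T) \<or> (\<forall>T\<in>\<Omega>. is_delone T)"
    using tiling_space unfolding tiling_space_def by (elim conjE)
  then show ?thesis
  proof
    assume "\<forall>T\<in>\<Omega>. is_tiling T"
    then show ?thesis using finite_patch_tiling[OF tiling_space _ assms] by simp
  next
    assume "\<forall>T\<in>\<Omega>. is_delone T"
    then show ?thesis using finite_patch_delone[of T x R] assms by blast
  qed
qed

text \<open>
  The relative positions of pairs of tiles inside a common ball.  The finiteness of this set is the form
  in which finite local complexity is used for comparing nearby tilings.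
\<close>

definition pair_types :: "real \<Rightarrow> (('a, 'l) tile \<times> ('a, 'l) tile \<times> 'a) set" where
  "pair_types R = {(prototile p, prototile q, anchor q - anchor p) |T x p q.
     T \<in> \<Omega> \<and> p \<in> patch T x R \<and> q \<in> patch T x R}"

text \<open>
  The relative positions inside a patch depend only on its translation class, and patches are
  finite.
\<close>

lemma finite_pair_types: "finite (pair_types R)"
proof -
  define rel where "rel Q = (\<Union>p\<in>Q. (\<lambda>q. (prototile p, prototile q, anchor q - anchor p)) ` Q)"
    for Q :: "('a, 'l) tiling"
  have rel_translate: "rel (patch T x R \<ominus> v) = rel (patch T x R)" if "T \<in> \<Omega>" for T x v
  proof -
    have "solid p" if "p \<in> patch T x R" for p
      using that solid_tile \<open>T \<in> \<Omega>\<close> by (simp add: in_patch)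
    then show ?thesis
      unfolding rel_def translate_eq_shift_tile
      by (simp add: image_image prototile_shift_tile anchor_shift_tile cong: image_cong)
  qed
  have "pair_types R \<subseteq> (\<Union>C\<in>{tiling_orbit (patch T x R) |T x. T \<in> \<Omega>}. \<Union> (rel ` C))"
  proof
    fix z assume "z \<in> pair_types R"
    then obtain T x p q where z: "z = (prototile p, prototile q, anchor q - anchor p)"
      "T \<in> \<Omega>" "p \<in> patch T x R" "q \<in> patch T x R"
      unfolding pair_types_def by blast
    have "z \<in> rel (patch T x R)" unfolding rel_def using z by force
    moreover have "patch T x R \<in> tiling_orbit (patch T x R)"
      unfolding tiling_orbit_def by (metis rangeI translate_0)
    ultimately show "z \<in> (\<Union>C\<in>{tiling_orbit (patch T x R) |T x. T \<in> \<Omega>}. \<Union> (rel ` C))"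
      using z(2) by blast
  qed
  moreover have "finite (\<Union>C\<in>{tiling_orbit (patch T x R) |T x. T \<in> \<Omega>}. \<Union> (rel ` C))"
  proof (rule finite_UN_I)
    show "finite {tiling_orbit (patch T x R) |T x. T \<in> \<Omega>}"
      using FLC unfolding FLC_def by blast
    fix C assume "C \<in> {tiling_orbit (patch T x R) |T x. T \<in> \<Omega>}"
    then obtain T x where C: "C = tiling_orbit (patch T x R)" "T \<in> \<Omega>" by blast
    have "\<Union> (rel ` C) = rel (patch T x R)"
      unfolding C(1) tiling_orbit_def using rel_translate[OF C(2)] by auto
    then show "finite (\<Union> (rel ` C))"
      using finite_patch[OF C(2)] unfolding rel_def by simp
  qed
  ultimately show ?thesis by (rule finite_subset)
qed

lemma finite_prototiles: "finite (prototile ` \<Union>\<Omega>)"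
proof -
  have "prototile ` \<Union>\<Omega> \<subseteq> fst ` pair_types 1"
  proof
    fix z assume "z \<in> prototile ` \<Union>\<Omega>"
    then obtain T p where z: "z = prototile p" "T \<in> \<Omega>" "p \<in> T" by blast
    then obtain x where "x \<in> fst p" using solid_tile unfolding solid_def by blast
    then have "p \<in> patch T x 1" using z(3) centre_in_ball[of x 1] by (auto simp: in_patch)
    then have "(prototile p, prototile p, anchor p - anchor p) \<in> pair_types 1"
      using z(2) unfolding pair_types_def by blast
    then show "z \<in> fst ` pair_types 1" using z(1) by force
  qed
  then show ?thesis by (rule finite_subset) (intro finite_imageI finite_pair_types)
qed

end

lemma finite_imp_uniform_gap:
  fixes d :: "'x \<Rightarrow> 'x \<Rightarrow> real"
  assumes "finite A" "\<And>x y. x \<in> A \<Longrightarrow> y \<in> A \<Longrightarrow> d x y \<le> 0 \<Longrightarrow> x = y"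
  shows "\<exists>\<gamma>>0. \<forall>x\<in>A. \<forall>y\<in>A. d x y < \<gamma> \<longrightarrow> x = y"
proof (intro exI conjI ballI impI)
  define D where "D = insert 1 ((\<lambda>z. d (fst z) (snd z)) ` {z \<in> A \<times> A. fst z \<noteq> snd z})"
  have D: "finite D" "D \<noteq> {}" unfolding D_def using assms(1) by auto
  have "\<forall>e\<in>D. e > 0"
    unfolding D_def using assms(2) by force
  then show "Min D > 0" using D by simp
  fix x y assume that: "x \<in> A" "y \<in> A" "d x y < Min D"
  show "x = y"
  proof (rule ccontr)
    assume "x \<noteq> y"
    then have "d x y \<in> D" unfolding D_def using that(1,2) by force
    then show False using that(3) Min_le[OF D(1)] by fastforce
  qed
qed

context FLC_space
begin

text \<open>
  A correspondence with small distances preserves prototiles, since these are finitely many; so each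
  tile is moved by a small translation.  Two tiles in a ball are moved by the same vector, because their
  relative positions before and after belong to the finite set of pair types and are close.  Hence the
  whole patch is moved by one vector \<open>z\<close>.
\<close>

lemma close_imp_patch_eq:
  assumes "\<eta> > 0"
  shows "\<exists>\<epsilon>>0. \<forall>T\<in>\<Omega>. \<forall>T'\<in>\<Omega>. tilings_close \<epsilon> T T' \<longrightarrow>
      (\<exists>z. norm z < \<eta> \<and> patch (T' \<ominus> z) 0 R = patch T 0 R)"
proof -
  define P where "P = prototile ` \<Union>\<Omega>"
  have "\<exists>\<gamma>>0. \<forall>p\<in>P. \<forall>q\<in>P. tile_dist p q < \<gamma> \<longrightarrow> p = q"
  proof (rule finite_imp_uniform_gap)
    show "finite P" unfolding P_def by (rule finite_prototiles)
    fix p q assume pq: "p \<in> P" "q \<in> P" "tile_dist p q \<le> 0"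
    have "solid p" if "p \<in> P" for p using that solid_tile unfolding P_def by (elim imageE UnionE) simp
    then show "p = q" using tile_dist_le_0_eq pq by blast
  qed
  then obtain \<gamma>\<^sub>1 where \<gamma>\<^sub>1: "\<gamma>\<^sub>1 > 0"
    "\<forall>p\<in>P. \<forall>q\<in>P. tile_dist p q < \<gamma>\<^sub>1 \<longrightarrow> p = q" by blast
  define D where "D = (\<lambda>z. snd (snd z)) ` pair_types (R + 2)"
  have "finite D" unfolding D_def using finite_pair_types by blast
  then have "\<exists>\<gamma>>0. \<forall>v\<in>D. \<forall>w\<in>D. dist v w < \<gamma> \<longrightarrow> v = w"
    by (rule finite_imp_uniform_gap) auto
  then obtain \<gamma>\<^sub>2 where \<gamma>\<^sub>2: "\<gamma>\<^sub>2 > 0" "\<forall>v\<in>D. \<forall>w\<in>D. dist v w < \<gamma>\<^sub>2 \<longrightarrow> v = w" by blast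
  have D: "anchor q - anchor p \<in> D" if "T \<in> \<Omega>" "p \<in> patch T 0 (R + 2)" "q \<in> patch T 0 (R + 2)" for T p q
  proof -
    have "(prototile p, prototile q, anchor q - anchor p) \<in> pair_types (R + 2)"
      unfolding pair_types_def using that by blast
    then show ?thesis unfolding D_def by (rule rev_image_eqI) simp
  qed
  define n where "n = real DIM('a)"
  define m where "m = min (min \<gamma>\<^sub>1 \<gamma>\<^sub>2) (min \<eta> 1)"
  \<comment> \<open>The first bound makes the correspondence cover a ball of radius \<open>R + 2\<close>; the factor
    \<open>n + 1\<close> is the Lipschitz constant of the passage to prototiles.\<close>
  define \<epsilon> where "\<epsilon> = min (1 / (\<bar>R\<bar> + 2)) (m / (2 * (n + 1)))"
  have n: "n \<ge> 1" unfolding n_def by (simp add: Suc_leI)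
  have m: "m > 0" "m \<le> \<gamma>\<^sub>1" "m \<le> \<gamma>\<^sub>2" "m \<le> \<eta>" "m \<le> 1" unfolding m_def using \<gamma>\<^sub>1 \<gamma>\<^sub>2 assms by auto
  have \<epsilon>: "\<epsilon> > 0" unfolding \<epsilon>_def using m n by (auto intro!: divide_pos_pos)
  have "\<epsilon> \<le> 1 / (\<bar>R\<bar> + 2)" unfolding \<epsilon>_def by simp
  then have "\<bar>R\<bar> + 2 \<le> 1 / \<epsilon>" using \<epsilon> by (simp add: field_simps)
  then have radius: "R + 2 \<le> 1 / \<epsilon>" by linarith
  have "\<epsilon> \<le> m / (2 * (n + 1))" unfolding \<epsilon>_def by simp
  then have small: "2 * (n * \<epsilon>) + 2 * \<epsilon> \<le> m" using n by (simp add: field_simps)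
  have n\<epsilon>: "n * \<epsilon> > 0" using n \<epsilon> by simp
  have "\<exists>z. norm z < \<eta> \<and> patch (T' \<ominus> z) 0 R = patch T 0 R"
    if T: "T \<in> \<Omega>" and T': "T' \<in> \<Omega>" and close: "tilings_close \<epsilon> T T'" for T T'
  proof -
    obtain A A' f where f: "patch T 0 (1 / \<epsilon>) \<subseteq> A" "A \<subseteq> T" "patch T' 0 (1 / \<epsilon>) \<subseteq> A'" "A' \<subseteq> T'"
        "bij_betw f A A'" "\<forall>p\<in>A. tile_dist p (f p) < \<epsilon>"
      using close unfolding tilings_close_def by (elim exE conjE) (rule that)
    have inA: "p \<in> T \<and> solid p \<and> f p \<in> T' \<and> solid (f p) \<and> tile_dist p (f p) < \<epsilon>" if "p \<in> A" for p
      using that f solid_tile[OF T, of p] solid_tile[OF T', of "f p"] bij_betwE[OF f(5)] by blast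
    define z where "z p = anchor (f p) - anchor p" for p
    have norm_z: "norm (z p) \<le> n * \<epsilon>" if "p \<in> A" for p
    proof -
      have "norm (z p) \<le> n * tile_dist p (f p)"
        using dist_anchor_le[of p "f p"] inA[OF that] unfolding z_def n_def
        by (simp add: dist_norm norm_minus_commute)
      also have "\<dots> \<le> n * \<epsilon>" using inA[OF that] n by (intro mult_left_mono) auto
      finally show ?thesis .
    qed
    have f_eq: "f p = shift_tile p (- z p)" if "p \<in> A" for p
    proof -
      have "tile_dist (prototile p) (prototile (f p)) \<le> (n + 1) * tile_dist p (f p)"
        using tile_dist_prototile_le[of p "f p"] inA[OF that] unfolding n_def by blast
      also have "\<dots> \<le> (n + 1) * \<epsilon>" using inA[OF that] n by (intro mult_left_mono) auto
      also have "\<dots> < \<gamma>\<^sub>1" using small m \<epsilon> n\<epsilon> unfolding distrib_right by linarith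
      finally have "prototile p = prototile (f p)"
        using inA[OF that] T T' unfolding P_def[symmetric] by (intro \<gamma>\<^sub>1(2)[rule_format]) (auto simp: P_def)
      then have "f p = shift_tile (prototile p) (- anchor (f p))" by (simp add: shift_prototile)
      then show ?thesis unfolding prototile_def z_def by simp
    qed
    have sub: "patch T 0 (R + 1) \<subseteq> A" using f(1) patch_mono[of "R + 1" "1 / \<epsilon>" T 0] radius by simp
    have in_patch': "p \<in> patch T 0 (R + 2)" "f p \<in> patch T' 0 (R + 2)" if p: "p \<in> patch T 0 (R + 1)" for p
    proof -
      show "p \<in> patch T 0 (R + 2)" using p patch_mono[of "R + 1" "R + 2" T 0] by auto
      have pA: "p \<in> A" using p sub by blast
      have "fst p \<inter> ball 0 (R + 1) \<noteq> {}" using p unfolding in_patch by blast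
      then have "fst (f p) \<inter> ball 0 (R + 1 + \<epsilon>) \<noteq> {}"
        using inA[OF pA] tile_dist_meets_ball by blast
      moreover have "ball (0::'a) (R + 1 + \<epsilon>) \<subseteq> ball 0 (R + 2)"
        using small m n\<epsilon> by (intro subset_ball) linarith
      ultimately show "f p \<in> patch T' 0 (R + 2)" using inA[OF pA] unfolding in_patch by blast
    qed
    \<comment> \<open>Both relative positions belong to the finite set \<open>D\<close>, whose elements are \<open>\<gamma>\<^sub>2\<close> apart.\<close>
    have z_const: "z p = z q" if p: "p \<in> patch T 0 (R + 1)" and q: "q \<in> patch T 0 (R + 1)" for p q
    proof -
      have "(anchor q - anchor p) - (anchor (f q) - anchor (f p)) = z p - z q" by (simp add: z_def)
      then have "dist (anchor q - anchor p) (anchor (f q) - anchor (f p)) \<le> norm (z p) + norm (z q)"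
        unfolding dist_norm by (metis norm_triangle_ineq4)
      also have "\<dots> < \<gamma>\<^sub>2"
        using norm_z[of p] norm_z[of q] p q sub small m \<epsilon> by fastforce
      finally have "anchor q - anchor p = anchor (f q) - anchor (f p)"
        by (intro \<gamma>\<^sub>2(2)[rule_format] D[OF T] D[OF T'] in_patch' p q)
      then show ?thesis unfolding z_def by (simp add: algebra_simps)
    qed
    obtain w where w: "norm w \<le> n * \<epsilon>" "\<And>p. p \<in> patch T 0 (R + 1) \<Longrightarrow> f p = shift_tile p (- w)"
    proof (cases "patch T 0 (R + 1) = {}")
      case True
      then show ?thesis using that[of 0] n\<epsilon> by simp
    next
      case False
      then obtain p\<^sub>0 where p\<^sub>0: "p\<^sub>0 \<in> patch T 0 (R + 1)" by blast
      show ?thesis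
        using that[of "z p\<^sub>0"] norm_z f_eq z_const[OF p\<^sub>0] p\<^sub>0 sub by (metis subsetD)
    qed
    have w_small: "norm w + \<epsilon> \<le> 1" "norm w < \<eta>" using w(1) small m \<epsilon> n\<epsilon> by linarith+
    have "patch (T' \<ominus> w) 0 R = patch T 0 R"
    proof (intro subset_antisym subsetI)
      fix p assume p: "p \<in> patch T 0 R"
      then have p': "p \<in> patch T 0 (R + 1)" using patch_mono[of R "R + 1" T 0] by auto
      then have "shift_tile p (- w) \<in> T'" using w(2) inA sub by (metis subsetD)
      then show "p \<in> patch (T' \<ominus> w) 0 R" using p unfolding in_patch in_translate_iff by blast
    next
      fix q assume "q \<in> patch (T' \<ominus> w) 0 R"
      then have q: "shift_tile q (- w) \<in> T'" "fst q \<inter> ball 0 R \<noteq> {}"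
        unfolding in_patch in_translate_iff by blast+
      have "fst (shift_tile q (- w)) \<inter> ball w R \<noteq> {}"
        using q(2) shift_tile_meets_ball[of q "- w" w R] by simp
      moreover have "ball w R \<subseteq> ball 0 (R + norm w)" by (simp add: ball_subset_ball_iff)
      ultimately have meets: "fst (shift_tile q (- w)) \<inter> ball 0 (R + norm w) \<noteq> {}" by blast
      moreover have "ball (0::'a) (R + norm w) \<subseteq> ball 0 (1 / \<epsilon>)"
        using radius w_small \<epsilon> by (intro subset_ball) linarith
      ultimately have "shift_tile q (- w) \<in> patch T' 0 (1 / \<epsilon>)" using q(1) unfolding in_patch by blast
      then have "shift_tile q (- w) \<in> f ` A"
        using f(5) subsetD[OF f(3)] by (simp add: bij_betw_def)
      then obtain p where p: "p \<in> A" "f p = shift_tile q (- w)"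
        by (metis imageE)
      have "fst p \<inter> ball 0 (R + norm w + \<epsilon>) \<noteq> {}"
        using meets inA[OF p(1)] tile_dist_meets_ball[of "f p" p \<epsilon> 0 "R + norm w"] p(2)
        by (simp add: tile_dist_commute)
      moreover have "ball (0::'a) (R + norm w + \<epsilon>) \<subseteq> ball 0 (R + 1)"
        using w_small by (intro subset_ball) linarith
      ultimately have "p \<in> patch T 0 (R + 1)" using inA[OF p(1)] unfolding in_patch by blast
      then have "shift_tile p (- w) = shift_tile q (- w)" using w(2) p(2) by simp
      then have "p = q" using injD[OF inj_shift_tile[of "- w"]] by blast
      then show "q \<in> patch T 0 R" using inA[OF p(1)] q(2) unfolding in_patch by blast
    qed
    with w_small(2) show ?thesis by blast
  qed
  with \<epsilon> show ?thesis by blast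
qed

end

section \<open>Flow boxes\<close>

lemma FLC_transversal_subset: "FLC_transversal \<Omega> \<Xi> \<Longrightarrow> \<Xi> \<subseteq> \<Omega>"
  unfolding FLC_transversal_def by blast

text \<open>
  Whether the origin is a point of the derived Delone set is decided by a patch around the
  origin.
\<close>

lemma FLC_transversal_local:
  assumes "FLC_transversal \<Omega> \<Xi>"
  shows "\<exists>R>0. \<forall>T\<in>\<Xi>. \<forall>T'\<in>\<Omega>. patch T 0 R = patch T' 0 R \<longrightarrow> T' \<in> \<Xi>"
proof -
  obtain \<Omega>\<^sub>0 :: "('a, real) tiling set" and D where D: "local_derivation \<Omega> \<Omega>\<^sub>0 D"
      "\<Xi> = {T \<in> \<Omega>. D T \<in> canonical_transversal \<Omega>\<^sub>0}"
    using assms unfolding FLC_transversal_def by blast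
  have image: "D ` \<Omega> = \<Omega>\<^sub>0" using D(1) unfolding local_derivation_def factor_map_def by blast
  have "\<forall>r>0. \<exists>R>0. \<forall>T\<in>\<Omega>. \<forall>T'\<in>\<Omega>. patch T 0 R = patch T' 0 R \<longrightarrow> patch (D T) 0 r = patch (D T') 0 r"
    using D(1) unfolding local_derivation_def by (elim conjE)
  from this[rule_format, of 1] obtain R where R: "R > 0"
      "\<forall>T\<in>\<Omega>. \<forall>T'\<in>\<Omega>. patch T 0 R = patch T' 0 R \<longrightarrow> patch (D T) 0 1 = patch (D T') 0 1"
    by auto
  have "T' \<in> \<Xi>" if T: "T \<in> \<Xi>" "T' \<in> \<Omega>" "patch T 0 R = patch T' 0 R" for T T'
  proof -
    obtain l where l: "({0}, l) \<in> D T" and "T \<in> \<Omega>"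
      using T(1) D(2) unfolding canonical_transversal_def by blast
    then have "({0}, l) \<in> patch (D T) 0 1" by (simp add: in_patch)
    also have "patch (D T) 0 1 = patch (D T') 0 1" using R(2) T \<open>T \<in> \<Omega>\<close> by blast
    finally have "({0}, l) \<in> D T'" by (simp add: in_patch)
    moreover have "D T' \<in> \<Omega>\<^sub>0" using image T(2) by blast
    ultimately show ?thesis using D(2) T(2) unfolding canonical_transversal_def by blast
  qed
  with R(1) show ?thesis by blast
qed

text \<open>
  The part of the conditions on a flow box that has to be checked; the topological conditions
  follow from finite local complexity (\<open>flow_chart_imp_flow_boxes\<close>).
\<close>

definition flow_chart ::
    "('a::euclidean_space, 'l::metric_space) tiling set \<Rightarrow> ('a, 'l) tiling set \<times> real \<Rightarrow> bool" where
  "flow_chart \<Omega> i \<longleftrightarrow> FLC_transversal \<Omega> (fst i) \<and> snd i > 0 \<and>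
     inj_on (\<lambda>(S, x). S \<ominus> x) (fst i \<times> ball 0 (snd i))"

text \<open>
  The vector \<open>x\<close> of \<open>S \<ominus> x\<close> in the flow box.  It is the function on the flow box that belongs to the
  cocycle \<open>\<lambda>T v. v\<close>, which represents the fundamental shape class.
\<close>

definition flow_coordinate ::
    "('a::euclidean_space, 'l) tiling set \<times> real \<Rightarrow> ('a, 'l) tiling \<Rightarrow> 'a" where
  "flow_coordinate i = flow_box_function (\<lambda>T v. v) i"

lemma in_flow_box: "T \<in> flow_box i \<longleftrightarrow> (\<exists>S x. S \<in> fst i \<and> norm x < snd i \<and> T = S \<ominus> x)"
  unfolding flow_box_def by (cases i) auto

lemma flow_chart_unique:
  assumes "flow_chart \<Omega> i" "S \<in> fst i" "norm x < snd i" "S' \<in> fst i" "norm x' < snd i" "S \<ominus> x = S' \<ominus> x'"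
  shows "S = S'" "x = x'"
proof -
  have "inj_on (\<lambda>(S, x). S \<ominus> x) (fst i \<times> ball 0 (snd i))"
    using assms(1) unfolding flow_chart_def by (elim conjE)
  then have "(S, x) = (S', x')"
    by (rule inj_onD) (use assms in auto)
  then show "S = S'" "x = x'" by auto
qed

lemma flow_box_function_translate:
  assumes "flow_chart \<Omega> i" "S \<in> fst i" "norm x < snd i"
  shows "flow_box_function \<alpha> i (S \<ominus> x) = \<alpha> S x"
proof -
  obtain \<Xi> \<epsilon> where i: "i = (\<Xi>, \<epsilon>)" by (cases i)
  show ?thesis
    unfolding i flow_box_function_def prod.case
  proof (rule the_equality)
    show "\<exists>S' x'. S' \<in> \<Xi> \<and> norm x' < \<epsilon> \<and> S \<ominus> x = S' \<ominus> x' \<and> \<alpha> S x = \<alpha> S' x'"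
      using assms i by auto
    fix c assume "\<exists>S' x'. S' \<in> \<Xi> \<and> norm x' < \<epsilon> \<and> S \<ominus> x = S' \<ominus> x' \<and> c = \<alpha> S' x'"
    then obtain S' x' where S': "S' \<in> \<Xi>" "norm x' < \<epsilon>" "S \<ominus> x = S' \<ominus> x'" "c = \<alpha> S' x'" by blast
    have "S = S'" "x = x'"
      using flow_chart_unique[OF assms(1), of S x S' x'] assms i S' by auto
    then show "c = \<alpha> S x" using S'(4) by simp
  qed
qed

lemma flow_coordinate_translate:
  assumes "flow_chart \<Omega> i" "S \<in> fst i" "norm x < snd i"
  shows "flow_coordinate i (S \<ominus> x) = x"
  unfolding flow_coordinate_def by (rule flow_box_function_translate[OF assms])

lemma flow_boxes_imp_flow_chart:
  assumes "i \<in> flow_boxes \<Omega>"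
  shows "flow_chart \<Omega> i"
proof -
  obtain \<Xi> \<epsilon> where i: "i = (\<Xi>, \<epsilon>)" by (cases i)
  have *: "FLC_transversal \<Omega> \<Xi>" "\<epsilon> > 0" "homeomorphic_map
       (prod_topology (subtopology (tiling_topology \<Omega>) \<Xi>) (top_of_set (ball 0 \<epsilon>)))
       (subtopology (tiling_topology \<Omega>) (flow_box (\<Xi>, \<epsilon>))) (\<lambda>(S, x). S \<ominus> x)"
    using assms unfolding i flow_boxes_def by blast+
  have "inj_on (\<lambda>(S, x). S \<ominus> x) ((\<Omega> \<inter> \<Xi>) \<times> ball 0 \<epsilon>)"
    using *(3) by (auto simp: homeomorphic_eq_everything_map)
  moreover have "\<Omega> \<inter> \<Xi> = \<Xi>" using FLC_transversal_subset[OF *(1)] by blast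
  ultimately show ?thesis using * unfolding flow_chart_def i by simp
qed

context FLC_space
begin

lemma neighbourhood_patch_eq:
  assumes "T\<^sub>0 \<in> \<Omega>" "\<eta> > 0"
  shows "\<exists>N. openin (tiling_topology \<Omega>) N \<and> T\<^sub>0 \<in> N \<and>
    (\<forall>T\<in>N. \<exists>z. norm z < \<eta> \<and> patch (T \<ominus> z) 0 R = patch T\<^sub>0 0 R)"
proof -
  obtain \<epsilon> where \<epsilon>: "\<epsilon> > 0" "\<forall>T\<in>\<Omega>. \<forall>T'\<in>\<Omega>. tilings_close \<epsilon> T T' \<longrightarrow>
      (\<exists>z. norm z < \<eta> \<and> patch (T' \<ominus> z) 0 R = patch T 0 R)"
    using close_imp_patch_eq[OF assms(2), of R] by (elim exE conjE)
  obtain N where N: "openin (tiling_topology \<Omega>) N" "T\<^sub>0 \<in> N" "\<And>T. T \<in> N \<Longrightarrow> tilings_close \<epsilon> T\<^sub>0 T"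
    by (rule tilings_close_neighbourhood[OF assms(1) \<epsilon>(1)]) simp_all
  have "N \<subseteq> \<Omega>" using openin_subset[OF N(1)] by simp
  then show ?thesis using N \<epsilon>(2) assms(1) by (intro exI[of _ N] conjI ballI) auto
qed

text \<open>
  If \<open>T \<ominus> z\<close> agrees with \<open>S\<^sub>0 \<ominus> x\<close> on a large ball, then \<open>T \<ominus> (z - x)\<close> agrees with \<open>S\<^sub>0\<close> around the origin,
  so it belongs to the transversal as well.
\<close>

lemma flow_chart_nearby:
  assumes i: "flow_chart \<Omega> i" and S\<^sub>0: "S\<^sub>0 \<in> fst i"
  shows "\<exists>R. \<forall>T\<in>\<Omega>. \<forall>z. norm z < snd i - norm x \<longrightarrow> patch (T \<ominus> z) 0 R = patch (S\<^sub>0 \<ominus> x) 0 R \<longrightarrow>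
     (\<exists>S\<in>fst i. T = S \<ominus> (x - z) \<and> norm (x - z) < snd i \<and> patch S 0 R\<^sub>1 = patch S\<^sub>0 0 R\<^sub>1)"
proof -
  have \<Xi>: "FLC_transversal \<Omega> (fst i)" using i unfolding flow_chart_def by (elim conjE)
  obtain R\<^sub>0 where R\<^sub>0: "R\<^sub>0 > 0" "\<forall>T\<in>fst i. \<forall>T'\<in>\<Omega>. patch T 0 R\<^sub>0 = patch T' 0 R\<^sub>0 \<longrightarrow> T' \<in> fst i"
    using FLC_transversal_local[OF \<Xi>] by blast
  define R where "R = max R\<^sub>0 R\<^sub>1 + norm x"
  show ?thesis
  proof (intro exI[of _ R] ballI allI impI)
    fix T z assume T: "T \<in> \<Omega>" and z: "norm z < snd i - norm x"
      and eq: "patch (T \<ominus> z) 0 R = patch (S\<^sub>0 \<ominus> x) 0 R"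
    define S where "S = T \<ominus> (z - x)"
    have eq': "patch S 0 r = patch S\<^sub>0 0 r" if "r \<le> max R\<^sub>0 R\<^sub>1" for r
      using patch_eq_mono[OF eq, of r "- x"] that unfolding S_def R_def by simp
    have "S \<in> fst i"
      using R\<^sub>0(2) S\<^sub>0 eq'[of R\<^sub>0] translate_closed[OF T] unfolding S_def by (metis max.cobounded1)
    moreover have "T = S \<ominus> (x - z)" unfolding S_def by simp
    moreover have "norm (x - z) < snd i"
      using z norm_triangle_ineq4[of x z] by linarith
    moreover have "patch S 0 R\<^sub>1 = patch S\<^sub>0 0 R\<^sub>1" by (rule eq') simp
    ultimately show "\<exists>S\<in>fst i. T = S \<ominus> (x - z) \<and> norm (x - z) < snd i \<and> patch S 0 R\<^sub>1 = patch S\<^sub>0 0 R\<^sub>1"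
      by blast
  qed
qed

text \<open>
  The flow coordinate measures the translation between two tilings that agree up to a small
  translation.  This holds with the same vector \<open>z\<close> in every flow box, which is why differences of flow
  coordinates are locally constant.
\<close>

lemma flow_coordinate_local:
  assumes i: "flow_chart \<Omega> i" and T\<^sub>0: "T\<^sub>0 \<in> flow_box i"
  shows "\<exists>R \<eta>. \<eta> > 0 \<and> (\<forall>T\<in>\<Omega>. \<forall>z. norm z < \<eta> \<longrightarrow> patch (T \<ominus> z) 0 R = patch T\<^sub>0 0 R \<longrightarrow>
     T \<in> flow_box i \<and> flow_coordinate i T = flow_coordinate i T\<^sub>0 - z)"
proof -
  obtain S\<^sub>0 x where x: "S\<^sub>0 \<in> fst i" "norm x < snd i" "T\<^sub>0 = S\<^sub>0 \<ominus> x"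
    using T\<^sub>0 unfolding in_flow_box by blast
  obtain R where R: "\<forall>T\<in>\<Omega>. \<forall>z. norm z < snd i - norm x \<longrightarrow> patch (T \<ominus> z) 0 R = patch (S\<^sub>0 \<ominus> x) 0 R \<longrightarrow>
     (\<exists>S\<in>fst i. T = S \<ominus> (x - z) \<and> norm (x - z) < snd i \<and> patch S 0 0 = patch S\<^sub>0 0 0)"
    using flow_chart_nearby[OF i x(1)] by blast
  show ?thesis
  proof (rule exI[of _ R], rule exI[of _ "snd i - norm x"], intro conjI ballI allI impI)
    show "snd i - norm x > 0" using x(2) by simp
    fix T z assume T: "T \<in> \<Omega>" "norm z < snd i - norm x" "patch (T \<ominus> z) 0 R = patch T\<^sub>0 0 R"
    have "\<exists>S\<in>fst i. T = S \<ominus> (x - z) \<and> norm (x - z) < snd i \<and> patch S 0 0 = patch S\<^sub>0 0 0"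
      by (rule R[rule_format, OF T(1,2)]) (use T(3) x(3) in simp)
    then obtain S where S: "S \<in> fst i" "T = S \<ominus> (x - z)" "norm (x - z) < snd i" by blast
    show "T \<in> flow_box i" using S unfolding in_flow_box by blast
    show "flow_coordinate i T = flow_coordinate i T\<^sub>0 - z"
      using S x flow_coordinate_translate[OF i] by simp
  qed
qed

lemma flow_coordinate_neighbourhood:
  assumes i: "flow_chart \<Omega> i" and T\<^sub>0: "T\<^sub>0 \<in> flow_box i" "T\<^sub>0 \<in> \<Omega>" and "\<eta> > 0"
  shows "\<exists>N. openin (tiling_topology \<Omega>) N \<and> T\<^sub>0 \<in> N \<and> N \<subseteq> flow_box i \<and>
    (\<forall>T\<in>N. \<exists>z. norm z < \<eta> \<and> patch (T \<ominus> z) 0 R = patch T\<^sub>0 0 R \<and>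
       flow_coordinate i T = flow_coordinate i T\<^sub>0 - z)"
proof -
  obtain R' \<eta>' where *: "\<eta>' > 0" "\<forall>T\<in>\<Omega>. \<forall>z. norm z < \<eta>' \<longrightarrow> patch (T \<ominus> z) 0 R' = patch T\<^sub>0 0 R' \<longrightarrow>
     T \<in> flow_box i \<and> flow_coordinate i T = flow_coordinate i T\<^sub>0 - z"
    using flow_coordinate_local[OF i T\<^sub>0(1)] by (elim exE conjE)
  have "min \<eta> \<eta>' > 0" using * assms by simp
  then obtain N where N: "openin (tiling_topology \<Omega>) N" "T\<^sub>0 \<in> N"
    "\<forall>T\<in>N. \<exists>z. norm z < min \<eta> \<eta>' \<and> patch (T \<ominus> z) 0 (max R R') = patch T\<^sub>0 0 (max R R')"
    using neighbourhood_patch_eq[OF T\<^sub>0(2)] by metis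
  have near: "\<exists>z. norm z < \<eta> \<and> patch (T \<ominus> z) 0 R = patch T\<^sub>0 0 R \<and>
       T \<in> flow_box i \<and> flow_coordinate i T = flow_coordinate i T\<^sub>0 - z" if T: "T \<in> N" for T
  proof -
    obtain z where z: "norm z < min \<eta> \<eta>'" "patch (T \<ominus> z) 0 (max R R') = patch T\<^sub>0 0 (max R R')"
      using N(3) T by blast
    have "patch (T \<ominus> z) 0 R = patch T\<^sub>0 0 R" "patch (T \<ominus> z) 0 R' = patch T\<^sub>0 0 R'"
      using patch_eq_mono[OF z(2), of R 0] patch_eq_mono[OF z(2), of R' 0] by simp_all
    moreover have "T \<in> \<Omega>" using openin_subset[OF N(1)] T by auto
    ultimately show ?thesis using z(1) *(2) by auto
  qed
  then show ?thesis using N(1,2) by (intro exI[of _ N] conjI) blast+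
qed

lemma flow_chart_imp_flow_boxes:
  assumes i: "flow_chart \<Omega> i"
  shows "i \<in> flow_boxes \<Omega>"
proof -
  define X where "X = tiling_topology \<Omega>"
  define U where "U = flow_box i"
  define c where "c = flow_coordinate i"
  have \<Xi>: "FLC_transversal \<Omega> (fst i)" "snd i > 0" using i unfolding flow_chart_def by (elim conjE; simp)+
  have sub: "fst i \<subseteq> \<Omega>" using FLC_transversal_subset[OF \<Xi>(1)] .
  have sub': "U \<subseteq> \<Omega>"
  proof
    fix T assume "T \<in> U"
    then obtain S x where "S \<in> fst i" "T = S \<ominus> x" unfolding U_def in_flow_box by blast
    then show "T \<in> \<Omega>" using sub translate_closed by blast
  qed
  have "openin X U"
  proof (subst openin_subopen, intro ballI)
    fix T assume T: "T \<in> U"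
    then have "T \<in> \<Omega>" using sub' by blast
    then show "\<exists>N. openin X N \<and> T \<in> N \<and> N \<subseteq> U"
      using flow_coordinate_neighbourhood[OF i T[unfolded U_def], of 1 0] unfolding X_def U_def by force
  qed
  define P where "P = prod_topology (subtopology X (fst i)) (top_of_set (ball (0::'a) (snd i)))"
  have P: "P = subtopology (prod_topology X euclidean) (fst i \<times> ball 0 (snd i))"
    unfolding P_def by (simp add: subtopology_Times)
  have c: "c (S \<ominus> x) = x" if "S \<in> fst i" "norm x < snd i" for S x
    unfolding c_def by (rule flow_coordinate_translate[OF i that])
  have forward: "continuous_map P (subtopology X U) (\<lambda>(S, x). S \<ominus> x)"
    unfolding P
  proof (rule continuous_map_into_subtopology)
    show "continuous_map (subtopology (prod_topology X euclidean) (fst i \<times> ball 0 (snd i))) X (\<lambda>(S, x). S \<ominus> x)"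
      unfolding X_def using continuous_map_translate[OF tiling_space] by (rule continuous_map_from_subtopology)
    show "(\<lambda>(S, x). S \<ominus> x) \<in> topspace (subtopology (prod_topology X euclidean) (fst i \<times> ball 0 (snd i))) \<rightarrow> U"
    proof
      fix z :: "('a, 'l) tiling \<times> 'a"
      assume "z \<in> topspace (subtopology (prod_topology X euclidean) (fst i \<times> ball 0 (snd i)))"
      then have "fst z \<in> fst i" "norm (snd z) < snd i" by auto
      then show "(case z of (S, x) \<Rightarrow> S \<ominus> x) \<in> U"
        unfolding U_def in_flow_box case_prod_unfold by blast
    qed
  qed
  have c_cont: "continuous_map (subtopology X U) euclidean c"
  proof (rule continuous_map_into_metricI)
    fix T and e :: real assume "T \<in> topspace (subtopology X U)" and e: "e > 0"
    then have T: "T \<in> flow_box i" "T \<in> \<Omega>" unfolding U_def X_def by simp_all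
    from flow_coordinate_neighbourhood[OF i T e, of 0, folded X_def U_def c_def]
    obtain N where N: "openin X N" "T \<in> N" "N \<subseteq> U"
      "\<forall>T'\<in>N. \<exists>z. norm z < e \<and> patch (T' \<ominus> z) 0 0 = patch T 0 0 \<and> c T' = c T - z"
      by (elim exE conjE) (rule that)
    have "dist (c T') (c T) < e" if T': "T' \<in> N" for T'
    proof -
      obtain z where "norm z < e" "c T' = c T - z" using N(4) T' by blast
      then show ?thesis by (simp add: dist_norm)
    qed
    moreover have "openin (subtopology X U) N" using N(1,3) openin_subtopology by blast
    ultimately show "\<exists>N. openin (subtopology X U) N \<and> T \<in> N \<and> (\<forall>T'\<in>N. dist (c T') (c T) < e)"
      using N(2) by blast
  qed
  have backward: "continuous_map (subtopology X U) P (\<lambda>T. (T \<ominus> (- c T), c T))"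
    unfolding P
  proof (rule continuous_map_into_subtopology)
    have "continuous_map (subtopology X U) X ((\<lambda>(S, x). S \<ominus> x) \<circ> (\<lambda>T. (T, - c T)))"
      unfolding X_def
    proof (rule continuous_map_compose[OF _ continuous_map_translate[OF tiling_space]])
      show "continuous_map (subtopology (tiling_topology \<Omega>) U) (prod_topology (tiling_topology \<Omega>) euclidean) (\<lambda>T. (T, - c T))"
        using c_cont unfolding X_def
        by (intro continuous_map_pairedI continuous_map_minus) (simp_all add: continuous_map_from_subtopology)
    qed
    then show "continuous_map (subtopology X U) (prod_topology X euclidean) (\<lambda>T. (T \<ominus> (- c T), c T))"
      using c_cont by (intro continuous_map_pairedI) (simp_all add: o_def)
    show "(\<lambda>T. (T \<ominus> (- c T), c T)) \<in> topspace (subtopology X U) \<rightarrow> fst i \<times> ball 0 (snd i)"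
    proof
      fix T assume "T \<in> topspace (subtopology X U)"
      then have "T \<in> U" by simp
      then obtain S x where S: "S \<in> fst i" "norm x < snd i" "T = S \<ominus> x"
        unfolding U_def in_flow_box by blast
      then show "(T \<ominus> (- c T), c T) \<in> fst i \<times> ball 0 (snd i)" using c[OF S(1,2)] by simp
    qed
  qed
  have "homeomorphic_maps P (subtopology X U) (\<lambda>(S, x). S \<ominus> x) (\<lambda>T. (T \<ominus> (- c T), c T))"
    unfolding homeomorphic_maps_def
  proof (intro conjI forward backward ballI)
    fix z assume "z \<in> topspace P"
    then show "((case z of (S, x) \<Rightarrow> S \<ominus> x) \<ominus> (- c (case z of (S, x) \<Rightarrow> S \<ominus> x)), c (case z of (S, x) \<Rightarrow> S \<ominus> x)) = z"
      using c unfolding P by (cases z) auto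
  qed simp
  then have "homeomorphic_map P (subtopology X U) (\<lambda>(S, x). S \<ominus> x)"
    by (rule homeomorphic_maps_imp_map)
  then show ?thesis
    using \<Xi> \<open>openin X U\<close> unfolding flow_boxes_def P_def X_def U_def by (cases i) auto
qed

end

section \<open>Existence of flow boxes\<close>

lemma corner_singleton [simp]: "corner {x} = x"
  by (rule euclidean_eqI) (simp add: corner_inner)

text \<open>
  An equivariant choice of a point for each tile, in the interior of a tile that has one, shifted
  by \<open>w\<close>.  The choice is made for the prototile and carried along with the anchor; the shift allows any given
  tiling to be moved into the transversal.
\<close>

definition puncture :: "'a \<Rightarrow> ('a::euclidean_space, 'l) tile \<Rightarrow> 'a" where
  "puncture w p = anchor p + (SOME y. y \<in> interior (fst (prototile p))) + w"

definition punctures :: "'a \<Rightarrow> ('a::euclidean_space, 'l) tiling \<Rightarrow> ('a, real) tiling" where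
  "punctures w T = (\<lambda>p. ({puncture w p}, 0)) ` T"

lemma puncture_shift_tile: "solid p \<Longrightarrow> puncture w (shift_tile p v) = puncture w p - v"
  unfolding puncture_def by (simp add: anchor_shift_tile prototile_shift_tile)

lemma punctures_translate:
  assumes "tilewise_solid T"
  shows "punctures w (T \<ominus> v) = punctures w T \<ominus> v"
proof -
  have "({puncture w (shift_tile p v)}, 0) = shift_tile ({puncture w p}, 0::real) v" if "p \<in> T" for p
  proof -
    have "solid p" using that assms unfolding tilewise_solid_def by blast
    then have "({puncture w (shift_tile p v)}, 0) = ({puncture w p - v}, 0::real)"
      by (simp add: puncture_shift_tile)
    then show ?thesis by (simp add: shift_tile_def)
  qed
  then show ?thesis
    unfolding punctures_def translate_eq_shift_tile image_image by (intro image_cong) auto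
qed

lemma tilewise_solid_punctures: "tilewise_solid (punctures w T)"
  unfolding tilewise_solid_def punctures_def solid_def by simp

lemma puncture_in_interior:
  assumes "interior (fst p) \<noteq> {}"
  shows "puncture w p - w \<in> interior (fst p)"
proof -
  have eq: "interior (fst (prototile p)) = (\<lambda>y. y - anchor p) ` interior (fst p)"
    using interior_translation[of "- anchor p" "fst p"]
    by (simp add: prototile_def fst_shift_tile add.commute[of "- anchor p"])
  then have "\<exists>y. y \<in> interior (fst (prototile p))" using assms by auto
  then have "(SOME y. y \<in> interior (fst (prototile p))) \<in> interior (fst (prototile p))" by (rule someI_ex)
  then obtain y where "y \<in> interior (fst p)" "(SOME y. y \<in> interior (fst (prototile p))) = y - anchor p"
    unfolding eq by blast
  then show ?thesis unfolding puncture_def by simp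
qed

lemma inj_on_puncture:
  assumes "is_tiling T \<or> is_delone T"
  shows "inj_on (puncture w) T"
proof (rule inj_onI)
  fix p q assume pq: "p \<in> T" "q \<in> T" "puncture w p = puncture w q"
  from assms show "p = q"
  proof
    assume T: "is_tiling T"
    have "puncture w p - w \<in> interior (fst p)" "puncture w q - w \<in> interior (fst q)"
      using tiling_tileD(2)[OF T] pq(1,2) by (simp_all add: puncture_in_interior)
    then show "p = q"
      using tiling_tile_unique[OF T pq(1,2)] pq(3) interior_subset by (metis subsetD)
  next
    assume T: "is_delone T"
    obtain x y where xy: "fst p = {x}" "fst q = {y}"
      using delone_tileE[OF T pq(1)] delone_tileE[OF T pq(2)] by metis
    have "puncture w p = x + (SOME y. y \<in> interior {0}) + w" "puncture w q = y + (SOME y. y \<in> interior {0}) + w"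
      using xy unfolding puncture_def anchor_def prototile_def fst_shift_tile by simp_all
    then have "x = y" using pq(3) by simp
    obtain e where "e > 0"
      "\<And>p q x y. p \<in> T \<Longrightarrow> q \<in> T \<Longrightarrow> x \<in> fst p \<Longrightarrow> y \<in> fst q \<Longrightarrow> dist x y < e \<Longrightarrow> p = q"
      by (rule delone_separated[OF T]) (rule that)
    then show "p = q" using pq(1,2) xy \<open>x = y\<close> by simp
  qed
qed

context FLC_space
begin

lemma tiling_or_delone: "T \<in> \<Omega> \<Longrightarrow> is_tiling T \<or> is_delone T"
  using tiling_space unfolding tiling_space_def by blast

text \<open>
  Up to translation there are finitely many tiles, and each of them is bounded.
\<close>

lemma puncture_reach: "\<exists>M\<ge>0. \<forall>T\<in>\<Omega>. \<forall>p\<in>T. \<forall>y\<in>fst p. dist y (puncture w p) \<le> M"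
proof -
  define c where "c p = (SOME y. y \<in> interior (fst p)) + w" for p :: "('a, 'l) tile"
  define B where "B = (\<Union>q\<in>prototile ` \<Union>\<Omega>. (\<lambda>z. z - c q) ` fst q)"
  have "bounded B"
    unfolding B_def
  proof (intro bounded_UN finite_prototiles ballI)
    fix q assume "q \<in> prototile ` \<Union>\<Omega>"
    then have "compact (fst q)" using solid_tile solid_prototile unfolding solid_def by blast
    then show "bounded ((\<lambda>z. z - c q) ` fst q)"
      by (intro compact_imp_bounded compact_continuous_image continuous_intros)
  qed
  then obtain M where M: "\<forall>z\<in>B. norm z \<le> M" unfolding bounded_iff by blast
  have "dist y (puncture w p) \<le> max M 0" if p: "T \<in> \<Omega>" "p \<in> T" "y \<in> fst p" for T p y
  proof -
    have "y - anchor p \<in> fst (prototile p)" using p(3) unfolding prototile_def fst_shift_tile by blast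
    moreover have "prototile p \<in> prototile ` \<Union>\<Omega>" using p by blast
    ultimately have "y - anchor p - c (prototile p) \<in> B" unfolding B_def by blast
    then have "norm (y - anchor p - c (prototile p)) \<le> M" using M by blast
    moreover have "y - puncture w p = y - anchor p - c (prototile p)"
      unfolding puncture_def c_def by (simp add: algebra_simps)
    ultimately have "norm (y - puncture w p) \<le> M" by metis
    then show ?thesis unfolding dist_norm by linarith
  qed
  then show ?thesis by (intro exI[of _ "max M 0"] conjI ballI) simp_all
qed

text \<open>
  The difference of the punctures of two tiles is determined by their pair type, and vanishes only
  for equal tiles.  So the differences of length less than \<open>1\<close> form a finite set.
\<close>

lemma puncture_separated:
  "\<exists>e>0. \<forall>T\<in>\<Omega>. \<forall>p\<in>T. \<forall>q\<in>T. dist (puncture w p) (puncture w q) < e \<longrightarrow> p = q"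
proof -
  obtain M where M: "M \<ge> 0" "\<forall>T\<in>\<Omega>. \<forall>p\<in>T. \<forall>y\<in>fst p. dist y (puncture w p) \<le> M"
    using puncture_reach by blast
  define c where "c p = (SOME y. y \<in> interior (fst p)) + w" for p :: "('a, 'l) tile"
  define D where "D = insert 0 ((\<lambda>(p, q, v). v + c q - c p) ` pair_types (M + 1))"
  have "finite D" unfolding D_def by (intro finite.insertI finite_imageI finite_pair_types)
  then have "\<exists>\<gamma>>0. \<forall>v\<in>D. \<forall>v'\<in>D. dist v v' < \<gamma> \<longrightarrow> v = v'"
    by (rule finite_imp_uniform_gap) simp
  then obtain \<gamma> where \<gamma>: "\<gamma> > 0" "\<forall>v\<in>D. \<forall>v'\<in>D. dist v v' < \<gamma> \<longrightarrow> v = v'" by blast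
  have "p = q" if T: "T \<in> \<Omega>" and p: "p \<in> T" and q: "q \<in> T"
    and close: "dist (puncture w p) (puncture w q) < min \<gamma> 1" for T p q
  proof -
    define x where "x = puncture w p"
    have in_patch': "r \<in> patch T x (M + 1)" if r: "r \<in> T" "dist x (puncture w r) < 1" for r
    proof -
      obtain y where y: "y \<in> fst r" using solid_tile[OF T r(1)] unfolding solid_def by blast
      have "dist y (puncture w r) \<le> M" using M(2) T r(1) y by blast
      then have "dist x y < M + 1" using r(2) dist_triangle2[of x y "puncture w r"] by linarith
      then show ?thesis using r(1) y unfolding in_patch by auto
    qed
    have "p \<in> patch T x (M + 1)" "q \<in> patch T x (M + 1)"
      using in_patch'[OF p] in_patch'[OF q] close unfolding x_def by simp_all
    then have "(prototile p, prototile q, anchor q - anchor p) \<in> pair_types (M + 1)"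
      unfolding pair_types_def using T by blast
    then have "anchor q - anchor p + c (prototile q) - c (prototile p) \<in> D"
      unfolding D_def by force
    moreover have "anchor q - anchor p + c (prototile q) - c (prototile p) = puncture w q - puncture w p"
      unfolding puncture_def c_def by (simp add: algebra_simps)
    ultimately have "puncture w q - puncture w p \<in> D" by simp
    moreover have "0 \<in> D" unfolding D_def by simp
    moreover have "dist (puncture w q - puncture w p) 0 < \<gamma>"
      using close by (simp add: dist_norm norm_minus_commute)
    ultimately have "puncture w q - puncture w p = 0" using \<gamma>(2) by blast
    then have "puncture w p = puncture w q" by simp
    then show "p = q"
      using inj_onD[OF inj_on_puncture[OF tiling_or_delone[OF T]]] p q by blast
  qed
  then show ?thesis using \<gamma>(1) by (intro exI[of _ "min \<gamma> 1"] conjI ballI impI) simp_all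
qed

lemma tiles_relatively_dense:
  assumes "T \<in> \<Omega>"
  shows "\<exists>R. \<forall>y. \<exists>p\<in>T. \<exists>x\<in>fst p. dist x y \<le> R"
  using tiling_or_delone[OF assms]
proof
  assume "is_tiling T"
  then have cover: "(\<Union>(t, l)\<in>T. t) = UNIV" unfolding is_tiling_def by (elim conjE)
  show ?thesis
  proof (intro exI[of _ 0] allI)
    fix y
    have "y \<in> (\<Union>(t, l)\<in>T. t)" unfolding cover by simp
    then obtain p where "p \<in> T" "y \<in> fst p" by auto
    then show "\<exists>p\<in>T. \<exists>x\<in>fst p. dist x y \<le> 0" by (intro bexI[of _ p] bexI[of _ y]) simp_all
  qed
next
  assume "is_delone T"
  then obtain X label where X: "relatively_dense X" "T = (\<lambda>x. ({x}, label x)) ` X"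
    unfolding is_delone_def by blast
  then obtain R where R: "\<forall>y. \<exists>x\<in>X. dist x y \<le> R" unfolding relatively_dense_def by blast
  show ?thesis
  proof (intro exI[of _ R] allI)
    fix y
    obtain x where "x \<in> X" "dist x y \<le> R" using R by blast
    then show "\<exists>p\<in>T. \<exists>x\<in>fst p. dist x y \<le> R"
      unfolding X(2) by (intro bexI[of _ "({x}, label x)"]) auto
  qed
qed

lemma is_delone_punctures:
  assumes T: "T \<in> \<Omega>"
  shows "is_delone (punctures w T)"
  unfolding is_delone_def
proof (intro exI conjI)
  show "punctures w T = (\<lambda>x. ({x}, (\<lambda>_. 0) x)) ` (puncture w ` T)"
    unfolding punctures_def image_image ..
  obtain e where e: "e > 0" "\<forall>T\<in>\<Omega>. \<forall>p\<in>T. \<forall>q\<in>T. dist (puncture w p) (puncture w q) < e \<longrightarrow> p = q"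
    using puncture_separated by blast
  then show "uniform_discrete (puncture w ` T)"
    unfolding uniform_discrete_def using T by (intro exI[of _ e]) blast
  obtain R where R: "\<forall>y. \<exists>p\<in>T. \<exists>x\<in>fst p. dist x y \<le> R" using tiles_relatively_dense[OF T] by blast
  obtain M where M: "M \<ge> 0" "\<forall>T\<in>\<Omega>. \<forall>p\<in>T. \<forall>y\<in>fst p. dist y (puncture w p) \<le> M"
    using puncture_reach by blast
  show "relatively_dense (puncture w ` T)"
    unfolding relatively_dense_def
  proof (intro exI[of _ "M + R"] allI)
    fix y
    obtain p x where px: "p \<in> T" "x \<in> fst p" "dist x y \<le> R" using R by blast
    then have "dist x (puncture w p) \<le> M" using M(2) T by blast
    then have "dist (puncture w p) y \<le> M + R"
      using px(3) dist_triangle3[of "puncture w p" y x] by linarith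
    with px(1) show "\<exists>x\<in>puncture w ` T. dist x y \<le> M + R" by blast
  qed
qed

lemma punctures_patch_subset:
  "\<exists>M\<ge>0. \<forall>T\<in>\<Omega>. \<forall>x r. patch (punctures w T) x r \<subseteq> punctures w (patch T x (r + M))"
proof -
  obtain M where M: "M \<ge> 0" "\<forall>T\<in>\<Omega>. \<forall>p\<in>T. \<forall>y\<in>fst p. dist y (puncture w p) \<le> M"
    using puncture_reach by blast
  have "z \<in> punctures w (patch T x (r + M))" if T: "T \<in> \<Omega>" and z: "z \<in> patch (punctures w T) x r" for T x r z
  proof -
    have z': "z \<in> punctures w T" "fst z \<inter> ball x r \<noteq> {}" using z unfolding in_patch by blast+
    from z'(1) obtain p where p: "p \<in> T" "z = ({puncture w p}, 0)" unfolding punctures_def by blast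
    have p': "dist x (puncture w p) < r" using z'(2) p(2) by simp
    obtain y where y: "y \<in> fst p" using solid_tile[OF T p(1)] unfolding solid_def by blast
    have "dist y (puncture w p) \<le> M" using M(2) T p(1) y by blast
    then have "dist x y < r + M"
      using p' dist_triangle2[of x y "puncture w p"] by linarith
    then have "y \<in> ball x (r + M)" by simp
    then have "p \<in> patch T x (r + M)" using p(1) y unfolding in_patch by blast
    with p(2) show ?thesis unfolding punctures_def by blast
  qed
  then show ?thesis using M(1) by (intro exI[of _ M]) blast
qed

lemma punctures_local:
  "\<exists>M\<ge>0. \<forall>T\<in>\<Omega>. \<forall>T'\<in>\<Omega>. \<forall>r. patch T 0 (r + M) = patch T' 0 (r + M) \<longrightarrow>
     patch (punctures w T) 0 r = patch (punctures w T') 0 r"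
proof -
  obtain M where M: "M \<ge> 0" "\<forall>T\<in>\<Omega>. \<forall>x r. patch (punctures w T) x r \<subseteq> punctures w (patch T x (r + M))"
    using punctures_patch_subset by blast
  have half: "patch (punctures w T) 0 r \<subseteq> patch (punctures w T') 0 r"
    if "T \<in> \<Omega>" "patch T 0 (r + M) = patch T' 0 (r + M)" for T T' r
  proof
    fix z assume z: "z \<in> patch (punctures w T) 0 r"
    then have "z \<in> punctures w (patch T 0 (r + M))" using M(2) that(1) by blast
    then have "z \<in> punctures w (patch T' 0 (r + M))" using that(2) by simp
    then have "z \<in> punctures w T'" using patch_subset[of T'] unfolding punctures_def by blast
    then show "z \<in> patch (punctures w T') 0 r" using z unfolding in_patch by blast
  qed
  show ?thesis
  proof (rule exI[of _ M], intro conjI ballI allI impI M(1))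
    fix T T' r assume "T \<in> \<Omega>" "T' \<in> \<Omega>" "patch T 0 (r + M) = patch T' 0 (r + M)"
    then show "patch (punctures w T) 0 r = patch (punctures w T') 0 r"
      using half[of T r T'] half[of T' r T] by simp
  qed
qed

lemma solid_tilings_punctures: "solid_tilings (punctures w ` \<Omega>)"
  by (rule solid_tilings.intro) (auto intro: tilewise_solid_punctures)

text \<open>
  A tiling near \<open>T\<close> agrees with \<open>T\<close> on a large ball up to a small translation, and both the agreement
  and the translation are passed on to the punctures.
\<close>

lemma continuous_map_punctures:
  "continuous_map (tiling_topology \<Omega>) (tiling_topology (punctures w ` \<Omega>)) (punctures w)"
proof (rule solid_tilings.continuous_map_into_tilingsI[OF solid_tilings_punctures])
  fix T and \<epsilon> :: real assume T: "T \<in> topspace (tiling_topology \<Omega>)" and \<epsilon>: "\<epsilon> > 0"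
  define \<delta> where "\<delta> = finer \<epsilon>"
  have \<delta>: "\<delta> > 0" unfolding \<delta>_def using \<epsilon> by (rule finer_pos)
  obtain M where M: "M \<ge> 0" "\<forall>T\<in>\<Omega>. \<forall>T'\<in>\<Omega>. \<forall>r. patch T 0 (r + M) = patch T' 0 (r + M) \<longrightarrow>
     patch (punctures w T) 0 r = patch (punctures w T') 0 r"
    using punctures_local by blast
  have T': "T \<in> \<Omega>" using T by simp
  obtain N where N: "openin (tiling_topology \<Omega>) N" "T \<in> N"
    "\<forall>S\<in>N. \<exists>z. norm z < \<delta> \<and> patch (S \<ominus> z) 0 (1 / \<delta> + M) = patch T 0 (1 / \<delta> + M)"
    using neighbourhood_patch_eq[OF T' \<delta>, of "1 / \<delta> + M"] by blast
  have "tilings_close \<epsilon> (punctures w T) (punctures w S)" if S: "S \<in> N" for S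
  proof -
    have S\<Omega>: "S \<in> \<Omega>" using S openin_subset[OF N(1)] by auto
    obtain z where z: "norm z < \<delta>" "patch (S \<ominus> z) 0 (1 / \<delta> + M) = patch T 0 (1 / \<delta> + M)"
      using N(3) S by blast
    then have "patch (punctures w T) 0 (1 / \<delta>) = patch (punctures w (S \<ominus> z)) 0 (1 / \<delta>)"
      using M(2) T' translate_closed[OF S\<Omega>] by (metis (no_types))
    then have "tilings_close \<delta> (punctures w T) (punctures w S \<ominus> z)"
      unfolding punctures_translate[OF tilewise_solid[OF S\<Omega>]]
      by (rule tilings_close_of_patch_eq[OF tilewise_solid_punctures \<delta>]) simp
    moreover have "tilings_close \<delta> (punctures w S \<ominus> z) (punctures w S)"
      using tilings_close_translate_self[OF tilewise_solid_punctures[of w S], of z 0 \<delta>] z(1) by simp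
    moreover have "tilewise_solid (punctures w S \<ominus> z)"
      unfolding punctures_translate[OF tilewise_solid[OF S\<Omega>], symmetric] by (rule tilewise_solid_punctures)
    ultimately show ?thesis
      unfolding \<delta>_def using tilings_close_finer[OF \<epsilon>] tilewise_solid_punctures by blast
  qed
  then show "\<exists>W. openin (tiling_topology \<Omega>) W \<and> T \<in> W \<and> (\<forall>S\<in>W. tilings_close \<epsilon> (punctures w T) (punctures w S))"
    using N(1,2) by blast
qed simp

text \<open>
  A patch of the punctures is a subset of the punctures of a patch of \<open>T\<close>.  It may be a proper
  subset, and a translation class of patches forgets the position of the centre, so all subsets have to be
  admitted.
\<close>

lemma FLC_punctures: "FLC (punctures w ` \<Omega>)"
  unfolding FLC_def
proof
  fix R
  obtain M where M: "\<forall>T\<in>\<Omega>. \<forall>x r. patch (punctures w T) x r \<subseteq> punctures w (patch T x (r + M))"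
    using punctures_patch_subset by blast
  define \<C> where "\<C> = {tiling_orbit (patch T x (R + M)) |T x. T \<in> \<Omega>}"
  define \<F> where "\<F> C = (\<Union>Q\<in>C. tiling_orbit ` Pow (punctures w Q))" for C :: "('a, 'l) tiling set"
  have orbit_translate: "tiling_orbit (Z \<ominus> v) = tiling_orbit Z" for Z :: "('a, real) tiling" and v
  proof -
    have "Z \<ominus> x \<in> range (\<lambda>x. Z \<ominus> (v + x))" for x
      by (rule range_eqI[of _ _ "x - v"]) simp
    then show ?thesis unfolding tiling_orbit_def by auto
  qed
  have "finite (\<F> C)" if C: "C \<in> \<C>" for C
  proof -
    obtain T x where T: "C = tiling_orbit (patch T x (R + M))" "T \<in> \<Omega>" using C unfolding \<C>_def by blast
    define Q where "Q = patch T x (R + M)"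
    have Q: "tilewise_solid Q" using solid_tile[OF T(2)] patch_subset unfolding Q_def tilewise_solid_def by blast
    have "tiling_orbit ` Pow (punctures w (Q \<ominus> v)) \<subseteq> tiling_orbit ` Pow (punctures w Q)" for v
    proof
      fix O' assume "O' \<in> tiling_orbit ` Pow (punctures w (Q \<ominus> v))"
      then obtain Z where Z: "O' = tiling_orbit Z" "Z \<subseteq> punctures w Q \<ominus> v"
        unfolding punctures_translate[OF Q] by blast
      have "Z \<ominus> (- v) \<subseteq> punctures w Q" using translate_mono[OF Z(2), of "- v"] by simp
      moreover have "O' = tiling_orbit (Z \<ominus> (- v))" unfolding Z(1) orbit_translate ..
      ultimately show "O' \<in> tiling_orbit ` Pow (punctures w Q)" by blast
    qed
    then have "\<F> C \<subseteq> tiling_orbit ` Pow (punctures w Q)"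
      unfolding \<F>_def T(1) Q_def[symmetric] unfolding tiling_orbit_def[of Q] by blast
    moreover have "finite (tiling_orbit ` Pow (punctures w Q))"
      using finite_patch[OF T(2)] unfolding Q_def punctures_def by simp
    ultimately show ?thesis by (rule finite_subset)
  qed
  moreover have "finite \<C>" using FLC unfolding FLC_def \<C>_def by blast
  ultimately have "finite (\<Union>C\<in>\<C>. \<F> C)" by blast
  moreover have "{tiling_orbit (patch S x R) |S x. S \<in> punctures w ` \<Omega>} \<subseteq> (\<Union>C\<in>\<C>. \<F> C)"
  proof
    fix O' assume "O' \<in> {tiling_orbit (patch S x R) |S x. S \<in> punctures w ` \<Omega>}"
    then obtain T x where T: "O' = tiling_orbit (patch (punctures w T) x R)" "T \<in> \<Omega>" by blast
    define Q where "Q = patch T x (R + M)"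
    have "tiling_orbit Q \<in> \<C>" using T(2) unfolding \<C>_def Q_def by blast
    moreover have "Q \<in> tiling_orbit Q" unfolding tiling_orbit_def by (rule range_eqI[of _ _ 0]) simp
    moreover have "O' \<in> tiling_orbit ` Pow (punctures w Q)"
      using M T unfolding Q_def by blast
    ultimately show "O' \<in> (\<Union>C\<in>\<C>. \<F> C)" unfolding \<F>_def by blast
  qed
  ultimately show "finite {tiling_orbit (patch S x R) |S x. S \<in> punctures w ` \<Omega>}"
    by (rule finite_subset[rotated])
qed

lemma tiling_space_punctures: "tiling_space (punctures w ` \<Omega>)"
  unfolding tiling_space_def
proof (intro conjI)
  show "(\<forall>T\<in>punctures w ` \<Omega>. is_tiling T) \<or> (\<forall>T\<in>punctures w ` \<Omega>. is_delone T)"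
    using is_delone_punctures by blast
  show "compact_space (tiling_topology (punctures w ` \<Omega>))"
  proof -
    have "compactin (tiling_topology \<Omega>) \<Omega>"
      using tiling_space unfolding tiling_space_def compact_space_def by simp
    from image_compactin[OF this continuous_map_punctures[of w]] show ?thesis
      unfolding compact_space_def by simp
  qed
  have closed: "T \<ominus> v \<in> punctures w ` \<Omega>" if T: "T \<in> punctures w ` \<Omega>" for T v
  proof -
    obtain S where S: "S \<in> \<Omega>" "T = punctures w S" using T by blast
    have "T \<ominus> v = punctures w (S \<ominus> v)" unfolding S(2) punctures_translate[OF tilewise_solid[OF S(1)]] ..
    then show ?thesis using translate_closed[OF S(1)] by blast
  qed
  then show "\<forall>T\<in>punctures w ` \<Omega>. \<forall>v. T \<ominus> v \<in> punctures w ` \<Omega>" by blast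
  define K where "K = \<Union>(punctures w ` \<Omega>)"
  define P where "P = K \<inter> {({0}, 0)}"
  have "\<exists>q\<in>P. \<exists>v. {p} = {q} \<ominus> v" if p: "p \<in> K" for p
  proof -
    obtain T where T: "T \<in> punctures w ` \<Omega>" "p \<in> T" using p unfolding K_def by blast
    then obtain c where c: "p = ({c}, 0)" unfolding punctures_def by blast
    have "shift_tile p c \<in> T \<ominus> c" using T(2) by simp
    moreover have "shift_tile p c = ({0}, 0)" unfolding c shift_tile_def by simp
    ultimately have "({0}, 0) \<in> P" using closed[OF T(1)] unfolding P_def K_def by auto
    moreover have "{p} = {({0}, 0)} \<ominus> (- c)" unfolding c translate_eq_shift_tile shift_tile_def by simp
    ultimately show ?thesis by blast
  qed
  moreover have "\<exists>q\<in>P. \<exists>r. strict_mono r \<and> (\<lambda>n. tile_dist (\<sigma> (r n)) q) \<longlonglongrightarrow> 0"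
    if \<sigma>: "range \<sigma> \<subseteq> P" for \<sigma> :: "nat \<Rightarrow> ('a, real) tile"
  proof -
    have "\<sigma> n = ({0}, 0)" for n using \<sigma> unfolding P_def by blast
    moreover have "\<sigma> 0 \<in> P" using \<sigma> by blast
    moreover have "tile_dist ({0::'a}, 0::real) ({0}, 0) = 0" by (rule tile_dist_self) (simp add: solid_def)
    ultimately show ?thesis
      by (intro bexI[of _ "({0}, 0)"] exI[of _ id]) (simp_all add: strict_mono_def)
  qed
  moreover have "P \<subseteq> K" unfolding P_def by blast
  ultimately show "compact_up_to_translation (\<Union>(punctures w ` \<Omega>))"
    unfolding compact_up_to_translation_def K_def[symmetric] by (intro exI[of _ P]) simp
qed

lemma local_derivation_punctures: "local_derivation \<Omega> (punctures w ` \<Omega>) (punctures w)"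
  unfolding local_derivation_def factor_map_def
proof (intro conjI continuous_map_punctures refl ballI allI impI)
  fix T v assume "T \<in> \<Omega>"
  then show "punctures w (T \<ominus> v) = punctures w T \<ominus> v"
    using punctures_translate tilewise_solid by blast
next
  fix r :: real assume "r > 0"
  obtain M where M: "M \<ge> 0" "\<forall>T\<in>\<Omega>. \<forall>T'\<in>\<Omega>. \<forall>r. patch T 0 (r + M) = patch T' 0 (r + M) \<longrightarrow>
     patch (punctures w T) 0 r = patch (punctures w T') 0 r"
    using punctures_local by blast
  then show "\<exists>R>0. \<forall>T\<in>\<Omega>. \<forall>T'\<in>\<Omega>. patch T 0 R = patch T' 0 R \<longrightarrow>
      patch (punctures w T) 0 r = patch (punctures w T') 0 r"
    using \<open>r > 0\<close> by (intro exI[of _ "r + M"] conjI) (simp, blast)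
qed

definition puncture_transversal :: "'a \<Rightarrow> ('a, 'l) tiling set" where
  "puncture_transversal w = {T \<in> \<Omega>. \<exists>p\<in>T. puncture w p = 0}"

lemma FLC_transversal_puncture_transversal: "FLC_transversal \<Omega> (puncture_transversal w)"
  unfolding FLC_transversal_def
proof (intro exI conjI)
  show "puncture_transversal w = {T \<in> \<Omega>. punctures w T \<in> canonical_transversal (punctures w ` \<Omega>)}"
    unfolding puncture_transversal_def canonical_transversal_def punctures_def by (auto simp: image_iff)
  show "\<forall>T\<in>punctures w ` \<Omega>. is_delone T" using is_delone_punctures by blast
qed (rule tiling_space_punctures FLC_punctures local_derivation_punctures)+

text \<open>
  Half the separation of the punctures is a suitable radius: if \<open>S \<ominus> x = S' \<ominus> x'\<close>, this tiling has
  punctures at \<open>- x\<close> and \<open>- x'\<close>.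
\<close>

lemma flow_chart_puncture_transversal: "\<exists>\<epsilon>. flow_chart \<Omega> (puncture_transversal w, \<epsilon>)"
proof -
  obtain e where e: "e > 0" "\<forall>T\<in>\<Omega>. \<forall>p\<in>T. \<forall>q\<in>T. dist (puncture w p) (puncture w q) < e \<longrightarrow> p = q"
    using puncture_separated by blast
  have "S = S' \<and> x = x'" if S: "S \<in> puncture_transversal w" "S' \<in> puncture_transversal w"
      "norm x < e / 2" "norm x' < e / 2" and eq: "S \<ominus> x = S' \<ominus> x'" for S S' x x'
  proof -
    obtain p p' where p: "p \<in> S" "puncture w p = 0" "p' \<in> S'" "puncture w p' = 0" "S \<in> \<Omega>" "S' \<in> \<Omega>"
      using S unfolding puncture_transversal_def by blast
    have P: "puncture w (shift_tile p x) = - x" "puncture w (shift_tile p' x') = - x'"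
      using p solid_tile by (simp_all add: puncture_shift_tile)
    have "shift_tile p x \<in> S \<ominus> x" "shift_tile p' x' \<in> S' \<ominus> x'" using p by simp_all
    then have "shift_tile p x \<in> S \<ominus> x" "shift_tile p' x' \<in> S \<ominus> x" using eq by simp_all
    moreover have "dist (- x) (- x') < e"
      using S(3,4) norm_triangle_ineq4[of x x'] by (simp add: dist_norm norm_minus_commute)
    ultimately have "shift_tile p x = shift_tile p' x'"
      using e(2) translate_closed[OF p(5)] P by metis
    then have "x = x'" using P by simp
    then have "S \<ominus> x \<ominus> (- x) = S' \<ominus> x' \<ominus> (- x')" using eq by (simp only:)
    then have "S = S'" by simp
    with \<open>x = x'\<close> show ?thesis by simp
  qed
  then have "inj_on (\<lambda>(S, x). S \<ominus> x) (puncture_transversal w \<times> ball 0 (e / 2))"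
    unfolding inj_on_def by (clarsimp simp del: split_paired_All)
  then show ?thesis
    using e(1) FLC_transversal_puncture_transversal unfolding flow_chart_def
    by (intro exI[of _ "e / 2"]) simp
qed

text \<open>
  The shift \<open>w\<close> is chosen such that some tile of \<open>T\<close> has its puncture at the origin.
\<close>

lemma flow_boxes_cover:
  assumes "T \<in> \<Omega>"
  shows "\<exists>i\<in>flow_boxes \<Omega>. T \<in> flow_box i"
proof -
  obtain p where p: "p \<in> T" using tiles_relatively_dense[OF assms] by blast
  define w where "w = - puncture 0 p"
  have "puncture w p = 0" unfolding w_def puncture_def by simp
  then have T: "T \<in> puncture_transversal w" using assms p unfolding puncture_transversal_def by blast
  obtain \<epsilon> where \<epsilon>: "flow_chart \<Omega> (puncture_transversal w, \<epsilon>)" using flow_chart_puncture_transversal by blast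
  then have "\<epsilon> > 0" unfolding flow_chart_def by simp
  then have "T \<in> flow_box (puncture_transversal w, \<epsilon>)"
    using T unfolding in_flow_box by (intro exI[of _ T] exI[of _ 0]) simp
  then show ?thesis using flow_chart_imp_flow_boxes[OF \<epsilon>] by blast
qed

end

section \<open>Cech cocycles trivialised by functions\<close>

text \<open>
  The functions \<open>b i\<close> are not required to be locally constant, so this is no coboundary condition for
  the cocycle \<open>c\<close>.
\<close>

fun primitive_of :: "('i, 'x, 'b::ab_group_add) cech \<Rightarrow> ('i \<Rightarrow> 'x \<Rightarrow> 'b) \<Rightarrow> bool" where
  "primitive_of (I, U, c) b \<longleftrightarrow> (\<forall>i\<in>I. \<forall>j\<in>I. \<forall>x\<in>U i \<inter> U j. c i j x = b i x - b j x)"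

definition equal_up_to_constant_near :: "'x topology \<Rightarrow> 'x \<Rightarrow> ('x \<Rightarrow> 'b::ab_group_add) \<Rightarrow> ('x \<Rightarrow> 'b) \<Rightarrow> bool" where
  "equal_up_to_constant_near X x f g \<longleftrightarrow>
     (\<exists>N k. openin X N \<and> x \<in> N \<and> (\<forall>y\<in>N. f y = g y + k))"

lemma equal_up_to_constant_near_trans:
  assumes "equal_up_to_constant_near X x f g" "equal_up_to_constant_near X x g h"
  shows "equal_up_to_constant_near X x f h"
proof -
  obtain N k M l where "openin X N" "x \<in> N" "\<forall>y\<in>N. f y = g y + k" "openin X M" "x \<in> M" "\<forall>y\<in>M. g y = h y + l"
    using assms unfolding equal_up_to_constant_near_def by metis
  then show ?thesis
    unfolding equal_up_to_constant_near_def
    by (intro exI[of _ "N \<inter> M"] exI[of _ "l + k"]) (auto simp: add.assoc)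
qed

lemma equal_up_to_constant_near_diff:
  assumes "equal_up_to_constant_near X x f g" "equal_up_to_constant_near X x f' g'"
  shows "equal_up_to_constant_near X x (\<lambda>y. f y - f' y) (\<lambda>y. g y - g' y)"
proof -
  obtain N k M l where "openin X N" "x \<in> N" "\<forall>y\<in>N. f y = g y + k" "openin X M" "x \<in> M" "\<forall>y\<in>M. f' y = g' y + l"
    using assms unfolding equal_up_to_constant_near_def by metis
  then show ?thesis
    unfolding equal_up_to_constant_near_def
    by (intro exI[of _ "N \<inter> M"] exI[of _ "k - l"]) auto
qed

lemma equal_up_to_constant_near_compose:
  assumes "continuous_map X Y h" "x \<in> topspace X" "equal_up_to_constant_near Y (h x) f g"
  shows "equal_up_to_constant_near X x (\<lambda>y. f (h y)) (\<lambda>y. g (h y))"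
proof -
  obtain N k where N: "openin Y N" "h x \<in> N" "\<forall>y\<in>N. f y = g y + k"
    using assms(3) unfolding equal_up_to_constant_near_def by metis
  have "openin X {y \<in> topspace X. h y \<in> N}"
    using assms(1) N(1) by (rule openin_continuous_map_preimage)
  then show ?thesis
    unfolding equal_up_to_constant_near_def using N assms(2)
    by (intro exI[of _ "{y \<in> topspace X. h y \<in> N}"] exI[of _ k]) auto
qed

lemma locally_constant_on_imp_near:
  assumes "locally_constant_on X A f" "openin X A" "x \<in> A"
  shows "equal_up_to_constant_near X x f (\<lambda>_. 0)"
proof -
  obtain W where W: "openin X W" "x \<in> W" "\<forall>y\<in>A \<inter> W. f y = f x"
    using assms(1,3) unfolding locally_constant_on_def by metis
  show ?thesis
    unfolding equal_up_to_constant_near_def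
  proof (intro exI conjI ballI)
    show "openin X (A \<inter> W)" "x \<in> A \<inter> W" using W assms(2,3) by blast+
    show "f y = 0 + f x" if "y \<in> A \<inter> W" for y using W(3) that by simp
  qed
qed

lemma cech_cocycleD:
  assumes "cech_cocycle X (I, U, c)"
  shows "\<forall>i\<in>I. openin X (U i)" "(\<Union>i\<in>I. U i) = topspace X"
    "\<forall>i\<in>I. \<forall>j\<in>I. locally_constant_on X (U i \<inter> U j) (c i j)"
    "\<forall>i\<in>I. \<forall>j\<in>I. \<forall>k\<in>I. \<forall>x\<in>U i \<inter> U j \<inter> U k. c i j x + c j k x = c i k x"
  using assms[unfolded cech_cocycle.simps] by simp_all

text \<open>
  On a set \<open>W\<close> of the common refinement, correct the primitive \<open>b (\<rho> W)\<close> by the locally constant cochain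
  \<open>g W\<close>, and pass from the index \<open>\<sigma> W\<close> to \<open>j\<close> by means of \<open>d\<close>.  The relation between the cocycles says that the
  result does not depend on \<open>W\<close>; only locally constant functions have been added.
\<close>

lemma primitive_transport:
  fixes c :: "'i \<Rightarrow> 'i \<Rightarrow> 'x \<Rightarrow> 'b::ab_group_add"
  assumes coh: "cech_cohomologous X (I, U, c) (J, V, d)" and d: "cech_cocycle X (J, V, d)"
    and b: "primitive_of (I, U, c) b"
  shows "\<exists>b'. primitive_of (J, V, d) b' \<and>
    (\<forall>j\<in>J. \<forall>x\<in>V j. \<exists>i\<in>I. x \<in> U i \<and> equal_up_to_constant_near X x (b' j) (b i))"
proof -
  obtain \<W> :: "'x set set" and \<rho> \<sigma> g where
    W: "\<forall>W\<in>\<W>. openin X W" "\<Union>\<W> = topspace X" and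
    \<rho>: "\<forall>W\<in>\<W>. \<rho> W \<in> I \<and> W \<subseteq> U (\<rho> W)" and \<sigma>: "\<forall>W\<in>\<W>. \<sigma> W \<in> J \<and> W \<subseteq> V (\<sigma> W)" and
    g: "\<forall>W\<in>\<W>. locally_constant_on X W (g W)" and
    eq: "\<forall>W\<in>\<W>. \<forall>W'\<in>\<W>. \<forall>x\<in>W \<inter> W'. c (\<rho> W) (\<rho> W') x - d (\<sigma> W) (\<sigma> W') x = g W' x - g W x"
    using coh unfolding cech_cohomologous.simps by (elim exE conjE) (rule that)
  note V = cech_cocycleD(1)[OF d] and d_loc = cech_cocycleD(3)[OF d] and d_add = cech_cocycleD(4)[OF d]
  have V_sub: "V j \<subseteq> topspace X" if "j \<in> J" for j using V that openin_subset by blast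
  define w where "w x = (SOME W. W \<in> \<W> \<and> x \<in> W)" for x
  have w: "w x \<in> \<W>" "x \<in> w x" if "x \<in> topspace X" for x
  proof -
    have "\<exists>W. W \<in> \<W> \<and> x \<in> W" using W(2) that by blast
    then have "w x \<in> \<W> \<and> x \<in> w x" unfolding w_def by (rule someI_ex)
    then show "w x \<in> \<W>" "x \<in> w x" by auto
  qed
  define b' where "b' j x = d j (\<sigma> (w x)) x + b (\<rho> (w x)) x + g (w x) x" for j x
  have b'_eq: "b' j x = d j (\<sigma> W) x + b (\<rho> W) x + g W x" if j: "j \<in> J" "x \<in> V j" and Wx: "W \<in> \<W>" "x \<in> W" for j x W
  proof -
    have x: "x \<in> topspace X" using V_sub j by blast
    note wx = w[OF x]
    have "c (\<rho> W) (\<rho> (w x)) x - d (\<sigma> W) (\<sigma> (w x)) x = g (w x) x - g W x"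
      using eq Wx wx by blast
    moreover have "c (\<rho> W) (\<rho> (w x)) x = b (\<rho> W) x - b (\<rho> (w x)) x"
      using b[unfolded primitive_of.simps] \<rho> Wx wx by blast
    moreover have "d j (\<sigma> W) x + d (\<sigma> W) (\<sigma> (w x)) x = d j (\<sigma> (w x)) x"
      using d_add \<sigma> Wx wx j by blast
    moreover have "d (\<sigma> W) (\<sigma> (w x)) x = c (\<rho> W) (\<rho> (w x)) x - (c (\<rho> W) (\<rho> (w x)) x - d (\<sigma> W) (\<sigma> (w x)) x)"
      by simp
    ultimately have "d j (\<sigma> (w x)) x = d j (\<sigma> W) x + ((b (\<rho> W) x - b (\<rho> (w x)) x) - (g (w x) x - g W x))"
      by (simp only:)
    then show ?thesis unfolding b'_def by (simp add: algebra_simps)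
  qed
  have "primitive_of (J, V, d) b'"
    unfolding primitive_of.simps
  proof (intro ballI)
    fix j k x assume jk: "j \<in> J" "k \<in> J" "x \<in> V j \<inter> V k"
    then have x: "x \<in> topspace X" using V_sub by blast
    have "d j k x + d k (\<sigma> (w x)) x = d j (\<sigma> (w x)) x"
      using d_add \<sigma> w[OF x] jk by blast
    then show "d j k x = b' j x - b' k x" unfolding b'_def by (simp add: algebra_simps)
  qed
  moreover have "\<exists>i\<in>I. x \<in> U i \<and> equal_up_to_constant_near X x (b' j) (b i)" if j: "j \<in> J" "x \<in> V j" for j x
  proof -
    have x: "x \<in> topspace X" using V_sub j by blast
    define W' where "W' = w x"
    have W': "W' \<in> \<W>" "x \<in> W'" unfolding W'_def by (rule w[OF x])+
    have \<rho>\<sigma>: "\<rho> W' \<in> I" "W' \<subseteq> U (\<rho> W')" "\<sigma> W' \<in> J" "W' \<subseteq> V (\<sigma> W')" using \<rho> \<sigma> W'(1) by blast+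
    have "equal_up_to_constant_near X x (d j (\<sigma> W')) (\<lambda>_. 0)"
    proof (rule locally_constant_on_imp_near)
      show "locally_constant_on X (V j \<inter> V (\<sigma> W')) (d j (\<sigma> W'))" using d_loc j(1) \<rho>\<sigma>(3) by blast
      show "openin X (V j \<inter> V (\<sigma> W'))" using V j(1) \<rho>\<sigma>(3) by blast
      show "x \<in> V j \<inter> V (\<sigma> W')" using j(2) W'(2) \<rho>\<sigma>(4) by blast
    qed
    moreover have "equal_up_to_constant_near X x (g W') (\<lambda>_. 0)"
      using locally_constant_on_imp_near[of X W' "g W'" x] g W(1) W' by blast
    ultimately obtain N k M l where N: "openin X N" "x \<in> N" "\<forall>y\<in>N. d j (\<sigma> W') y = 0 + k"
      and M: "openin X M" "x \<in> M" "\<forall>y\<in>M. g W' y = 0 + l"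
      unfolding equal_up_to_constant_near_def by (elim exE conjE) (rule that)
    have "equal_up_to_constant_near X x (b' j) (b (\<rho> W'))"
      unfolding equal_up_to_constant_near_def
    proof (intro exI conjI ballI)
      show "openin X (N \<inter> M \<inter> V j \<inter> W')" using N(1) M(1) V j(1) W(1) W'(1) by blast
      show "x \<in> N \<inter> M \<inter> V j \<inter> W'" using N(2) M(2) j(2) W'(2) by blast
      fix y assume "y \<in> N \<inter> M \<inter> V j \<inter> W'"
      then show "b' j y = b (\<rho> W') y + (k + l)"
        using b'_eq[OF j(1), of y W'] W'(1) N(3) M(3) by (simp add: algebra_simps)
    qed
    then show ?thesis using \<rho>\<sigma> W'(2) by blast
  qed
  ultimately show ?thesis by blast
qed

lemma primitive_of_pullback:
  assumes "primitive_of (I, U, c) b"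
  shows "primitive_of (cech_pullback_cochain X h (I, U, c)) (\<lambda>i x. b i (h x))"
  using assms by auto

text \<open>
  Reindexing by the members of the cover themselves, so that the index type becomes the one that the
  classes are built on.
\<close>

lemma cech_class_nonempty:
  fixes X :: "'x topology" and c :: "'i \<Rightarrow> 'i \<Rightarrow> 'x \<Rightarrow> 'b::ab_group_add"
  assumes c: "cech_cocycle X (I, U, c)"
  shows "cech_class X (I, U, c) \<noteq> {}"
proof -
  define \<rho> where "\<rho> = inv_into I U"
  define d where "d A B = c (\<rho> A) (\<rho> B)" for A B
  have \<rho>: "\<rho> A \<in> I" "U (\<rho> A) = A" if "A \<in> U ` I" for A
    unfolding \<rho>_def by (rule inv_into_into[OF that], rule f_inv_into_f[OF that])
  note c' = cech_cocycleD[OF c]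
  have "cech_cocycle X (U ` I, (\<lambda>A. A), d)"
    unfolding cech_cocycle.simps
  proof (intro conjI ballI)
    fix A B assume AB: "A \<in> U ` I" "B \<in> U ` I"
    then show "openin X A" using c'(1) by blast
    have "locally_constant_on X (U (\<rho> A) \<inter> U (\<rho> B)) (c (\<rho> A) (\<rho> B))"
      using c'(3) \<rho>(1) AB by blast
    then show "locally_constant_on X (A \<inter> B) (d A B)" unfolding d_def using \<rho>(2) AB by simp
    fix C x assume C: "C \<in> U ` I" "x \<in> A \<inter> B \<inter> C"
    have "x \<in> U (\<rho> A) \<inter> U (\<rho> B) \<inter> U (\<rho> C)" using \<rho>(2) AB C by simp
    then show "d A B x + d B C x = d A C x"
      unfolding d_def using c'(4) \<rho>(1) AB C(1) by blast
  qed (use c' in auto)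
  moreover have "cech_cohomologous X (I, U, c) (U ` I, (\<lambda>A. A), d)"
    unfolding cech_cohomologous.simps
  proof (rule exI[of _ "U ` I"], rule exI[of _ \<rho>], rule exI[of _ "\<lambda>A. A"], rule exI[of _ "\<lambda>_ _. 0"], intro conjI ballI)
    fix A assume A: "A \<in> U ` I"
    show "openin X A" using A c'(1) by blast
    show "\<rho> A \<in> I" "A \<subseteq> U (\<rho> A)" using \<rho>[OF A] by auto
    show "locally_constant_on X A (\<lambda>_. 0 :: 'b)"
      unfolding locally_constant_on_def using A c'(1) by blast
  qed (use c'(2) in \<open>auto simp: d_def\<close>)
  ultimately have "(U ` I, (\<lambda>A. A), d) \<in> cech_class X (I, U, c)"
    unfolding cech_class_def by blast
  then show ?thesis by blast
qed

lemma cech_cocycle_pullback: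
  assumes h: "continuous_map X Y h" and c: "cech_cocycle Y (I, U, c)"
  shows "cech_cocycle X (cech_pullback_cochain X h (I, U, c))"
proof -
  note c' = cech_cocycleD[OF c]
  have pre: "openin X {x \<in> topspace X. h x \<in> W}" if "openin Y W" for W
    using h that by (rule openin_continuous_map_preimage)
  have loc: "locally_constant_on X ({x \<in> topspace X. h x \<in> U i} \<inter> {x \<in> topspace X. h x \<in> U j}) (\<lambda>x. c i j (h x))"
    if ij: "i \<in> I" "j \<in> I" for i j
    unfolding locally_constant_on_def
  proof
    fix x assume x: "x \<in> {x \<in> topspace X. h x \<in> U i} \<inter> {x \<in> topspace X. h x \<in> U j}"
    then have "h x \<in> U i \<inter> U j" by simp
    moreover have "locally_constant_on Y (U i \<inter> U j) (c i j)" using c'(3) ij by blast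
    ultimately obtain W where W: "openin Y W" "h x \<in> W" "\<forall>y\<in>(U i \<inter> U j) \<inter> W. c i j y = c i j (h x)"
      unfolding locally_constant_on_def by blast
    show "\<exists>W. openin X W \<and> x \<in> W \<and>
        (\<forall>y\<in>({x \<in> topspace X. h x \<in> U i} \<inter> {x \<in> topspace X. h x \<in> U j}) \<inter> W. c i j (h y) = c i j (h x))"
    proof (intro exI conjI ballI)
      show "openin X {x \<in> topspace X. h x \<in> W}" by (rule pre[OF W(1)])
      show "x \<in> {x \<in> topspace X. h x \<in> W}" using x W(2) by simp
      fix y assume "y \<in> ({x \<in> topspace X. h x \<in> U i} \<inter> {x \<in> topspace X. h x \<in> U j}) \<inter> {x \<in> topspace X. h x \<in> W}"
      then have "h y \<in> (U i \<inter> U j) \<inter> W" by blast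
      then show "c i j (h y) = c i j (h x)" using W(3) by blast
    qed
  qed
  have "(\<Union>i\<in>I. {x \<in> topspace X. h x \<in> U i}) = topspace X"
    using c'(2) h unfolding continuous_map_def by blast
  then show ?thesis
    using c'(1,4) pre loc by simp
qed

section \<open>The strong class as a germ of flow coordinates\<close>

context FLC_space
begin

lemma openin_flow_box: "i \<in> flow_boxes \<Omega> \<Longrightarrow> openin (tiling_topology \<Omega>) (flow_box i)"
  unfolding flow_boxes_def by auto

lemma flow_box_subset: "i \<in> flow_boxes \<Omega> \<Longrightarrow> flow_box i \<subseteq> \<Omega>"
  using openin_subset[OF openin_flow_box] by simp

lemma flow_coordinate_diff_locally_constant:
  assumes i: "i \<in> flow_boxes \<Omega>" and j: "j \<in> flow_boxes \<Omega>"
  shows "locally_constant_on (tiling_topology \<Omega>) (flow_box i \<inter> flow_box j)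
    (\<lambda>T. flow_coordinate i T - flow_coordinate j T)"
  unfolding locally_constant_on_def
proof
  fix T\<^sub>0 assume T\<^sub>0: "T\<^sub>0 \<in> flow_box i \<inter> flow_box j"
  then have in_\<Omega>: "T\<^sub>0 \<in> \<Omega>" using flow_box_subset[OF i] by blast
  have ij: "flow_chart \<Omega> i" "flow_chart \<Omega> j" using i j flow_boxes_imp_flow_chart by blast+
  obtain R \<eta> where R: "\<eta> > 0" "\<forall>T\<in>\<Omega>. \<forall>z. norm z < \<eta> \<longrightarrow> patch (T \<ominus> z) 0 R = patch T\<^sub>0 0 R \<longrightarrow>
     T \<in> flow_box i \<and> flow_coordinate i T = flow_coordinate i T\<^sub>0 - z"
    using flow_coordinate_local[OF ij(1)] T\<^sub>0 by blast
  obtain R' \<eta>' where R': "\<eta>' > 0" "\<forall>T\<in>\<Omega>. \<forall>z. norm z < \<eta>' \<longrightarrow> patch (T \<ominus> z) 0 R' = patch T\<^sub>0 0 R' \<longrightarrow>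
     T \<in> flow_box j \<and> flow_coordinate j T = flow_coordinate j T\<^sub>0 - z"
    using flow_coordinate_local[OF ij(2)] T\<^sub>0 by blast
  have "min \<eta> \<eta>' > 0" using R(1) R'(1) by simp
  then obtain N where N: "openin (tiling_topology \<Omega>) N" "T\<^sub>0 \<in> N"
    "\<forall>T\<in>N. \<exists>z. norm z < min \<eta> \<eta>' \<and> patch (T \<ominus> z) 0 (max R R') = patch T\<^sub>0 0 (max R R')"
    using neighbourhood_patch_eq[OF in_\<Omega>] by metis
  have "flow_coordinate i T - flow_coordinate j T = flow_coordinate i T\<^sub>0 - flow_coordinate j T\<^sub>0"
    if T: "T \<in> N" for T
  proof -
    obtain z where z: "norm z < min \<eta> \<eta>'" "patch (T \<ominus> z) 0 (max R R') = patch T\<^sub>0 0 (max R R')"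
      using N(3) T by blast
    have "patch (T \<ominus> z) 0 R = patch T\<^sub>0 0 R" "patch (T \<ominus> z) 0 R' = patch T\<^sub>0 0 R'"
      using patch_eq_mono[OF z(2), of R 0] patch_eq_mono[OF z(2), of R' 0] by simp_all
    moreover have "T \<in> \<Omega>" using openin_subset[OF N(1)] T by auto
    ultimately have "flow_coordinate i T = flow_coordinate i T\<^sub>0 - z" "flow_coordinate j T = flow_coordinate j T\<^sub>0 - z"
      using z(1) R(2) R'(2) by simp_all
    then show ?thesis by simp
  qed
  then show "\<exists>W. openin (tiling_topology \<Omega>) W \<and> T\<^sub>0 \<in> W \<and> (\<forall>T\<in>(flow_box i \<inter> flow_box j) \<inter> W.
      flow_coordinate i T - flow_coordinate j T = flow_coordinate i T\<^sub>0 - flow_coordinate j T\<^sub>0)"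
    using N(1,2) by blast
qed

lemma cech_cocycle_flow_box_cocycle: "cech_cocycle (tiling_topology \<Omega>) (flow_box_cocycle \<Omega> (\<lambda>T v. v))"
  unfolding flow_box_cocycle_def cech_cocycle.simps flow_coordinate_def[symmetric]
proof (intro conjI ballI)
  show "(\<Union>i\<in>flow_boxes \<Omega>. flow_box i) = topspace (tiling_topology \<Omega>)"
    using flow_boxes_cover flow_box_subset by auto
qed (auto intro: openin_flow_box flow_coordinate_diff_locally_constant)

lemma identity_in_fundamental_shape_class: "(\<lambda>T v. v) \<in> fundamental_shape_class \<Omega>"
proof -
  have const: "transversally_locally_constant \<Omega> (\<lambda>_. v :: 'a)" for v
    unfolding transversally_locally_constant_def locally_constant_on_def
  proof (intro allI impI ballI)
    fix \<Xi> T assume "FLC_transversal \<Omega> \<Xi>" "T \<in> \<Xi>"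
    then have "T \<in> \<Omega>" using FLC_transversal_subset by blast
    moreover have "openin (tiling_topology \<Omega>) \<Omega>" using openin_topspace[of "tiling_topology \<Omega>"] by simp
    ultimately show "\<exists>W. openin (tiling_topology \<Omega>) W \<and> T \<in> W \<and> (\<forall>y\<in>\<Xi> \<inter> W. v = v)" by blast
  qed
  have "continuous_map (prod_topology (tiling_topology \<Omega>) euclidean) euclidean (\<lambda>(T, x). x :: 'a)"
  proof -
    have "(\<lambda>(T, x). x) = (snd :: ('a, 'l) tiling \<times> 'a \<Rightarrow> 'a)" by auto
    then show ?thesis by (simp only: continuous_map_snd)
  qed
  then have "strong_cocycle \<Omega> (\<lambda>T v. v)"
    using const unfolding strong_cocycle_def weak_cocycle_def by simp
  moreover have "strong_coboundary \<Omega> (\<lambda>T v. v - v :: 'a)"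
    unfolding strong_coboundary_def using const[of 0] by (intro exI[of _ "\<lambda>_. 0"]) simp
  ultimately show ?thesis
    unfolding fundamental_shape_class_def strong_cohomology_class_def by simp
qed

lemma strong_class_nonempty:
  assumes h: "continuous_map (tiling_topology \<Omega>') (tiling_topology \<Omega>) h"
  shows "strong_class \<Omega>' \<Omega> h \<noteq> {}"
proof -
  have "cech_cocycle (tiling_topology \<Omega>) (flow_boxes \<Omega>, flow_box,
      \<lambda>i j T. flow_box_function (\<lambda>T v. v) i T - flow_box_function (\<lambda>T v. v) j T)"
    using cech_cocycle_flow_box_cocycle unfolding flow_box_cocycle_def .
  from cech_class_nonempty[OF this] obtain C
    where C: "C \<in> cech_class (tiling_topology \<Omega>) (flow_box_cocycle \<Omega> (\<lambda>T v. v))"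
    unfolding flow_box_cocycle_def by blast
  obtain J V d where JVd: "C = (J, V, d)" by (cases C)
  have "cech_cocycle (tiling_topology \<Omega>) (J, V, d)" using C unfolding cech_class_def JVd by blast
  from cech_cocycle_pullback[OF h this]
  have "cech_class (tiling_topology \<Omega>') (cech_pullback_cochain (tiling_topology \<Omega>') h C) \<noteq> {}"
    unfolding JVd cech_pullback_cochain.simps by (rule cech_class_nonempty)
  moreover have "C \<in> strong_to_cech \<Omega> (fundamental_shape_class \<Omega>)"
    unfolding strong_to_cech_def using C identity_in_fundamental_shape_class by blast
  ultimately show ?thesis
    unfolding strong_class_def cech_pullback_def by blast
qed

text \<open>
  Let \<open>\<alpha>\<close> be \<open>\<lambda>T v. v\<close> plus the coboundary of \<open>s\<close>.  At \<open>S \<ominus> x\<close> its function on a flow box is \<open>x\<close>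
  plus the value of \<open>s\<close> there minus \<open>s S\<close>, and \<open>s\<close> is locally constant on the transversal.
\<close>

lemma flow_box_function_near:
  assumes \<alpha>: "\<alpha> \<in> fundamental_shape_class \<Omega>"
  shows "\<exists>s. continuous_map (tiling_topology \<Omega>) euclidean s \<and> (\<forall>i\<in>flow_boxes \<Omega>. \<forall>T\<in>flow_box i.
    equal_up_to_constant_near (tiling_topology \<Omega>) T (flow_box_function \<alpha> i) (\<lambda>T. flow_coordinate i T + s T))"
proof -
  have "strong_coboundary \<Omega> (\<lambda>T v. \<alpha> T v - v)"
    using \<alpha> unfolding fundamental_shape_class_def strong_cohomology_class_def by blast
  then obtain s where s: "continuous_map (tiling_topology \<Omega>) euclidean s"
    "transversally_locally_constant \<Omega> s" "\<forall>T\<in>\<Omega>. \<forall>v. \<alpha> T v - v = s (T \<ominus> v) - s T"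
    unfolding strong_coboundary_def by blast
  have "equal_up_to_constant_near (tiling_topology \<Omega>) T\<^sub>0 (flow_box_function \<alpha> i) (\<lambda>T. flow_coordinate i T + s T)"
    if i: "i \<in> flow_boxes \<Omega>" and T\<^sub>0: "T\<^sub>0 \<in> flow_box i" for i T\<^sub>0
  proof -
    have chart: "flow_chart \<Omega> i" using i by (rule flow_boxes_imp_flow_chart)
    have \<Xi>: "FLC_transversal \<Omega> (fst i)" using chart unfolding flow_chart_def by (elim conjE)
    have \<Xi>_sub: "fst i \<subseteq> \<Omega>" using FLC_transversal_subset[OF \<Xi>] .
    obtain S\<^sub>0 x where x: "S\<^sub>0 \<in> fst i" "norm x < snd i" "T\<^sub>0 = S\<^sub>0 \<ominus> x"
      using T\<^sub>0 unfolding in_flow_box by blast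
    have S\<^sub>0: "S\<^sub>0 \<in> \<Omega>" using x(1) \<Xi>_sub by blast
    have "locally_constant_on (tiling_topology \<Omega>) (fst i) s"
      using s(2) \<Xi> unfolding transversally_locally_constant_def by blast
    then obtain W where W: "openin (tiling_topology \<Omega>) W" "S\<^sub>0 \<in> W" "\<forall>S\<in>fst i \<inter> W. s S = s S\<^sub>0"
      unfolding locally_constant_on_def using x(1) by blast
    obtain \<epsilon> where \<epsilon>: "\<epsilon> > 0" "\<forall>S\<in>\<Omega>. tilings_close \<epsilon> S\<^sub>0 S \<longrightarrow> S \<in> W"
      using W(1,2) unfolding openin_tiling_topology by blast
    obtain R where R: "\<forall>T\<in>\<Omega>. \<forall>z. norm z < snd i - norm x \<longrightarrow> patch (T \<ominus> z) 0 R = patch (S\<^sub>0 \<ominus> x) 0 R \<longrightarrow>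
     (\<exists>S\<in>fst i. T = S \<ominus> (x - z) \<and> norm (x - z) < snd i \<and> patch S 0 (1 / \<epsilon>) = patch S\<^sub>0 0 (1 / \<epsilon>))"
      using flow_chart_nearby[OF chart x(1)] by blast
    have "snd i - norm x > 0" using x(2) by simp
    then obtain N where N: "openin (tiling_topology \<Omega>) N" "T\<^sub>0 \<in> N"
      "\<forall>T\<in>N. \<exists>z. norm z < snd i - norm x \<and> patch (T \<ominus> z) 0 R = patch T\<^sub>0 0 R"
      using neighbourhood_patch_eq[of T\<^sub>0 "snd i - norm x" R] translate_closed[OF S\<^sub>0] x(3) by blast
    have "flow_box_function \<alpha> i T = (flow_coordinate i T + s T) + (- s S\<^sub>0)" if T: "T \<in> N" for T
    proof -
      have T\<Omega>: "T \<in> \<Omega>" using openin_subset[OF N(1)] T by auto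
      obtain z where z: "norm z < snd i - norm x" "patch (T \<ominus> z) 0 R = patch T\<^sub>0 0 R"
        using N(3) T by blast
      then obtain S where S: "S \<in> fst i" "T = S \<ominus> (x - z)" "norm (x - z) < snd i"
          "patch S 0 (1 / \<epsilon>) = patch S\<^sub>0 0 (1 / \<epsilon>)"
        using R T\<Omega> x(3) by blast
      have S\<Omega>: "S \<in> \<Omega>" using S(1) \<Xi>_sub by blast
      have "tilings_close \<epsilon> S\<^sub>0 S"
        using tilings_close_of_patch_eq[OF tilewise_solid[OF S\<^sub>0] \<epsilon>(1) S(4)[symmetric]] by simp
      then have "s S = s S\<^sub>0" using \<epsilon>(2) W(3) S(1) S\<Omega> by blast
      moreover have "flow_box_function \<alpha> i T = \<alpha> S (x - z)"
        unfolding S(2) by (rule flow_box_function_translate[OF chart S(1,3)])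
      moreover have "flow_coordinate i T = x - z"
        unfolding S(2) by (rule flow_coordinate_translate[OF chart S(1,3)])
      moreover have "\<alpha> S (x - z) - (x - z) = s T - s S"
        using s(3) S\<Omega> S(2) by blast
      moreover have "\<alpha> S (x - z) = (\<alpha> S (x - z) - (x - z)) + (x - z)" by simp
      ultimately have "flow_box_function \<alpha> i T = (s T - s S\<^sub>0) + flow_coordinate i T" by (simp only:)
      then show ?thesis by simp
    qed
    then show ?thesis
      unfolding equal_up_to_constant_near_def using N(1,2) by blast
  qed
  with s(1) show ?thesis by blast
qed

text \<open>
  Starting from the primitive of the flow box cocycle, transport it to a Cech representative of the
  fundamental shape class, pull it back along \<open>h\<close>, and transport it to the given representative of the strong
  class.
\<close>

lemma strong_class_primitive:
  assumes h: "continuous_map (tiling_topology \<Omega>') (tiling_topology \<Omega>) h"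
    and E: "(K, W, e) \<in> strong_class \<Omega>' \<Omega> h"
  shows "\<exists>b s. primitive_of (K, W, e) b \<and> continuous_map (tiling_topology \<Omega>) euclidean s \<and>
    (\<forall>k\<in>K. \<forall>T\<in>W k. \<exists>i\<in>flow_boxes \<Omega>. h T \<in> flow_box i \<and>
       equal_up_to_constant_near (tiling_topology \<Omega>') T (b k) (\<lambda>T. flow_coordinate i (h T) + s (h T)))"
proof -
  define X where "X = tiling_topology \<Omega>'"
  define Y where "Y = tiling_topology \<Omega>"
  obtain \<alpha> C where \<alpha>: "\<alpha> \<in> fundamental_shape_class \<Omega>" and C: "C \<in> cech_class Y (flow_box_cocycle \<Omega> \<alpha>)"
    and E': "(K, W, e) \<in> cech_class X (cech_pullback_cochain X h C)"
    using E unfolding strong_class_def cech_pullback_def strong_to_cech_def X_def Y_def by blast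
  obtain J V d where JVd: "C = (J, V, d)" by (cases C)
  have d: "cech_cocycle Y (J, V, d)" "cech_cohomologous Y (flow_box_cocycle \<Omega> \<alpha>) (J, V, d)"
    using C unfolding cech_class_def JVd by blast+
  have "primitive_of (flow_box_cocycle \<Omega> \<alpha>) (flow_box_function \<alpha>)"
    unfolding flow_box_cocycle_def by simp
  then obtain b\<^sub>1 where b\<^sub>1: "primitive_of (J, V, d) b\<^sub>1"
    "\<forall>j\<in>J. \<forall>T\<in>V j. \<exists>i\<in>flow_boxes \<Omega>. T \<in> flow_box i \<and> equal_up_to_constant_near Y T (b\<^sub>1 j) (flow_box_function \<alpha> i)"
    using primitive_transport[OF d(2)[unfolded flow_box_cocycle_def] d(1)] unfolding flow_box_cocycle_def by blast
  obtain s where s: "continuous_map Y euclidean s" "\<forall>i\<in>flow_boxes \<Omega>. \<forall>T\<in>flow_box i.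
    equal_up_to_constant_near Y T (flow_box_function \<alpha> i) (\<lambda>T. flow_coordinate i T + s T)"
    using flow_box_function_near[OF \<alpha>] unfolding Y_def by blast
  have e: "cech_cocycle X (K, W, e)" "cech_cohomologous X (cech_pullback_cochain X h (J, V, d)) (K, W, e)"
    using E' unfolding cech_class_def JVd by blast+
  from primitive_transport[OF e(2)[unfolded cech_pullback_cochain.simps] e(1)
      primitive_of_pullback[OF b\<^sub>1(1), of X h, unfolded cech_pullback_cochain.simps]]
  obtain b where b: "primitive_of (K, W, e) b"
    "\<forall>k\<in>K. \<forall>T\<in>W k. \<exists>j\<in>J. T \<in> {T \<in> topspace X. h T \<in> V j} \<and> equal_up_to_constant_near X T (b k) (\<lambda>T. b\<^sub>1 j (h T))"
    by (elim exE conjE) (rule that)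
  have "\<exists>i\<in>flow_boxes \<Omega>. h T \<in> flow_box i \<and>
       equal_up_to_constant_near X T (b k) (\<lambda>T. flow_coordinate i (h T) + s (h T))"
    if kT: "k \<in> K" "T \<in> W k" for k T
  proof -
    obtain j where j: "j \<in> J" "T \<in> topspace X" "h T \<in> V j" "equal_up_to_constant_near X T (b k) (\<lambda>T. b\<^sub>1 j (h T))"
      using b(2) kT by blast
    obtain i where i: "i \<in> flow_boxes \<Omega>" "h T \<in> flow_box i"
        "equal_up_to_constant_near Y (h T) (b\<^sub>1 j) (flow_box_function \<alpha> i)"
      using b\<^sub>1(2) j(1,3) by blast
    have "equal_up_to_constant_near Y (h T) (b\<^sub>1 j) (\<lambda>T. flow_coordinate i T + s T)"
      using equal_up_to_constant_near_trans[OF i(3)] s(2) i(1,2) by blast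
    then have "equal_up_to_constant_near X T (\<lambda>T. b\<^sub>1 j (h T)) (\<lambda>T. flow_coordinate i (h T) + s (h T))"
      by (rule equal_up_to_constant_near_compose[OF h[folded X_def Y_def] j(2)])
    with j(4) have "equal_up_to_constant_near X T (b k) (\<lambda>T. flow_coordinate i (h T) + s (h T))"
      by (rule equal_up_to_constant_near_trans)
    with i(1,2) show ?thesis by blast
  qed
  with b(1) s(1) show ?thesis unfolding X_def Y_def by blast
qed

lemma flow_coordinate_close:
  assumes "i \<in> flow_boxes \<Omega>" "T\<^sub>0 \<in> flow_box i" "e > 0"
  shows "\<exists>N. openin (tiling_topology \<Omega>) N \<and> T\<^sub>0 \<in> N \<and>
    (\<forall>T\<in>N. dist (flow_coordinate i T) (flow_coordinate i T\<^sub>0) < e)"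
proof -
  have "T\<^sub>0 \<in> \<Omega>" using assms flow_box_subset by blast
  then obtain N where N: "openin (tiling_topology \<Omega>) N" "T\<^sub>0 \<in> N"
    "\<forall>T\<in>N. \<exists>z. norm z < e \<and> patch (T \<ominus> z) 0 0 = patch T\<^sub>0 0 0 \<and> flow_coordinate i T = flow_coordinate i T\<^sub>0 - z"
    using flow_coordinate_neighbourhood[OF flow_boxes_imp_flow_chart[OF assms(1)] assms(2) _ assms(3), of 0] by blast
  have "dist (flow_coordinate i T) (flow_coordinate i T\<^sub>0) < e" if T: "T \<in> N" for T
  proof -
    obtain z where "norm z < e" "flow_coordinate i T = flow_coordinate i T\<^sub>0 - z" using N(3) T by blast
    then show ?thesis by (simp add: dist_norm)
  qed
  with N(1,2) show ?thesis by blast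
qed

lemma flow_coordinate_small_translate:
  assumes "i \<in> flow_boxes \<Omega>" "T \<in> flow_box i"
  shows "\<exists>\<delta>>0. \<forall>w. norm w < \<delta> \<longrightarrow> flow_coordinate i (T \<ominus> w) = flow_coordinate i T + w"
proof -
  have chart: "flow_chart \<Omega> i" using assms(1) by (rule flow_boxes_imp_flow_chart)
  obtain S x where x: "S \<in> fst i" "norm x < snd i" "T = S \<ominus> x" using assms(2) unfolding in_flow_box by blast
  have "flow_coordinate i (T \<ominus> w) = flow_coordinate i T + w" if w: "norm w < snd i - norm x" for w
  proof -
    have "norm (x + w) < snd i" using w norm_triangle_ineq[of x w] by linarith
    then show ?thesis
      unfolding x(3) translate_translate using flow_coordinate_translate[OF chart x(1)] x(2) by simp
  qed
  then show ?thesis using x(2) by (intro exI[of _ "snd i - norm x"]) simp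
qed

text \<open>
  The small translation that takes \<open>S\<close> to the vicinity of \<open>S\<^sub>0\<close> also works for every \<open>S'\<close> that agrees with
  \<open>S\<close> on a large ball.
\<close>

lemma patch_eq_flow_coordinate:
  assumes i: "i \<in> flow_boxes \<Omega>" "S\<^sub>0 \<in> flow_box i" and V: "openin (tiling_topology \<Omega>) V" "S\<^sub>0 \<in> V"
  shows "\<exists>M R. openin (tiling_topology \<Omega>) M \<and> S\<^sub>0 \<in> M \<and> M \<subseteq> V \<and> R > 0 \<and>
    (\<forall>S\<in>M. \<forall>S'\<in>\<Omega>. patch S 0 R = patch S' 0 R \<longrightarrow> S' \<in> V \<and> flow_coordinate i S' = flow_coordinate i S)"
proof -
  have S\<^sub>0: "S\<^sub>0 \<in> \<Omega>" using i flow_box_subset by blast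
  obtain \<epsilon> where \<epsilon>: "\<epsilon> > 0" "\<forall>S\<in>\<Omega>. tilings_close \<epsilon> S\<^sub>0 S \<longrightarrow> S \<in> V"
    using V unfolding openin_tiling_topology by blast
  define \<delta> where "\<delta> = finer \<epsilon>"
  have \<delta>: "\<delta> > 0" unfolding \<delta>_def using \<epsilon>(1) by (rule finer_pos)
  obtain M\<^sub>1 where M\<^sub>1: "openin (tiling_topology \<Omega>) M\<^sub>1" "S\<^sub>0 \<in> M\<^sub>1" "\<And>S. S \<in> M\<^sub>1 \<Longrightarrow> tilings_close \<delta> S\<^sub>0 S"
    by (rule tilings_close_neighbourhood[OF S\<^sub>0 \<delta>]) simp_all
  obtain R\<^sub>2 \<eta> where R\<^sub>2: "\<eta> > 0" "\<forall>T\<in>\<Omega>. \<forall>z. norm z < \<eta> \<longrightarrow> patch (T \<ominus> z) 0 R\<^sub>2 = patch S\<^sub>0 0 R\<^sub>2 \<longrightarrow>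
     T \<in> flow_box i \<and> flow_coordinate i T = flow_coordinate i S\<^sub>0 - z"
    using flow_coordinate_local[OF flow_boxes_imp_flow_chart[OF i(1)] i(2)] by blast
  obtain M\<^sub>2 where M\<^sub>2: "openin (tiling_topology \<Omega>) M\<^sub>2" "S\<^sub>0 \<in> M\<^sub>2"
    "\<forall>S\<in>M\<^sub>2. \<exists>z. norm z < \<eta> \<and> patch (S \<ominus> z) 0 R\<^sub>2 = patch S\<^sub>0 0 R\<^sub>2"
    using neighbourhood_patch_eq[OF S\<^sub>0 R\<^sub>2(1), of R\<^sub>2] by blast
  define R where "R = max (1 / \<delta>) (R\<^sub>2 + \<eta>)"
  have R: "R > 0" "1 / \<delta> \<le> R" unfolding R_def using \<delta> by (auto simp: less_max_iff_disj)
  have "S' \<in> V \<and> flow_coordinate i S' = flow_coordinate i S"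
    if S: "S \<in> M\<^sub>1 \<inter> M\<^sub>2" and S': "S' \<in> \<Omega>" and eq: "patch S 0 R = patch S' 0 R" for S S'
  proof
    have S\<Omega>: "S \<in> \<Omega>" using S openin_subset[OF M\<^sub>1(1)] by auto
    have "tilings_close \<delta> S\<^sub>0 S" using M\<^sub>1(3) S by blast
    moreover have "tilings_close \<delta> S S'"
      using tilings_close_of_patch_eq[OF tilewise_solid[OF S\<Omega>] \<delta> eq R(2)] .
    ultimately have "tilings_close \<epsilon> S\<^sub>0 S'"
      unfolding \<delta>_def by (rule tilings_close_finer[OF \<epsilon>(1) tilewise_solid[OF S\<^sub>0] tilewise_solid[OF S\<Omega>] tilewise_solid[OF S']])
    then show "S' \<in> V" using \<epsilon>(2) S' by blast
    obtain z where z: "norm z < \<eta>" "patch (S \<ominus> z) 0 R\<^sub>2 = patch S\<^sub>0 0 R\<^sub>2" using M\<^sub>2(3) S by blast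
    have "patch (S \<ominus> z) 0 R\<^sub>2 = patch (S' \<ominus> z) 0 R\<^sub>2"
      using z(1) by (intro patch_eq_mono[OF eq]) (simp add: R_def less_imp_le)
    then have "patch (S' \<ominus> z) 0 R\<^sub>2 = patch S\<^sub>0 0 R\<^sub>2" using z(2) by simp
    then show "flow_coordinate i S' = flow_coordinate i S" using R\<^sub>2(2) z S' S\<Omega> by simp
  qed
  then show ?thesis
    using M\<^sub>1(1,2) M\<^sub>2(1,2) V R(1)
    by (intro exI[of _ "M\<^sub>1 \<inter> M\<^sub>2 \<inter> V"] exI[of _ R]) auto
qed

end

definition flow_potential ::
    "('a::euclidean_space, 'l::metric_space) tiling set \<Rightarrow>
     ('a, 'l1::metric_space) tiling set \<Rightarrow> (('a, 'l) tiling \<Rightarrow> ('a, 'l1) tiling) \<Rightarrow>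
     ('a, 'l2::metric_space) tiling set \<Rightarrow> (('a, 'l) tiling \<Rightarrow> ('a, 'l2) tiling) \<Rightarrow>
     (('a, 'l) tiling \<Rightarrow> 'a) \<Rightarrow> bool" where
  "flow_potential \<Omega> \<Omega>\<^sub>1 h\<^sub>1 \<Omega>\<^sub>2 h\<^sub>2 \<sigma> \<longleftrightarrow> (\<forall>T\<in>\<Omega>. \<exists>i\<in>flow_boxes \<Omega>\<^sub>1. \<exists>j\<in>flow_boxes \<Omega>\<^sub>2.
     h\<^sub>1 T \<in> flow_box i \<and> h\<^sub>2 T \<in> flow_box j \<and>
     equal_up_to_constant_near (tiling_topology \<Omega>) T \<sigma>
       (\<lambda>T. flow_coordinate i (h\<^sub>1 T) - flow_coordinate j (h\<^sub>2 T)))"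

text \<open>
  Two primitives of the same cocycle differ by a function that does not depend on the index; the
  continuous global functions in them are subtracted at the end.
\<close>

lemma equal_strong_classes_potential:
  assumes "FLC_space \<Omega>\<^sub>1" "FLC_space \<Omega>\<^sub>2"
    and h: "continuous_map (tiling_topology \<Omega>) (tiling_topology \<Omega>\<^sub>1) h\<^sub>1"
      "continuous_map (tiling_topology \<Omega>) (tiling_topology \<Omega>\<^sub>2) h\<^sub>2"
    and eq: "strong_class \<Omega> \<Omega>\<^sub>1 h\<^sub>1 = strong_class \<Omega> \<Omega>\<^sub>2 h\<^sub>2"
  shows "\<exists>\<sigma>. flow_potential \<Omega> \<Omega>\<^sub>1 h\<^sub>1 \<Omega>\<^sub>2 h\<^sub>2 \<sigma>"
proof -
  interpret F1: FLC_space \<Omega>\<^sub>1 by fact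
  interpret F2: FLC_space \<Omega>\<^sub>2 by fact
  define X where "X = tiling_topology \<Omega>"
  obtain E where E: "E \<in> strong_class \<Omega> \<Omega>\<^sub>1 h\<^sub>1" using F1.strong_class_nonempty[OF h(1)] by blast
  obtain K W e where KWe: "E = (K, W, e)" by (cases E)
  note E1 = E[unfolded KWe] and E2 = E[unfolded KWe eq]
  have e: "cech_cocycle X (K, W, e)"
    using E1 unfolding strong_class_def cech_pullback_def cech_class_def X_def by blast
  have W: "\<forall>k\<in>K. openin X (W k)" "(\<Union>k\<in>K. W k) = \<Omega>"
    using e unfolding cech_cocycle.simps X_def by simp_all
  obtain b\<^sub>1 s\<^sub>1 where b\<^sub>1: "primitive_of (K, W, e) b\<^sub>1"
    "\<forall>k\<in>K. \<forall>T\<in>W k. \<exists>i\<in>flow_boxes \<Omega>\<^sub>1. h\<^sub>1 T \<in> flow_box i \<and>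
       equal_up_to_constant_near X T (b\<^sub>1 k) (\<lambda>T. flow_coordinate i (h\<^sub>1 T) + s\<^sub>1 (h\<^sub>1 T))"
    using F1.strong_class_primitive[OF h(1) E1] unfolding X_def by blast
  obtain b\<^sub>2 s\<^sub>2 where b\<^sub>2: "primitive_of (K, W, e) b\<^sub>2"
    "\<forall>k\<in>K. \<forall>T\<in>W k. \<exists>i\<in>flow_boxes \<Omega>\<^sub>2. h\<^sub>2 T \<in> flow_box i \<and>
       equal_up_to_constant_near X T (b\<^sub>2 k) (\<lambda>T. flow_coordinate i (h\<^sub>2 T) + s\<^sub>2 (h\<^sub>2 T))"
    using F2.strong_class_primitive[OF h(2) E2] unfolding X_def by blast
  define \<kappa> where "\<kappa> T = (SOME k. k \<in> K \<and> T \<in> W k)" for T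
  have \<kappa>: "\<kappa> T \<in> K" "T \<in> W (\<kappa> T)" if "T \<in> \<Omega>" for T
  proof -
    have "\<exists>k. k \<in> K \<and> T \<in> W k" using W(2) that by blast
    then have "\<kappa> T \<in> K \<and> T \<in> W (\<kappa> T)" unfolding \<kappa>_def by (rule someI_ex)
    then show "\<kappa> T \<in> K" "T \<in> W (\<kappa> T)" by auto
  qed
  \<comment> \<open>The choice of the index \<open>\<kappa> T\<close> is immaterial, as the next step shows.\<close>
  define \<sigma> where "\<sigma> T = (b\<^sub>1 (\<kappa> T) T - b\<^sub>2 (\<kappa> T) T) - (s\<^sub>1 (h\<^sub>1 T) - s\<^sub>2 (h\<^sub>2 T))" for T
  have \<sigma>: "\<sigma> T = (b\<^sub>1 k T - b\<^sub>2 k T) - (s\<^sub>1 (h\<^sub>1 T) - s\<^sub>2 (h\<^sub>2 T))" if k: "k \<in> K" "T \<in> W k" for k T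
  proof -
    have T: "T \<in> \<Omega>" using W(2) k by blast
    have "e (\<kappa> T) k T = b\<^sub>1 (\<kappa> T) T - b\<^sub>1 k T" "e (\<kappa> T) k T = b\<^sub>2 (\<kappa> T) T - b\<^sub>2 k T"
      using b\<^sub>1(1) b\<^sub>2(1) \<kappa>[OF T] k unfolding primitive_of.simps by blast+
    then have "b\<^sub>1 (\<kappa> T) T - b\<^sub>1 k T = b\<^sub>2 (\<kappa> T) T - b\<^sub>2 k T" by simp
    then have "b\<^sub>1 (\<kappa> T) T - b\<^sub>2 (\<kappa> T) T = b\<^sub>1 k T - b\<^sub>2 k T" by (simp add: algebra_simps)
    then show ?thesis unfolding \<sigma>_def by simp
  qed
  have "\<exists>i\<in>flow_boxes \<Omega>\<^sub>1. \<exists>j\<in>flow_boxes \<Omega>\<^sub>2. h\<^sub>1 T \<in> flow_box i \<and> h\<^sub>2 T \<in> flow_box j \<and>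
    equal_up_to_constant_near X T \<sigma> (\<lambda>T. flow_coordinate i (h\<^sub>1 T) - flow_coordinate j (h\<^sub>2 T))"
    if T: "T \<in> \<Omega>" for T
  proof -
    define k where "k = \<kappa> T"
    have k: "k \<in> K" "T \<in> W k" unfolding k_def by (rule \<kappa>[OF T])+
    obtain i where i: "i \<in> flow_boxes \<Omega>\<^sub>1" "h\<^sub>1 T \<in> flow_box i"
       "equal_up_to_constant_near X T (b\<^sub>1 k) (\<lambda>T. flow_coordinate i (h\<^sub>1 T) + s\<^sub>1 (h\<^sub>1 T))"
      using b\<^sub>1(2) k by blast
    obtain j where j: "j \<in> flow_boxes \<Omega>\<^sub>2" "h\<^sub>2 T \<in> flow_box j"
       "equal_up_to_constant_near X T (b\<^sub>2 k) (\<lambda>T. flow_coordinate j (h\<^sub>2 T) + s\<^sub>2 (h\<^sub>2 T))"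
      using b\<^sub>2(2) k by blast
    obtain N l where N: "openin X N" "T \<in> N" "\<forall>T\<in>N. b\<^sub>1 k T - b\<^sub>2 k T =
        (flow_coordinate i (h\<^sub>1 T) + s\<^sub>1 (h\<^sub>1 T)) - (flow_coordinate j (h\<^sub>2 T) + s\<^sub>2 (h\<^sub>2 T)) + l"
      using equal_up_to_constant_near_diff[OF i(3) j(3)] unfolding equal_up_to_constant_near_def by blast
    have "equal_up_to_constant_near X T \<sigma> (\<lambda>T. flow_coordinate i (h\<^sub>1 T) - flow_coordinate j (h\<^sub>2 T))"
      unfolding equal_up_to_constant_near_def
    proof (intro exI conjI ballI)
      show "openin X (N \<inter> W k)" using N(1) W(1) k(1) by blast
      show "T \<in> N \<inter> W k" using N(2) k(2) by blast
      fix S assume S: "S \<in> N \<inter> W k"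
      show "\<sigma> S = flow_coordinate i (h\<^sub>1 S) - flow_coordinate j (h\<^sub>2 S) + l"
      proof -
        have "b\<^sub>1 k S - b\<^sub>2 k S =
            (flow_coordinate i (h\<^sub>1 S) + s\<^sub>1 (h\<^sub>1 S)) - (flow_coordinate j (h\<^sub>2 S) + s\<^sub>2 (h\<^sub>2 S)) + l"
          using N(3) S by blast
        moreover have "\<sigma> S = (b\<^sub>1 k S - b\<^sub>2 k S) - (s\<^sub>1 (h\<^sub>1 S) - s\<^sub>2 (h\<^sub>2 S))" using \<sigma> k(1) S by blast
        ultimately show ?thesis by (simp only:) (simp add: algebra_simps)
      qed
    qed
    with i(1,2) j(1,2) show ?thesis by blast
  qed
  then show ?thesis unfolding X_def flow_potential_def by blast
qed

section \<open>Conjugacies from potentials\<close>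

lemma flow_potentialE:
  assumes "flow_potential \<Omega> \<Omega>\<^sub>1 h\<^sub>1 \<Omega>\<^sub>2 h\<^sub>2 \<sigma>" "T \<in> \<Omega>"
  obtains i j N k where "i \<in> flow_boxes \<Omega>\<^sub>1" "j \<in> flow_boxes \<Omega>\<^sub>2" "h\<^sub>1 T \<in> flow_box i" "h\<^sub>2 T \<in> flow_box j"
    "openin (tiling_topology \<Omega>) N" "T \<in> N"
    "\<forall>S\<in>N. \<sigma> S = flow_coordinate i (h\<^sub>1 S) - flow_coordinate j (h\<^sub>2 S) + k"
  using assms unfolding flow_potential_def equal_up_to_constant_near_def by meson

lemma flow_potential_swap:
  assumes "flow_potential \<Omega> \<Omega>\<^sub>1 h\<^sub>1 \<Omega>\<^sub>2 h\<^sub>2 \<sigma>"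
  shows "flow_potential \<Omega> \<Omega>\<^sub>2 h\<^sub>2 \<Omega>\<^sub>1 h\<^sub>1 (\<lambda>T. - \<sigma> T)"
  unfolding flow_potential_def
proof
  fix T assume "T \<in> \<Omega>"
  then obtain i j N k where *: "i \<in> flow_boxes \<Omega>\<^sub>1" "j \<in> flow_boxes \<Omega>\<^sub>2" "h\<^sub>1 T \<in> flow_box i" "h\<^sub>2 T \<in> flow_box j"
    "openin (tiling_topology \<Omega>) N" "T \<in> N"
    "\<forall>S\<in>N. \<sigma> S = flow_coordinate i (h\<^sub>1 S) - flow_coordinate j (h\<^sub>2 S) + k"
    by (rule flow_potentialE[OF assms])
  have "equal_up_to_constant_near (tiling_topology \<Omega>) T (\<lambda>T. - \<sigma> T)
      (\<lambda>T. flow_coordinate j (h\<^sub>2 T) - flow_coordinate i (h\<^sub>1 T))"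
    unfolding equal_up_to_constant_near_def
  proof (intro exI conjI ballI)
    show "openin (tiling_topology \<Omega>) N" "T \<in> N" by fact+
    show "- \<sigma> S = flow_coordinate j (h\<^sub>2 S) - flow_coordinate i (h\<^sub>1 S) + (- k)" if "S \<in> N" for S
      using *(7) that by simp
  qed
  with * show "\<exists>i\<in>flow_boxes \<Omega>\<^sub>2. \<exists>j\<in>flow_boxes \<Omega>\<^sub>1. h\<^sub>2 T \<in> flow_box i \<and> h\<^sub>1 T \<in> flow_box j \<and>
      equal_up_to_constant_near (tiling_topology \<Omega>) T (\<lambda>T. - \<sigma> T)
        (\<lambda>T. flow_coordinate i (h\<^sub>2 T) - flow_coordinate j (h\<^sub>1 T))"
    by blast
qed

lemma flow_potential_continuous:
  assumes "FLC_space \<Omega>\<^sub>1" "FLC_space \<Omega>\<^sub>2"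
    and h: "continuous_map (tiling_topology \<Omega>) (tiling_topology \<Omega>\<^sub>1) h\<^sub>1"
      "continuous_map (tiling_topology \<Omega>) (tiling_topology \<Omega>\<^sub>2) h\<^sub>2"
    and \<sigma>: "flow_potential \<Omega> \<Omega>\<^sub>1 h\<^sub>1 \<Omega>\<^sub>2 h\<^sub>2 \<sigma>"
  shows "continuous_map (tiling_topology \<Omega>) euclidean \<sigma>"
proof (rule continuous_map_into_metricI)
  interpret F1: FLC_space \<Omega>\<^sub>1 by fact
  interpret F2: FLC_space \<Omega>\<^sub>2 by fact
  fix T and e :: real assume T: "T \<in> topspace (tiling_topology \<Omega>)" and e: "e > 0"
  obtain i j N k where *: "i \<in> flow_boxes \<Omega>\<^sub>1" "j \<in> flow_boxes \<Omega>\<^sub>2" "h\<^sub>1 T \<in> flow_box i" "h\<^sub>2 T \<in> flow_box j"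
    "openin (tiling_topology \<Omega>) N" "T \<in> N"
    "\<forall>S\<in>N. \<sigma> S = flow_coordinate i (h\<^sub>1 S) - flow_coordinate j (h\<^sub>2 S) + k"
    using flow_potentialE[OF \<sigma>] T by (metis topspace_tiling_topology)
  have e2: "e / 2 > 0" using e by simp
  obtain N\<^sub>1 where N\<^sub>1: "openin (tiling_topology \<Omega>\<^sub>1) N\<^sub>1" "h\<^sub>1 T \<in> N\<^sub>1"
    "\<forall>S\<in>N\<^sub>1. dist (flow_coordinate i S) (flow_coordinate i (h\<^sub>1 T)) < e / 2"
    using F1.flow_coordinate_close[OF *(1,3) e2] by blast
  obtain N\<^sub>2 where N\<^sub>2: "openin (tiling_topology \<Omega>\<^sub>2) N\<^sub>2" "h\<^sub>2 T \<in> N\<^sub>2"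
    "\<forall>S\<in>N\<^sub>2. dist (flow_coordinate j S) (flow_coordinate j (h\<^sub>2 T)) < e / 2"
    using F2.flow_coordinate_close[OF *(2,4) e2] by blast
  define M where "M = N \<inter> {S \<in> topspace (tiling_topology \<Omega>). h\<^sub>1 S \<in> N\<^sub>1} \<inter> {S \<in> topspace (tiling_topology \<Omega>). h\<^sub>2 S \<in> N\<^sub>2}"
  have "openin (tiling_topology \<Omega>) M"
    unfolding M_def by (intro openin_Int *(5) openin_continuous_map_preimage[OF h(1) N\<^sub>1(1)]
        openin_continuous_map_preimage[OF h(2) N\<^sub>2(1)])
  moreover have "T \<in> M" unfolding M_def using T *(6) N\<^sub>1(2) N\<^sub>2(2) by blast
  moreover have "dist (\<sigma> S) (\<sigma> T) < e" if S: "S \<in> M" for S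
  proof -
    have d: "dist (flow_coordinate i (h\<^sub>1 S)) (flow_coordinate i (h\<^sub>1 T)) < e / 2"
      "dist (flow_coordinate j (h\<^sub>2 S)) (flow_coordinate j (h\<^sub>2 T)) < e / 2"
      using S N\<^sub>1(3) N\<^sub>2(3) unfolding M_def by blast+
    have "\<sigma> S - \<sigma> T = (flow_coordinate i (h\<^sub>1 S) - flow_coordinate i (h\<^sub>1 T)) -
        (flow_coordinate j (h\<^sub>2 S) - flow_coordinate j (h\<^sub>2 T))"
      using *(6,7) S unfolding M_def by simp
    then have "dist (\<sigma> S) (\<sigma> T) \<le> dist (flow_coordinate i (h\<^sub>1 S)) (flow_coordinate i (h\<^sub>1 T)) +
        dist (flow_coordinate j (h\<^sub>2 S)) (flow_coordinate j (h\<^sub>2 T))"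
      unfolding dist_norm by (metis norm_triangle_ineq4)
    with d show ?thesis by linarith
  qed
  ultimately show "\<exists>N. openin (tiling_topology \<Omega>) N \<and> T \<in> N \<and> (\<forall>S\<in>N. dist (\<sigma> S) (\<sigma> T) < e)"
    by blast
qed

text \<open>
  Near \<open>0\<close> both flow coordinates increase by the displacements, which gives the coboundary equation for
  small vectors.  By the cocycle property the defect of the equation is then a locally constant function of
  \<open>v\<close>, hence constant.
\<close>

lemma flow_potential_cohomologous:
  assumes "FLC_space \<Omega>\<^sub>1" "FLC_space \<Omega>\<^sub>2"
    and "orbit_homeomorphism (tiling_topology \<Omega>) (\<ominus>) (tiling_topology \<Omega>\<^sub>1) (\<ominus>) h\<^sub>1"
      "orbit_homeomorphism (tiling_topology \<Omega>) (\<ominus>) (tiling_topology \<Omega>\<^sub>2) (\<ominus>) h\<^sub>2"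
    and \<sigma>: "flow_potential \<Omega> \<Omega>\<^sub>1 h\<^sub>1 \<Omega>\<^sub>2 h\<^sub>2 \<sigma>"
  shows "cohomologous_orbit_homeomorphisms (tiling_topology \<Omega>) (\<ominus>)
    (tiling_topology \<Omega>\<^sub>1) (\<ominus>) h\<^sub>1 (tiling_topology \<Omega>\<^sub>2) (\<ominus>) h\<^sub>2 \<sigma>"
proof -
  interpret F1: FLC_space \<Omega>\<^sub>1 by fact
  interpret F2: FLC_space \<Omega>\<^sub>2 by fact
  interpret H1: orbit_homeomorphism "tiling_topology \<Omega>" "(\<ominus>)" "tiling_topology \<Omega>\<^sub>1" "(\<ominus>)" h\<^sub>1 by fact
  interpret H2: orbit_homeomorphism "tiling_topology \<Omega>" "(\<ominus>)" "tiling_topology \<Omega>\<^sub>2" "(\<ominus>)" h\<^sub>2 by fact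
  have closed: "T \<ominus> v \<in> \<Omega>" if "T \<in> \<Omega>" for T v using H1.A.act_closed that by simp
  have near: "\<exists>\<delta>>0. \<forall>v. norm v < \<delta> \<longrightarrow> H1.disp T v - H2.disp T v = \<sigma> (T \<ominus> v) - \<sigma> T"
    if T: "T \<in> \<Omega>" for T
  proof -
    obtain i j N k where *: "i \<in> flow_boxes \<Omega>\<^sub>1" "j \<in> flow_boxes \<Omega>\<^sub>2" "h\<^sub>1 T \<in> flow_box i" "h\<^sub>2 T \<in> flow_box j"
      "openin (tiling_topology \<Omega>) N" "T \<in> N"
      "\<forall>S\<in>N. \<sigma> S = flow_coordinate i (h\<^sub>1 S) - flow_coordinate j (h\<^sub>2 S) + k"
      by (rule flow_potentialE[OF \<sigma> T])
    obtain \<delta>\<^sub>1 where \<delta>\<^sub>1: "\<delta>\<^sub>1 > 0" "\<forall>w. norm w < \<delta>\<^sub>1 \<longrightarrow> flow_coordinate i (h\<^sub>1 T \<ominus> w) = flow_coordinate i (h\<^sub>1 T) + w"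
      using F1.flow_coordinate_small_translate[OF *(1,3)] by blast
    obtain \<delta>\<^sub>2 where \<delta>\<^sub>2: "\<delta>\<^sub>2 > 0" "\<forall>w. norm w < \<delta>\<^sub>2 \<longrightarrow> flow_coordinate j (h\<^sub>2 T \<ominus> w) = flow_coordinate j (h\<^sub>2 T) + w"
      using F2.flow_coordinate_small_translate[OF *(2,4)] by blast
    obtain \<eta>\<^sub>1 where \<eta>\<^sub>1: "\<eta>\<^sub>1 > 0" "\<And>S v. S \<in> topspace (tiling_topology \<Omega>) \<Longrightarrow> norm v < \<eta>\<^sub>1 \<Longrightarrow> norm (H1.disp S v) < \<delta>\<^sub>1"
      by (rule H1.disp_small[OF \<delta>\<^sub>1(1)]) (rule that)
    obtain \<eta>\<^sub>2 where \<eta>\<^sub>2: "\<eta>\<^sub>2 > 0" "\<And>S v. S \<in> topspace (tiling_topology \<Omega>) \<Longrightarrow> norm v < \<eta>\<^sub>2 \<Longrightarrow> norm (H2.disp S v) < \<delta>\<^sub>2"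
      by (rule H2.disp_small[OF \<delta>\<^sub>2(1)]) (rule that)
    have "continuous_map euclidean (tiling_topology \<Omega>) (\<lambda>v. T \<ominus> v)"
      using T by (intro H1.A.continuous_map_act) (simp_all add: continuous_map_id[unfolded id_def])
    from openin_continuous_map_preimage[OF this *(5)] have "open {v. T \<ominus> v \<in> N}" by simp
    moreover have "0 \<in> {v. T \<ominus> v \<in> N}" using *(6) by simp
    ultimately obtain \<eta>\<^sub>3 where \<eta>\<^sub>3: "\<eta>\<^sub>3 > 0" "ball 0 \<eta>\<^sub>3 \<subseteq> {v. T \<ominus> v \<in> N}" using openE by blast
    have "H1.disp T v - H2.disp T v = \<sigma> (T \<ominus> v) - \<sigma> T" if v: "norm v < min \<eta>\<^sub>1 (min \<eta>\<^sub>2 \<eta>\<^sub>3)" for v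
    proof -
      have "v \<in> ball 0 \<eta>\<^sub>3" using v by simp
      then have "T \<ominus> v \<in> N" using \<eta>\<^sub>3(2) by blast
      moreover have "flow_coordinate i (h\<^sub>1 (T \<ominus> v)) = flow_coordinate i (h\<^sub>1 T) + H1.disp T v"
        using \<delta>\<^sub>1(2) \<eta>\<^sub>1(2)[of T v] v T H1.disp_eq[of T v] by simp
      moreover have "flow_coordinate j (h\<^sub>2 (T \<ominus> v)) = flow_coordinate j (h\<^sub>2 T) + H2.disp T v"
        using \<delta>\<^sub>2(2) \<eta>\<^sub>2(2)[of T v] v T H2.disp_eq[of T v] by simp
      ultimately show ?thesis using *(6,7) by simp
    qed
    then show ?thesis using \<eta>\<^sub>1(1) \<eta>\<^sub>2(1) \<eta>\<^sub>3(1) by (intro exI[of _ "min \<eta>\<^sub>1 (min \<eta>\<^sub>2 \<eta>\<^sub>3)"]) simp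
  qed
  have "H1.disp T v - H2.disp T v = \<sigma> (T \<ominus> v) - \<sigma> T" if T: "T \<in> \<Omega>" for T v
  proof -
    define g where "g v = H1.disp T v - H2.disp T v - (\<sigma> (T \<ominus> v) - \<sigma> T)" for v
    have "g constant_on UNIV"
    proof (rule locally_constant_imp_constant)
      show "connected (UNIV :: 'a set)" by (rule connected_UNIV)
      fix u :: 'a
      obtain \<delta> where \<delta>: "\<delta> > 0" "\<forall>v. norm v < \<delta> \<longrightarrow> H1.disp (T \<ominus> u) v - H2.disp (T \<ominus> u) v = \<sigma> (T \<ominus> u \<ominus> v) - \<sigma> (T \<ominus> u)"
        using near[OF closed[OF T]] by blast
      have "g x = g u" if "x \<in> ball u \<delta>" for x
      proof -
        have "H1.disp (T \<ominus> u) (x - u) - H2.disp (T \<ominus> u) (x - u) = \<sigma> (T \<ominus> u \<ominus> (x - u)) - \<sigma> (T \<ominus> u)"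
          using \<delta>(2) that by (simp add: dist_norm norm_minus_commute)
        moreover have "H1.disp T u + H1.disp (T \<ominus> u) (x - u) = H1.disp T x"
          "H2.disp T u + H2.disp (T \<ominus> u) (x - u) = H2.disp T x"
          using H1.disp_add[of T u "x - u"] H2.disp_add[of T u "x - u"] T by simp_all
        then have "g x - g u = (H1.disp (T \<ominus> u) (x - u) - H2.disp (T \<ominus> u) (x - u)) -
            (\<sigma> (T \<ominus> u \<ominus> (x - u)) - \<sigma> (T \<ominus> u))"
          unfolding g_def by (simp add: algebra_simps)
        ultimately show ?thesis by simp
      qed
      moreover have "openin (top_of_set UNIV) (ball u \<delta>)" "u \<in> ball u \<delta>" using \<delta>(1) by simp_all
      ultimately show "\<exists>V. openin (top_of_set UNIV) V \<and> u \<in> V \<and> (\<forall>x\<in>V. g x = g u)"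
        by blast
    qed
    then have "g v = g 0" unfolding constant_on_def by auto
    also have "g 0 = 0" unfolding g_def using T by (simp add: H1.disp_zero H2.disp_zero)
    finally show ?thesis unfolding g_def by simp
  qed
  moreover have "continuous_map (tiling_topology \<Omega>) euclidean \<sigma>"
    using flow_potential_continuous[OF assms(1,2) H1.h_continuous H2.h_continuous \<sigma>] .
  ultimately show ?thesis
    by (intro cohomologous_orbit_homeomorphisms.intro cohomologous_orbit_homeomorphisms_axioms.intro assms) auto
qed

lemma (in cohomologous_orbit_homeomorphisms) swap:
  "cohomologous_orbit_homeomorphisms X a Z c h\<^sub>2 Y b h\<^sub>1 (\<lambda>x. - s x)"
proof
  show "continuous_map X euclidean (\<lambda>x. - s x)" using s_continuous by (rule continuous_map_minus)
  show "H2.disp x v - H1.disp x v = - s (a x v) - - s x" if "x \<in> topspace X" for x v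
    using s_coboundary[OF that, of v] by (simp add: algebra_simps)
qed

locale tiling_conjugacy =
  cohomologous_orbit_homeomorphisms "tiling_topology \<Omega>" "(\<ominus>)" "tiling_topology \<Omega>\<^sub>1" "(\<ominus>)" h\<^sub>1 "tiling_topology \<Omega>\<^sub>2" "(\<ominus>)" h\<^sub>2 s
  for \<Omega> :: "('a::euclidean_space, 'l::metric_space) tiling set"
    and \<Omega>\<^sub>1 :: "('a, 'l1::metric_space) tiling set" and \<Omega>\<^sub>2 :: "('a, 'l2::metric_space) tiling set"
    and h\<^sub>1 h\<^sub>2 s
begin

lemma factor_map_conj: "factor_map \<Omega>\<^sub>1 \<Omega>\<^sub>2 conj"
  unfolding factor_map_def
proof (intro conjI ballI allI)
  show "continuous_map (tiling_topology \<Omega>\<^sub>1) (tiling_topology \<Omega>\<^sub>2) conj" by (rule conj_continuous)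
  show "conj ` \<Omega>\<^sub>1 = \<Omega>\<^sub>2" using homeomorphic_imp_surjective_map[OF conj_homeomorphic] by simp
  show "conj (T \<ominus> x) = conj T \<ominus> x" if "T \<in> \<Omega>\<^sub>1" for T x using that by (simp add: conj_act)
qed

lemma topological_conjugacy_conj: "topological_conjugacy \<Omega>\<^sub>1 \<Omega>\<^sub>2 conj"
  unfolding topological_conjugacy_def using factor_map_conj conj_homeomorphic by blast

lemma shift_conj:
  "continuous_map (tiling_topology \<Omega>) euclidean shift \<and>
   homeomorphic_map (tiling_topology \<Omega>) (tiling_topology \<Omega>) (\<lambda>T. T \<ominus> shift T) \<and>
   (\<forall>T\<in>\<Omega>. h\<^sub>2 (T \<ominus> shift T) = conj (h\<^sub>1 T))"
  using shift_continuous act_shift_homeomorphic h2_act_shift by simp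

text \<open>
  Let \<open>h\<^sub>1 T\<close> and \<open>h\<^sub>1 T'\<close> agree on a large ball, with \<open>T\<close> near \<open>T\<^sub>0\<close>.  Then \<open>T'\<close> is near \<open>T\<^sub>0\<close> too, and
  \<open>h\<^sub>2 T \<ominus> z\<close> and \<open>h\<^sub>2 T' \<ominus> z'\<close> agree with \<open>h\<^sub>2 T\<^sub>0\<close> on a large ball for some small \<open>z\<close> and \<open>z'\<close>.  The first flow
  coordinates of \<open>T\<close> and \<open>T'\<close> are equal and the second ones differ by \<open>z' - z\<close>, so \<open>s T - z = s T' - z'\<close>, and
  translating by this vector gives agreement of the images.  Compactness makes the radius uniform.
\<close>

lemma local_derivation_conj:
  assumes "FLC_space \<Omega>\<^sub>1" "FLC_space \<Omega>\<^sub>2" and \<sigma>: "flow_potential \<Omega> \<Omega>\<^sub>1 h\<^sub>1 \<Omega>\<^sub>2 h\<^sub>2 s"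
  shows "local_derivation \<Omega>\<^sub>1 \<Omega>\<^sub>2 conj"
  unfolding local_derivation_def
proof (intro conjI factor_map_conj allI impI)
  interpret F1: FLC_space \<Omega>\<^sub>1 by fact
  interpret F2: FLC_space \<Omega>\<^sub>2 by fact
  fix r :: real assume "r > 0"
  define good where "good N R \<longleftrightarrow> R > 0 \<and> (\<forall>T\<in>N. \<forall>T'\<in>\<Omega>. patch (h\<^sub>1 T) 0 R = patch (h\<^sub>1 T') 0 R \<longrightarrow>
      patch (conj (h\<^sub>1 T)) 0 r = patch (conj (h\<^sub>1 T')) 0 r)" for N R
  have near: "\<exists>N R. openin (tiling_topology \<Omega>) N \<and> T\<^sub>0 \<in> N \<and> good N R" if T\<^sub>0: "T\<^sub>0 \<in> \<Omega>" for T\<^sub>0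
  proof -
    obtain i j N\<^sub>0 k where *: "i \<in> flow_boxes \<Omega>\<^sub>1" "j \<in> flow_boxes \<Omega>\<^sub>2" "h\<^sub>1 T\<^sub>0 \<in> flow_box i" "h\<^sub>2 T\<^sub>0 \<in> flow_box j"
      "openin (tiling_topology \<Omega>) N\<^sub>0" "T\<^sub>0 \<in> N\<^sub>0"
      "\<forall>S\<in>N\<^sub>0. s S = flow_coordinate i (h\<^sub>1 S) - flow_coordinate j (h\<^sub>2 S) + k"
      by (rule flow_potentialE[OF \<sigma> T\<^sub>0])
    \<comment> \<open>A bound for \<open>s T - z\<close>: one unit for the change of \<open>s\<close> near \<open>T\<^sub>0\<close>, one for the vector \<open>z\<close>.\<close>
    define B where "B = norm (s T\<^sub>0) + 2"
    have h2T\<^sub>0: "h\<^sub>2 T\<^sub>0 \<in> \<Omega>\<^sub>2" using H2.h_closed T\<^sub>0 by simp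
    obtain N\<^sub>2 where N\<^sub>2: "openin (tiling_topology \<Omega>\<^sub>2) N\<^sub>2" "h\<^sub>2 T\<^sub>0 \<in> N\<^sub>2"
      "\<forall>P\<in>N\<^sub>2. \<exists>z. norm z < 1 \<and> patch (P \<ominus> z) 0 (r + B) = patch (h\<^sub>2 T\<^sub>0) 0 (r + B) \<and>
         flow_coordinate j P = flow_coordinate j (h\<^sub>2 T\<^sub>0) - z"
      using F2.flow_coordinate_neighbourhood[OF flow_boxes_imp_flow_chart[OF *(2)] *(4) h2T\<^sub>0 zero_less_one, of "r + B"]
      by blast
    define N' where "N' = N\<^sub>0 \<inter> {T \<in> topspace (tiling_topology \<Omega>). h\<^sub>2 T \<in> N\<^sub>2} \<inter>
      {T \<in> topspace (tiling_topology \<Omega>). s T \<in> ball (s T\<^sub>0) 1}"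
    have N'_open: "openin (tiling_topology \<Omega>) N'"
      unfolding N'_def by (intro openin_Int *(5) openin_continuous_map_preimage[OF H2.h_continuous N\<^sub>2(1)]
          openin_continuous_map_preimage[OF s_continuous]) simp
    have T\<^sub>0N': "T\<^sub>0 \<in> N'" unfolding N'_def using T\<^sub>0 *(6) N\<^sub>2(2) by simp
    have N'_sub: "N' \<subseteq> \<Omega>" using openin_subset[OF N'_open] by simp
    have "openin (tiling_topology \<Omega>\<^sub>1) (h\<^sub>1 ` N')"
      using homeomorphic_imp_open_map[OF H1.h_homeomorphic] N'_open unfolding open_map_def by blast
    then obtain M R where M: "openin (tiling_topology \<Omega>\<^sub>1) M" "h\<^sub>1 T\<^sub>0 \<in> M" "M \<subseteq> h\<^sub>1 ` N'" "R > 0"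
      "\<forall>S\<in>M. \<forall>S'\<in>\<Omega>\<^sub>1. patch S 0 R = patch S' 0 R \<longrightarrow> S' \<in> h\<^sub>1 ` N' \<and> flow_coordinate i S' = flow_coordinate i S"
      using F1.patch_eq_flow_coordinate[OF *(1,3), of "h\<^sub>1 ` N'"] T\<^sub>0N' by blast
    have in_N': "T \<in> N'" if "T \<in> \<Omega>" "h\<^sub>1 T \<in> h\<^sub>1 ` N'" for T
      using that N'_sub H1.h_bij inj_on_image_mem_iff[of h\<^sub>1 \<Omega> T N'] by (simp add: bij_betw_def)
    have "patch (conj (h\<^sub>1 T)) 0 r = patch (conj (h\<^sub>1 T')) 0 r"
      if T: "T \<in> \<Omega>" "h\<^sub>1 T \<in> M" and T': "T' \<in> \<Omega>" and eq: "patch (h\<^sub>1 T) 0 R = patch (h\<^sub>1 T') 0 R" for T T'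
    proof -
      have "h\<^sub>1 T' \<in> \<Omega>\<^sub>1" using H1.h_closed T' by simp
      then have S': "h\<^sub>1 T' \<in> h\<^sub>1 ` N'" "flow_coordinate i (h\<^sub>1 T') = flow_coordinate i (h\<^sub>1 T)"
        using M(5) T(2) eq by blast+
      have N': "T \<in> N'" "T' \<in> N'" using in_N' T T' S'(1) M(3) by blast+
      obtain z where z: "norm z < 1" "patch (h\<^sub>2 T \<ominus> z) 0 (r + B) = patch (h\<^sub>2 T\<^sub>0) 0 (r + B)"
          "flow_coordinate j (h\<^sub>2 T) = flow_coordinate j (h\<^sub>2 T\<^sub>0) - z"
        using N\<^sub>2(3) N'(1) unfolding N'_def by blast
      obtain z' where z': "norm z' < 1" "patch (h\<^sub>2 T' \<ominus> z') 0 (r + B) = patch (h\<^sub>2 T\<^sub>0) 0 (r + B)"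
          "flow_coordinate j (h\<^sub>2 T') = flow_coordinate j (h\<^sub>2 T\<^sub>0) - z'"
        using N\<^sub>2(3) N'(2) unfolding N'_def by blast
      have "s T = flow_coordinate i (h\<^sub>1 T) - flow_coordinate j (h\<^sub>2 T) + k"
        "s T' = flow_coordinate i (h\<^sub>1 T') - flow_coordinate j (h\<^sub>2 T') + k"
        using *(7) N' unfolding N'_def by blast+
      then have diff: "s T' - z' = s T - z" using S'(2) z(3) z'(3) by simp
      have "norm (s T) < norm (s T\<^sub>0) + 1"
        using N'(1) norm_triangle_sub[of "s T" "s T\<^sub>0"] unfolding N'_def by (simp add: dist_norm norm_minus_commute)
      then have "norm (s T - z) \<le> B" using z(1) norm_triangle_ineq4[of "s T" z] unfolding B_def by linarith
      then have "patch (h\<^sub>2 T \<ominus> z \<ominus> (s T - z)) 0 r = patch (h\<^sub>2 T' \<ominus> z' \<ominus> (s T - z)) 0 r"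
        using z(2) z'(2) by (intro patch_eq_mono[of _ "r + B"]) simp_all
      moreover have "h\<^sub>2 T \<ominus> z \<ominus> (s T - z) = conj (h\<^sub>1 T)" using T(1) by (simp add: conj_h1)
      moreover have "h\<^sub>2 T' \<ominus> z' \<ominus> (s T - z) = conj (h\<^sub>1 T')"
        unfolding diff[symmetric] using T' by (simp add: conj_h1)
      ultimately show ?thesis by simp
    qed
    then have "good {T \<in> \<Omega>. h\<^sub>1 T \<in> M} R" unfolding good_def using M(4) by blast
    moreover have "openin (tiling_topology \<Omega>) {T \<in> \<Omega>. h\<^sub>1 T \<in> M}"
      using openin_continuous_map_preimage[OF H1.h_continuous M(1)] by simp
    ultimately show ?thesis using T\<^sub>0 M(2) by blast
  qed
  define \<N> where "\<N> = {N. openin (tiling_topology \<Omega>) N \<and> (\<exists>R. good N R)}"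
  have "\<Omega> \<subseteq> \<Union>\<N>" unfolding \<N>_def using near by blast
  moreover have "compactin (tiling_topology \<Omega>) \<Omega>" using H1.A.compact unfolding compact_space_def by simp
  moreover have "\<forall>N\<in>\<N>. openin (tiling_topology \<Omega>) N" unfolding \<N>_def by blast
  ultimately obtain F where F: "finite F" "F \<subseteq> \<N>" "\<Omega> \<subseteq> \<Union>F"
    unfolding compactin_def by meson
  have "\<forall>N\<in>F. \<exists>R. good N R" using F(2) unfolding \<N>_def by blast
  from bchoice[OF this] obtain \<rho> where \<rho>: "\<forall>N\<in>F. good N (\<rho> N)" by blast
  define R where "R = Max (insert 1 (\<rho> ` F))"
  have R: "R \<ge> 1" "\<And>N. N \<in> F \<Longrightarrow> \<rho> N \<le> R" unfolding R_def using F(1) by auto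
  have "patch (conj S) 0 r = patch (conj S') 0 r"
    if S: "S \<in> \<Omega>\<^sub>1" "S' \<in> \<Omega>\<^sub>1" and eq: "patch S 0 R = patch S' 0 R" for S S'
  proof -
    define T where "T = H1.h_inv S"
    define T' where "T' = H1.h_inv S'"
    have T: "T \<in> \<Omega>" "h\<^sub>1 T = S" "T' \<in> \<Omega>" "h\<^sub>1 T' = S'"
      using S H1.h_inv_closed H1.h_h_inv unfolding T_def T'_def by simp_all
    obtain N where N: "N \<in> F" "T \<in> N" using F(3) T(1) by blast
    have "patch S 0 (\<rho> N) = patch S' 0 (\<rho> N)"
      using patch_eq_mono[OF eq, of "\<rho> N" 0] R(2)[OF N(1)] by simp
    then show ?thesis using \<rho> N T unfolding good_def by blast
  qed
  moreover have "R > 0" using R(1) by linarith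
  ultimately show "\<exists>R>0. \<forall>S\<in>\<Omega>\<^sub>1. \<forall>S'\<in>\<Omega>\<^sub>1. patch S 0 R = patch S' 0 R \<longrightarrow> patch (conj S) 0 r = patch (conj S') 0 r"
    by blast
qed

end

lemma local_derivation_cong:
  assumes "local_derivation \<Omega> \<Omega>' f" "\<And>T. T \<in> \<Omega> \<Longrightarrow> f T = g T" "\<And>T v. T \<in> \<Omega> \<Longrightarrow> T \<ominus> v \<in> \<Omega>"
  shows "local_derivation \<Omega> \<Omega>' g"
proof -
  have f: "continuous_map (tiling_topology \<Omega>) (tiling_topology \<Omega>') f" "f ` \<Omega> = \<Omega>'"
      "\<forall>T\<in>\<Omega>. \<forall>x. f (T \<ominus> x) = f T \<ominus> x"
    "\<forall>r>0. \<exists>R>0. \<forall>T\<in>\<Omega>. \<forall>T'\<in>\<Omega>. patch T 0 R = patch T' 0 R \<longrightarrow> patch (f T) 0 r = patch (f T') 0 r"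
    using assms(1) unfolding local_derivation_def factor_map_def by blast+
  have "continuous_map (tiling_topology \<Omega>) (tiling_topology \<Omega>') g"
    by (rule continuous_map_eq[OF f(1)]) (simp add: assms(2))
  moreover have "g ` \<Omega> = \<Omega>'" unfolding f(2)[symmetric] by (rule image_cong) (simp_all add: assms(2))
  moreover have "\<forall>T\<in>\<Omega>. \<forall>x. g (T \<ominus> x) = g T \<ominus> x" using f(3) assms(2,3) by metis
  moreover have "\<forall>r>0. \<exists>R>0. \<forall>T\<in>\<Omega>. \<forall>T'\<in>\<Omega>. patch T 0 R = patch T' 0 R \<longrightarrow> patch (g T) 0 r = patch (g T') 0 r"
    using f(4) by (simp add: assms(2) cong: ball_cong)
  ultimately show ?thesis unfolding local_derivation_def factor_map_def by blast
qed

text \<open>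
  The inverse is the conjugacy for the pair \<open>h\<^sub>2\<close>, \<open>h\<^sub>1\<close> with the potential \<open>- s\<close>.
\<close>

lemma (in tiling_conjugacy) MLD_map_conj:
  assumes FLC: "FLC_space \<Omega>\<^sub>1" "FLC_space \<Omega>\<^sub>2" and \<sigma>: "flow_potential \<Omega> \<Omega>\<^sub>1 h\<^sub>1 \<Omega>\<^sub>2 h\<^sub>2 s"
  shows "MLD_map \<Omega>\<^sub>1 \<Omega>\<^sub>2 conj"
proof -
  interpret S: tiling_conjugacy \<Omega> \<Omega>\<^sub>2 \<Omega>\<^sub>1 h\<^sub>2 h\<^sub>1 "\<lambda>T. - s T"
    by (rule tiling_conjugacy.intro[OF swap])
  have "local_derivation \<Omega>\<^sub>2 \<Omega>\<^sub>1 S.conj"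
    by (rule S.local_derivation_conj[OF FLC(2,1) flow_potential_swap[OF \<sigma>]])
  then have "local_derivation \<Omega>\<^sub>2 \<Omega>\<^sub>1 (inv_into \<Omega>\<^sub>1 conj)"
  proof (rule local_derivation_cong)
    show "S.conj T = inv_into \<Omega>\<^sub>1 conj T" if "T \<in> \<Omega>\<^sub>2" for T
      using inv_into_conj[of T] that by (simp add: S.conj_def conj_inv_def)
    show "T \<ominus> v \<in> \<Omega>\<^sub>2" if "T \<in> \<Omega>\<^sub>2" for T v
      using H2.B.act_closed[of T v] that by simp
  qed
  then show ?thesis
    unfolding MLD_map_def using conj_homeomorphic local_derivation_conj[OF assms] by blast
qed

text \<open>
  Classes are sets of cocycles, so their equality is used through the member \<open>displacement h\<^sub>1\<close>.
\<close>

lemma equal_weak_classes_coboundary: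
  assumes "orbit_map (tiling_topology \<Omega>) (\<ominus>) (tiling_topology \<Omega>\<^sub>1) (\<ominus>) h\<^sub>1"
    and eq: "weak_class \<Omega> h\<^sub>1 = weak_class \<Omega> h\<^sub>2"
  shows "weak_coboundary \<Omega> (\<lambda>T v. displacement h\<^sub>1 T v - displacement h\<^sub>2 T v)"
proof -
  interpret orbit_map "tiling_topology \<Omega>" "(\<ominus>)" "tiling_topology \<Omega>\<^sub>1" "(\<ominus>)" h\<^sub>1 by fact
  have "weak_cocycle \<Omega> (displacement h\<^sub>1)"
    unfolding weak_cocycle_def displacement_eq_disp[OF assms(1)]
    using disp_continuous disp_add by simp
  moreover have "weak_coboundary \<Omega> (\<lambda>T v. displacement h\<^sub>1 T v - displacement h\<^sub>1 T v)"
    unfolding weak_coboundary_def by (intro exI[of _ "\<lambda>_. 0"]) simp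
  ultimately have "displacement h\<^sub>1 \<in> weak_class \<Omega> h\<^sub>1"
    unfolding weak_class_def weak_cohomology_class_def by simp
  then show ?thesis
    unfolding eq unfolding weak_class_def weak_cohomology_class_def by blast
qed

theorem theorem6p5:
  fixes \<Omega> :: "('a::euclidean_space, 'l::metric_space) tiling set"
    and \<Omega>\<^sub>1 :: "('a, 'l1::metric_space) tiling set"
    and \<Omega>\<^sub>2 :: "('a, 'l2::metric_space) tiling set"
    and h\<^sub>1 :: "('a, 'l) tiling \<Rightarrow> ('a, 'l1) tiling"
    and h\<^sub>2 :: "('a, 'l) tiling \<Rightarrow> ('a, 'l2) tiling"
  assumes "tiling_space \<Omega>" "minimal_space \<Omega>" "aperiodic_space \<Omega>"
    and "tiling_space \<Omega>\<^sub>1" "minimal_space \<Omega>\<^sub>1" "aperiodic_space \<Omega>\<^sub>1"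
    and "tiling_space \<Omega>\<^sub>2" "minimal_space \<Omega>\<^sub>2" "aperiodic_space \<Omega>\<^sub>2"
    and "orbit_equivalence \<Omega> \<Omega>\<^sub>1 h\<^sub>1" "orbit_equivalence \<Omega> \<Omega>\<^sub>2 h\<^sub>2"
  shows "(weak_class \<Omega> h\<^sub>1 = weak_class \<Omega> h\<^sub>2 \<longrightarrow>
            (\<exists>s \<phi>. continuous_map (tiling_topology \<Omega>) euclidean s \<and>
               homeomorphic_map (tiling_topology \<Omega>) (tiling_topology \<Omega>) (\<lambda>T. T \<ominus> s T) \<and>
               topological_conjugacy \<Omega>\<^sub>1 \<Omega>\<^sub>2 \<phi> \<and>
               (\<forall>T\<in>\<Omega>. h\<^sub>2 (T \<ominus> s T) = \<phi> (h\<^sub>1 T)))) \<and>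
         (FLC \<Omega> \<and> FLC \<Omega>\<^sub>1 \<and> FLC \<Omega>\<^sub>2 \<and>
          strong_class \<Omega> \<Omega>\<^sub>1 h\<^sub>1 = strong_class \<Omega> \<Omega>\<^sub>2 h\<^sub>2 \<longrightarrow>
            (\<exists>s \<phi>. continuous_map (tiling_topology \<Omega>) euclidean s \<and>
               homeomorphic_map (tiling_topology \<Omega>) (tiling_topology \<Omega>) (\<lambda>T. T \<ominus> s T) \<and>
               MLD_map \<Omega>\<^sub>1 \<Omega>\<^sub>2 \<phi> \<and>
               (\<forall>T\<in>\<Omega>. h\<^sub>2 (T \<ominus> s T) = \<phi> (h\<^sub>1 T))))"
proof -
  have h1: "orbit_homeomorphism (tiling_topology \<Omega>) (\<ominus>) (tiling_topology \<Omega>\<^sub>1) (\<ominus>) h\<^sub>1"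
    and h2: "orbit_homeomorphism (tiling_topology \<Omega>) (\<ominus>) (tiling_topology \<Omega>\<^sub>2) (\<ominus>) h\<^sub>2"
    using assms by (blast intro: orbit_homeomorphism_of_orbit_equivalence)+
  interpret H1: orbit_homeomorphism "tiling_topology \<Omega>" "(\<ominus>)" "tiling_topology \<Omega>\<^sub>1" "(\<ominus>)" h\<^sub>1 by (rule h1)
  interpret H2: orbit_homeomorphism "tiling_topology \<Omega>" "(\<ominus>)" "tiling_topology \<Omega>\<^sub>2" "(\<ominus>)" h\<^sub>2 by (rule h2)
  show ?thesis
  proof (intro conjI impI)
    assume "weak_class \<Omega> h\<^sub>1 = weak_class \<Omega> h\<^sub>2"
    from equal_weak_classes_coboundary[OF H1.orbit_map_axioms this]
    obtain s where s: "continuous_map (tiling_topology \<Omega>) euclidean s"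
      "\<forall>T\<in>\<Omega>. \<forall>v. H1.disp T v - H2.disp T v = s (T \<ominus> v) - s T"
      unfolding weak_coboundary_def displacement_eq_disp[OF H1.orbit_map_axioms]
        displacement_eq_disp[OF H2.orbit_map_axioms] by blast
    interpret C: tiling_conjugacy \<Omega> \<Omega>\<^sub>1 \<Omega>\<^sub>2 h\<^sub>1 h\<^sub>2 s
      by unfold_locales (use s in simp_all)
    show "\<exists>s \<phi>. continuous_map (tiling_topology \<Omega>) euclidean s \<and>
               homeomorphic_map (tiling_topology \<Omega>) (tiling_topology \<Omega>) (\<lambda>T. T \<ominus> s T) \<and>
               topological_conjugacy \<Omega>\<^sub>1 \<Omega>\<^sub>2 \<phi> \<and> (\<forall>T\<in>\<Omega>. h\<^sub>2 (T \<ominus> s T) = \<phi> (h\<^sub>1 T))"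
      using C.shift_conj C.topological_conjugacy_conj by (intro exI[of _ C.shift] exI[of _ C.conj]) blast
  next
    assume strong: "FLC \<Omega> \<and> FLC \<Omega>\<^sub>1 \<and> FLC \<Omega>\<^sub>2 \<and> strong_class \<Omega> \<Omega>\<^sub>1 h\<^sub>1 = strong_class \<Omega> \<Omega>\<^sub>2 h\<^sub>2"
    have FLC: "FLC_space \<Omega>\<^sub>1" "FLC_space \<Omega>\<^sub>2"
      using strong assms by (simp_all add: FLC_space_def)
    obtain \<sigma> where \<sigma>: "flow_potential \<Omega> \<Omega>\<^sub>1 h\<^sub>1 \<Omega>\<^sub>2 h\<^sub>2 \<sigma>"
      using equal_strong_classes_potential[OF FLC H1.h_continuous H2.h_continuous] strong by blast
    interpret C: tiling_conjugacy \<Omega> \<Omega>\<^sub>1 \<Omega>\<^sub>2 h\<^sub>1 h\<^sub>2 \<sigma>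
      by (rule tiling_conjugacy.intro[OF flow_potential_cohomologous[OF FLC h1 h2 \<sigma>]])
    show "\<exists>s \<phi>. continuous_map (tiling_topology \<Omega>) euclidean s \<and>
               homeomorphic_map (tiling_topology \<Omega>) (tiling_topology \<Omega>) (\<lambda>T. T \<ominus> s T) \<and>
               MLD_map \<Omega>\<^sub>1 \<Omega>\<^sub>2 \<phi> \<and> (\<forall>T\<in>\<Omega>. h\<^sub>2 (T \<ominus> s T) = \<phi> (h\<^sub>1 T))"
      using C.shift_conj C.MLD_map_conj[OF FLC \<sigma>] by (intro exI[of _ C.shift] exI[of _ C.conj]) blast
  qed
qed

end
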